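(* Let $\mathbf{X}=(X_t)_{t\ge 0}$ be a Lévy process in $\mathbb{R}^d$ with $X_0=0$ and with triplet $(0,\gamma,\nu)$, such that $$\int_{\|x\|<1}\|x\|^\beta\,\nu(dx)<\infty\quad\text{for some } 0\le\beta<2 .$$ Let $g:\mathbb{R}^d\to\mathbb{R}$ be a bounded Borel function and $\mu$ a finite Borel measure on $\mathbb{R}^d$, and assume that the function $r(x)=\int_{\mathbb{R}^d}g(x+y)\,\mu(dy)$ belongs to $C_b(\mathbb{R}^d)$. Let $H_g^\mu(t)=\int_{\mathbb{R}^d}\mathbb{E}^x g(X_t)\,\mu(dx)$, $t\ge 0$. Then the following hold. 1. Let $0\le\beta\le 1$. Assume that $\gamma_0=0$, where $\gamma_0=\int_{\|y\|\le 1}y\,\nu(dy)-\gamma$, and that there is a constant $C>0$ with $|r(x)-r(0)|\le C\|x\|^\beta$ for $\|x\|<1$. Then $$\lim_{t\to0^+}t^{-1}\left(H_g^\mu(t)-H_g^\mu(0)\right)=\int_{\mathbb{R}^d}(r(x)-r(0))\,\nu(dx).$$ 2. Let $1\le\beta<2$. (i) If $\mathbf{X}$ is symmetric (i.e. $\gamma=0$ and $\nu$ is symmetric) and there is a constant $C>0$ with $|r(x)+r(-x)-2r(0)|\le C\|x\|^\beta$ for $\|x\|<1$, then $$\lim_{t\to0^+}t^{-1}\left(H_g^\mu(t)-H_g^\mu(0)\right)=\frac12\int_{\mathbb{R}^d}(r(x)+r(-x)-2r(0))\,\nu(dx).$$ (ii) If $\mathbf{X}$ is arbitrary (not necessarily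 symmetric), $r$ is differentiable at $0$, and there is a constant $C>0$ with $|r(x)-r(0)-\langle x,\nabla r(0)\rangle|\le C\|x\|^\beta$ for $\|x\|<1$, then $$\lim_{t\to0^+}t^{-1}\left(H_g^\mu(t)-H_g^\mu(0)\right)=\langle\gamma,\nabla r(0)\rangle+\int_{\mathbb{R}^d}\left(r(x)-r(0)-\langle x,\nabla r(0)\rangle\mathbf{1}_{\{\|x\|\le1\}}\right)\nu(dx).$$
   Context: $\|\cdot\|$ and $\langle\cdot,\cdot\rangle$ are the Euclidean norm and scalar product. A Lévy process $\mathbf{X}$ in $\mathbb{R}^d$ with $X_0=0$ has triplet $(A,\gamma,\nu)$ if $\mathbb{E}\,e^{i\langle x,X_t\rangle}=e^{-t\psi(x)}$ with Lévy–Khintchine exponent $$\psi(x)=\langle x,Ax\rangle-i\langle x,\gamma\rangle-\int_{\mathbb{R}^d}\left(e^{i\langle x,y\rangle}-1-i\langle x,y\rangle\mathbf{1}_{\{\|y\|\le1\}}\right)\nu(dy),$$ where $A$ is a symmetric non-negative definite $d\times d$ matrix, $\gamma\in\mathbb{R}^d$, and $\nu$ is a Lévy measure: $\nu(\{0\})=0$ and $\int_{\mathbb{R}^d}(1\wedge\|y\|^2)\,\nu(dy)<\infty$. $\mathbb{P}^x,\mathbb{E}^x$ denote probability and expectation for the process started at $x$, i.e. $\mathbb{E}^xg(X_t)=\mathbb{E}\,g(x+X_t)$ with $X_0=0$. $C_b(\mathbb{R}^d)$ is the set of bounded continuous functions on $\mathbb{R}^d$. *)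

theory Defs
  imports "HOL-Probability.Probability"
begin

text \<open>The index set is \<open>{0..}\<close>; the values \<open>X t\<close> for negative \<open>t\<close> are irrelevant.\<close>

definition levy_process :: "'w measure \<Rightarrow> (real \<Rightarrow> 'w \<Rightarrow> real ^ 'd) \<Rightarrow> bool" where
  "levy_process M X \<longleftrightarrow>
     prob_space M \<and>
     (\<forall>t\<ge>0. X t \<in> borel_measurable M) \<and>
     (AE \<omega> in M. X 0 \<omega> = 0) \<and>
     (\<forall>(n::nat) (\<tau>::nat \<Rightarrow> real). 0 \<le> \<tau> 0 \<longrightarrow> (\<forall>i<n. \<tau> i < \<tau> (Suc i)) \<longrightarrow>
        prob_space.indep_vars M (\<lambda>_. borel) (\<lambda>i \<omega>. X (\<tau> (Suc i)) \<omega> - X (\<tau> i) \<omega>) {..<n}) \<and>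
     (\<forall>s\<ge>0. \<forall>t\<ge>0. distr M borel (\<lambda>\<omega>. X (s + t) \<omega> - X s \<omega>) = distr M borel (X t)) \<and>
     (\<forall>s\<ge>0. \<forall>\<epsilon>>0.
        ((\<lambda>t. measure M {\<omega> \<in> space M. norm (X t \<omega> - X s \<omega>) > \<epsilon>}) \<longlongrightarrow> 0) (at s within {0..})) \<and>
     (AE \<omega> in M.
        (\<forall>t\<ge>0. ((\<lambda>s. X s \<omega>) \<longlongrightarrow> X t \<omega>) (at_right t)) \<and>
        (\<forall>t>0. \<exists>l. ((\<lambda>s. X s \<omega>) \<longlongrightarrow> l) (at_left t)))"

definition levy_measure :: "(real ^ 'd) measure \<Rightarrow> bool" where
  "levy_measure \<nu> \<longleftrightarrow>
     sets \<nu> = sets borel \<and> emeasure \<nu> {0} = 0 \<and>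
     (\<integral>\<^sup>+ y. ennreal (min 1 ((norm y)\<^sup>2)) \<partial>\<nu>) < \<infinity>"

definition levy_exponent ::
    "real ^ 'd ^ 'd \<Rightarrow> real ^ 'd \<Rightarrow> (real ^ 'd) measure \<Rightarrow> real ^ 'd \<Rightarrow> complex" where
  "levy_exponent A \<gamma> \<nu> x =
     of_real (x \<bullet> (A *v x)) - \<i> * of_real (x \<bullet> \<gamma>)
     - (\<integral>y. (exp (\<i> * of_real (x \<bullet> y)) - 1
              - \<i> * of_real (x \<bullet> y) * indicator {y. norm y \<le> 1} y) \<partial>\<nu>)"

definition has_levy_triplet ::
    "'w measure \<Rightarrow> (real \<Rightarrow> 'w \<Rightarrow> real ^ 'd) \<Rightarrow>
     real ^ 'd ^ 'd \<Rightarrow> real ^ 'd \<Rightarrow> (real ^ 'd) measure \<Rightarrow> bool" where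
  "has_levy_triplet M X A \<gamma> \<nu> \<longleftrightarrow>
     transpose A = A \<and> (\<forall>x. 0 \<le> x \<bullet> (A *v x)) \<and> levy_measure \<nu> \<and>
     (\<forall>t\<ge>0. \<forall>x. (\<integral>\<omega>. exp (\<i> * of_real (x \<bullet> X t \<omega>)) \<partial>M)
                  = exp (- of_real t * levy_exponent A \<gamma> \<nu> x))"

definition symmetric_measure :: "(real ^ 'd) measure \<Rightarrow> bool" where
  "symmetric_measure \<nu> \<longleftrightarrow> (\<forall>B\<in>sets borel. emeasure \<nu> (uminus ` B) = emeasure \<nu> B)"

text \<open>Expectation of \<open>g (X t)\<close> for the process started at \<open>x\<close>, where \<open>X\<close> itself starts at \<open>0\<close>.\<close>

definition expectation_from ::
    "'w measure \<Rightarrow> (real \<Rightarrow> 'w \<Rightarrow> real ^ 'd) \<Rightarrow> real ^ 'd \<Rightarrow> (real ^ 'd \<Rightarrow> real) \<Rightarrow> real \<Rightarrow> real" where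
  "expectation_from M X x g t = (\<integral>\<omega>. g (x + X t \<omega>) \<partial>M)"

definition heat_content ::
    "'w measure \<Rightarrow> (real \<Rightarrow> 'w \<Rightarrow> real ^ 'd) \<Rightarrow>
     (real ^ 'd \<Rightarrow> real) \<Rightarrow> (real ^ 'd) measure \<Rightarrow> real \<Rightarrow> real" where
  "heat_content M X g \<mu> t = (\<integral>x. expectation_from M X x g t \<partial>\<mu>)"

end

theory Submission
  imports Defs
begin

text \<open>Let \<open>P t\<close> be the law of \<open>X t\<close> and \<open>psi\<close> the Levy exponent. By Fubini the increment
of the heat content is \<open>\<integral>x. r x - r 0 \<partial>P t\<close>, so the theorem describes the behaviour of
\<open>(\<integral>x. F x \<partial>P t) / t\<close> as \<open>t\<close> decreases to \<open>0\<close>, for a bounded continuous \<open>F\<close> that is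
small at the origin; the limit should be \<open>\<integral>x. F x \<partial>\<nu>\<close>. Everything is read off from the
characteristic functions \<open>exp (- t * psi \<xi>)\<close> of the laws.

Away from the origin, \<open>P t / t\<close> converges to \<open>\<nu>\<close>. Weighting with \<open>1 - cos (\<xi> \<bullet> x)\<close> turns the
characteristic function into a second difference of \<open>psi\<close>, in which drift and compensator cancel,
so the weighted measures converge to the weighted \<open>\<nu>\<close> on continuous functions of compact support
(\<open>integral_tendsto_of_charfun_compact_support\<close>, proved by Gaussian mollification). Finitely many
weights are jointly positive on an annulus (\<open>tendsto_integral_annulus\<close>), and
\<open>uniformly_small_tail\<close> controls \<open>P t / t\<close> near infinity. Hence \<open>tendsto_integral_of_small_jumps\<close>:
only the part of \<open>\<integral>x. \<bar>F x\<bar> \<partial>P t\<close> over a small ball has to be shown small compared with \<open>t\<close>.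

Near the origin, \<open>norm x powr \<beta>\<close> is at most a constant times the sum over \<open>k\<close> and the coordinate
directions \<open>b\<close> of \<open>2 powr (- \<beta> * k) * (1 - exp (- (a * (b \<bullet> x))\<^sup>2 / 2))\<close> with \<open>a\<close> proportional to \<open>2 ^ k\<close>.
The integral of each summand is a Gaussian average of \<open>1 - Re (exp (- t * psi \<xi>))\<close>, which is at most
\<open>t * Re (psi \<xi>) + (1 - cos (t * Im (psi \<xi>)))\<close>. The first terms add up to at most a constant
times \<open>t\<close> times the tail of a series that converges because \<open>norm y powr \<beta>\<close> is \<open>\<nu>\<close>-integrable near \<open>0\<close>. If
\<open>\<bar>Im (psi \<xi>)\<bar> \<le> \<eta> * norm \<xi> powr \<beta> + K\<close>, the second terms contribute at most a constant times \<open>\<eta> * t\<close>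
plus \<open>O(t\<^sup>2)\<close>. This is \<open>small_jump_moment\<close>.

What separates the cases is the growth of \<open>Im psi\<close>. Without drift it is
\<open>- (\<integral>y. sin (\<xi> \<bullet> y) \<partial>\<nu>)\<close>, so \<open>\<eta>\<close> is arbitrarily small; for \<open>\<beta> = 0\<close> the exponent is bounded and \<open>P t\<close> charges
the complement of the origin with mass \<open>O(t)\<close>. For a symmetric process \<open>Im psi\<close> vanishes, and \<open>r\<close> may be
replaced by its even part. In general \<open>r x - r 0 - sin (D \<bullet> x)\<close> is the function to treat, since
the integral of \<open>sin (D \<bullet> x)\<close> is known exactly: \<open>\<eta>\<close> is arbitrarily small if \<open>\<beta> > 1\<close>, while for \<open>\<beta> = 1\<close> a drift
only allows a fixed \<open>\<eta>\<close>, and differentiability of \<open>r\<close> at \<open>0\<close> makes up for it.\<close>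

section \<open>Convergence of characteristic functions on Euclidean space\<close>

abbreviation std_normal :: "real measure" where
  "std_normal \<equiv> std_normal_distribution"

text \<open>The standard Gaussian law, used for its self-dual characteristic function.\<close>

definition std_gaussian :: "'a::euclidean_space measure" where
  "std_gaussian = distr (\<Pi>\<^sub>M b\<in>(Basis::'a set). std_normal) borel (\<lambda>f. \<Sum>b\<in>Basis. f b *\<^sub>R b)"

lemma prob_space_std_normal: "prob_space std_normal"
  using prob_space_normal_density by auto

lemma std_gaussian_measurable:
  "(\<lambda>f. \<Sum>b\<in>(Basis::'a::euclidean_space set). f b *\<^sub>R b)
     \<in> borel_measurable (\<Pi>\<^sub>M b\<in>(Basis::'a set). std_normal)"
  by measurable

lemma sets_std_gaussian [measurable_cong, simp]: "sets std_gaussian = sets borel"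
  by (simp add: std_gaussian_def)

lemma prob_space_std_gaussian: "prob_space std_gaussian"
  unfolding std_gaussian_def
  by (intro prob_space.prob_space_distr prob_space_PiM prob_space_std_normal std_gaussian_measurable)

lemma integral_std_normal_iexp:
  "(\<integral>s. iexp (s * x) \<partial>std_normal) = exp (- (x\<^sup>2) / 2)"
  using fun_cong[OF char_std_normal_distribution, of x]
  by (simp add: char_def mult.commute)

lemma norm_square_eq_sum_Basis: "(norm z)\<^sup>2 = (\<Sum>b\<in>Basis. (z \<bullet> b)\<^sup>2)"
  for z :: "'a::euclidean_space"
  unfolding power2_norm_eq_inner by (subst euclidean_inner) (simp add: power2_eq_square)

lemma integral_std_gaussian_iexp:
  "(\<integral>\<xi>. iexp (\<xi> \<bullet> z) \<partial>std_gaussian) = exp (- (norm z)\<^sup>2 / 2)"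
proof -
  interpret product_prob_space "\<lambda>_. std_normal" Basis
    by (intro product_prob_spaceI prob_space_std_normal)
  have "(\<integral>\<xi>. iexp (\<xi> \<bullet> z) \<partial>std_gaussian)
      = (\<integral>f. iexp ((\<Sum>b\<in>Basis. f b *\<^sub>R b) \<bullet> z) \<partial>(\<Pi>\<^sub>M b\<in>Basis. std_normal))"
    unfolding std_gaussian_def by (subst integral_distr) (auto intro!: std_gaussian_measurable)
  also have "\<dots> = (\<integral>f. (\<Prod>b\<in>Basis. iexp (f b * (b \<bullet> z))) \<partial>(\<Pi>\<^sub>M b\<in>Basis. std_normal))"
    by (simp add: inner_sum_left sum_distrib_left exp_sum)
  also have "\<dots> = (\<Prod>b\<in>Basis. \<integral>s. iexp (s * (b \<bullet> z)) \<partial>std_normal)"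
    by (rule product_integral_prod)
       (auto intro!: prob_space.integrable_iexp[OF prob_space_std_normal])
  also have "\<dots> = exp (\<Sum>b\<in>Basis. - ((z \<bullet> b)\<^sup>2) / 2)"
    unfolding integral_std_normal_iexp by (simp add: exp_sum inner_commute)
  also have "(\<Sum>b\<in>Basis. - ((z \<bullet> b)\<^sup>2) / 2) = - (norm z)\<^sup>2 / 2"
    by (simp add: norm_square_eq_sum_Basis sum_negf sum_divide_distrib)
  finally show ?thesis .
qed

abbreviation charfun_of :: "'a::euclidean_space measure \<Rightarrow> 'a \<Rightarrow> complex" where
  "charfun_of M \<xi> \<equiv> \<integral>x. iexp (\<xi> \<bullet> x) \<partial>M"

lemma finite_measure_integrable_iexp:
  assumes "finite_measure M" "f \<in> borel_measurable M"
  shows "integrable M (\<lambda>x. iexp (f x))"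
  using assms by (intro finite_measure.integrable_const_bound[where B = 1]) auto

text \<open>A Gaussian is its own characteristic function, so smoothing \<open>M\<close> by a Gaussian kernel only involves
  the characteristic function of \<open>M\<close>, integrated against a fixed probability measure. This is
  what transfers pointwise convergence of characteristic functions.\<close>

lemma integral_gaussian_kernel:
  fixes M :: "'a::euclidean_space measure"
  assumes M: "finite_measure M" and sets[measurable_cong]: "sets M = sets borel"
  shows "(\<integral>x. of_real (exp (- (norm (a *\<^sub>R (y - x)))\<^sup>2 / 2)) \<partial>M)
       = (\<integral>\<xi>. iexp (a * (\<xi> \<bullet> y)) * charfun_of M (- a *\<^sub>R \<xi>) \<partial>std_gaussian)"
proof -
  interpret M: finite_measure M by fact
  interpret G: prob_space "std_gaussian :: 'a measure" by (rule prob_space_std_gaussian)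
  interpret P: pair_sigma_finite "std_gaussian :: 'a measure" M ..
  interpret PF: finite_measure "(std_gaussian :: 'a measure) \<Otimes>\<^sub>M M"
    by (rule finite_measure_pair_measure) unfold_locales
  have eq: "iexp (\<xi> \<bullet> (a *\<^sub>R (y - x))) = iexp (a * (\<xi> \<bullet> y)) * iexp ((- a *\<^sub>R \<xi>) \<bullet> x)" for \<xi> x
    by (simp add: inner_diff_right algebra_simps flip: exp_add)
  have "(\<integral>x. of_real (exp (- (norm (a *\<^sub>R (y - x)))\<^sup>2 / 2)) \<partial>M)
      = (\<integral>x. (\<integral>\<xi>. iexp (\<xi> \<bullet> (a *\<^sub>R (y - x))) \<partial>std_gaussian) \<partial>M)"
    unfolding integral_std_gaussian_iexp by simp
  also have "\<dots> = (\<integral>\<xi>. (\<integral>x. iexp (\<xi> \<bullet> (a *\<^sub>R (y - x))) \<partial>M) \<partial>std_gaussian)"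
    by (rule P.Fubini_integral)
       (unfold case_prod_beta, intro finite_measure_integrable_iexp PF.finite_measure_axioms, measurable)
  also have "\<dots> = (\<integral>\<xi>. iexp (a * (\<xi> \<bullet> y)) * charfun_of M (- a *\<^sub>R \<xi>) \<partial>std_gaussian)"
    unfolding eq by simp
  finally show ?thesis .
qed

lemma integrable_gaussian: "integrable lborel (\<lambda>u::'a::euclidean_space. exp (- (norm u)\<^sup>2 / 2))"
proof -
  have eq: "exp (- (norm u)\<^sup>2 / 2) = (\<Prod>b\<in>Basis. exp (- (u \<bullet> b)\<^sup>2 / 2))" for u :: 'a
    by (subst exp_sum[symmetric], simp)
       (simp add: norm_square_eq_sum_Basis sum_negf sum_divide_distrib)
  have fin: "(\<integral>\<^sup>+s. ennreal (exp (- s\<^sup>2 / 2)) \<partial>lborel) < \<infinity>"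
  proof -
    have "integrable lborel (\<lambda>s::real. sqrt (2 * pi) * std_normal_density s)"
      by (intro integrable_mult_right integrable_normal_density) auto
    then have "integrable lborel (\<lambda>s::real. exp (- s\<^sup>2 / 2))"
      by (simp add: std_normal_density_def)
    then show ?thesis by (simp add: integrable_iff_bounded)
  qed
  have "(\<integral>\<^sup>+u. ennreal (exp (- (norm u)\<^sup>2 / 2)) \<partial>(lborel::'a measure))
      = (\<integral>\<^sup>+u. (\<Prod>b\<in>Basis. ennreal (exp (- (u \<bullet> b)\<^sup>2 / 2))) \<partial>(lborel::'a measure))"
    unfolding eq by (simp add: prod_ennreal)
  also have "\<dots> = (\<Prod>b\<in>(Basis::'a set). \<integral>\<^sup>+s. ennreal (exp (- s\<^sup>2 / 2)) \<partial>lborel)"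
    by (rule nn_integral_lborel_prod) auto
  also have "\<dots> < \<infinity>" using fin by (simp add: ennreal_prod_eq_top less_top power_less_top_ennreal)
  finally show ?thesis by (simp add: integrable_iff_bounded)
qed

lemma gaussian_integral_pos: "0 < (\<integral>u. exp (- (norm (u::'a::euclidean_space))\<^sup>2 / 2) \<partial>lborel)"
proof -
  have "(\<integral>u. exp (- (norm (u::'a))\<^sup>2 / 2) \<partial>lborel) \<noteq> 0"
  proof
    assume "(\<integral>u. exp (- (norm (u::'a))\<^sup>2 / 2) \<partial>lborel) = 0"
    then have "AE u in (lborel::'a measure). exp (- (norm u)\<^sup>2 / 2) = 0"
      by (subst (asm) integral_nonneg_eq_0_iff_AE) (use integrable_gaussian in auto)
    then have "AE u in (lborel::'a measure). False" by simp
    then have "emeasure (lborel::'a measure) UNIV = 0"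
      by (subst (asm) AE_iff_null) (auto simp: null_sets_def)
    then show False by (simp add: emeasure_lborel_UNIV)
  qed
  moreover have "0 \<le> (\<integral>u. exp (- (norm (u::'a))\<^sup>2 / 2) \<partial>lborel)" by simp
  ultimately show ?thesis by linarith
qed

text \<open>Were the approximation not uniform, bad points \<open>x n\<close> at scale \<open>1 / Suc n\<close> would exist; the
  difference of the two sides at \<open>x n\<close> tends to \<open>0\<close> by dominated convergence, because uniform
  continuity makes the integrand small even though the base point moves.\<close>

lemma gaussian_mollification_uniform:
  fixes f :: "'a::euclidean_space \<Rightarrow> real"
  assumes uc: "uniformly_continuous_on UNIV f" and bd: "\<And>x. \<bar>f x\<bar> \<le> B" and e: "0 < e"
  shows "\<exists>a>0. \<forall>x. \<bar>(\<integral>u. f (x + a *\<^sub>R u) * exp (- (norm u)\<^sup>2 / 2) \<partial>lborel)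
            - f x * (\<integral>u. exp (- (norm (u::'a))\<^sup>2 / 2) \<partial>lborel)\<bar> \<le> e"
proof (rule ccontr)
  let ?k = "\<lambda>u::'a. exp (- (norm u)\<^sup>2 / 2)"
  assume none: "\<not> ?thesis"
  have "\<exists>x. \<bar>(\<integral>u. f (x + (1 / Suc n) *\<^sub>R u) * ?k u \<partial>lborel) - f x * (\<integral>u. ?k u \<partial>lborel)\<bar> > e" for n :: nat
  proof -
    have "0 < 1 / real (Suc n)" by simp
    then show ?thesis using none unfolding not_ex not_all not_le de_Morgan_conj by blast
  qed
  then have "\<exists>x. \<forall>n. \<bar>(\<integral>u. f (x n + (1 / Suc n) *\<^sub>R u) * ?k u \<partial>lborel) - f (x n) * (\<integral>u. ?k u \<partial>lborel)\<bar> > e"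
    by (intro choice allI)
  then obtain x where x: "\<And>n. \<bar>(\<integral>u. f (x n + (1 / Suc n) *\<^sub>R u) * ?k u \<partial>lborel) - f (x n) * (\<integral>u. ?k u \<partial>lborel)\<bar> > e"
    by blast
  have B0: "0 \<le> B" using bd[of 0] by linarith
  have cont: "continuous_on UNIV f" using uc by (rule uniformly_continuous_imp_continuous)
  note [measurable] = borel_measurable_continuous_onI[OF cont]
  have int1: "integrable lborel (\<lambda>u. f (x n + (1 / Suc n) *\<^sub>R u) * ?k u)" for n
    by (rule Bochner_Integration.integrable_bound[OF integrable_mult_right[OF integrable_gaussian, of B]])
       (auto simp: abs_mult B0 bd intro!: mult_right_mono)
  have int2: "integrable lborel (\<lambda>u. f (x n) * ?k u)" for n
    by (intro integrable_mult_right integrable_gaussian)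
  have eq: "(\<integral>u. f (x n + (1 / Suc n) *\<^sub>R u) * ?k u \<partial>lborel) - f (x n) * (\<integral>u. ?k u \<partial>lborel)
      = (\<integral>u. (f (x n + (1 / Suc n) *\<^sub>R u) - f (x n)) * ?k u \<partial>lborel)" for n
    using int1 int2 by (simp add: left_diff_distrib)
  have "(\<lambda>n. \<integral>u. (f (x n + (1 / Suc n) *\<^sub>R u) - f (x n)) * ?k u \<partial>lborel) \<longlonglongrightarrow> (\<integral>u. 0 \<partial>(lborel :: 'a measure))"
  proof (rule integral_dominated_convergence[where w = "\<lambda>u. 2 * B * ?k u"])
    show "integrable lborel (\<lambda>u. 2 * B * ?k u)" by (intro integrable_mult_right integrable_gaussian)
    show "AE u in lborel. norm ((f (x n + (1 / Suc n) *\<^sub>R u) - f (x n)) * ?k u) \<le> 2 * B * ?k u" for n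
    proof (intro AE_I2)
      fix u
      have "\<bar>f (x n + (1 / Suc n) *\<^sub>R u) - f (x n)\<bar> \<le> 2 * B"
        using bd[of "x n + (1 / Suc n) *\<^sub>R u"] bd[of "x n"] by linarith
      then show "norm ((f (x n + (1 / Suc n) *\<^sub>R u) - f (x n)) * ?k u) \<le> 2 * B * ?k u"
        by (simp add: abs_mult mult_right_mono)
    qed
    show "AE u in lborel. (\<lambda>n. (f (x n + (1 / Suc n) *\<^sub>R u) - f (x n)) * ?k u) \<longlonglongrightarrow> 0"
    proof (intro AE_I2 tendsto_mult_left_zero)
      fix u :: 'a
      show "(\<lambda>n. f (x n + (1 / Suc n) *\<^sub>R u) - f (x n)) \<longlonglongrightarrow> 0"
      proof (rule LIMSEQ_I)
        fix r :: real assume "0 < r"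
        then obtain d where d: "d > 0" "\<And>y z. dist z y < d \<Longrightarrow> dist (f z) (f y) < r"
          using uc unfolding uniformly_continuous_on_def by (metis UNIV_I)
        have "(\<lambda>n. norm ((1 / Suc n) *\<^sub>R u)) \<longlonglongrightarrow> 0"
        proof -
          have "(\<lambda>n. inverse (real (Suc n)) *\<^sub>R u) \<longlonglongrightarrow> 0 *\<^sub>R u"
            by (intro tendsto_scaleR tendsto_const LIMSEQ_inverse_real_of_nat)
          then have "(\<lambda>n. (1 / Suc n) *\<^sub>R u) \<longlonglongrightarrow> 0" by (simp add: inverse_eq_divide)
          then show ?thesis by (rule tendsto_norm_zero)
        qed
        then have "\<forall>\<^sub>F n in sequentially. norm ((1 / Suc n) *\<^sub>R u) < d"
          using d(1) by (rule order_tendstoD)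
        then have "\<forall>\<^sub>F n in sequentially. norm (f (x n + (1 / Suc n) *\<^sub>R u) - f (x n) - 0) < r"
          by eventually_elim (use d(2) in \<open>force simp: dist_norm\<close>)
        then show "\<exists>no. \<forall>n\<ge>no. norm (f (x n + (1 / Suc n) *\<^sub>R u) - f (x n) - 0) < r"
          by (simp add: eventually_sequentially)
      qed
    qed
  qed auto
  then have "\<forall>\<^sub>F n in sequentially. \<bar>\<integral>u. (f (x n + (1 / Suc n) *\<^sub>R u) - f (x n)) * ?k u \<partial>lborel\<bar> < e"
    using e by (auto dest!: tendstoD simp: dist_norm)
  then obtain n where "\<bar>\<integral>u. (f (x n + (1 / Suc n) *\<^sub>R u) - f (x n)) * ?k u \<partial>lborel\<bar> < e"
    by (meson eventually_happens trivial_limit_sequentially)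
  with x[of n] eq[of n] show False by simp
qed

lemma integral_lborel_affine:
  fixes h :: "'a::euclidean_space \<Rightarrow> real"
  assumes a: "0 < a" and [measurable]: "h \<in> borel_measurable borel"
  shows "(\<integral>y. h y \<partial>lborel) = a ^ DIM('a) * (\<integral>u. h (x + a *\<^sub>R u) \<partial>lborel)"
proof -
  have "(\<integral>y. h y \<partial>lborel)
      = (\<integral>y. h y \<partial>density (distr lborel borel (\<lambda>u. x + a *\<^sub>R u)) (\<lambda>_. ennreal (\<bar>a\<bar> ^ DIM('a))))"
    using lborel_affine[of a x] a by simp
  also have "\<dots> = a ^ DIM('a) * (\<integral>u. h (x + a *\<^sub>R u) \<partial>lborel)"
    using a by (subst integral_density) (auto simp: integral_distr)
  finally show ?thesis .
qed

lemma continuous_compact_support_uniform: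
  fixes f :: "'a::euclidean_space \<Rightarrow> real"
  assumes cont: "continuous_on UNIV f" and supp: "\<And>x. R \<le> norm x \<Longrightarrow> f x = 0"
  shows "uniformly_continuous_on UNIV f" "\<exists>B. \<forall>x. \<bar>f x\<bar> \<le> B"
proof -
  have "compact (cball (0::'a) (R + 1))" by simp
  then have uc: "uniformly_continuous_on (cball 0 (R + 1)) f"
    by (intro compact_uniformly_continuous continuous_on_subset[OF cont]) auto
  show "uniformly_continuous_on UNIV f"
    unfolding uniformly_continuous_on_def
  proof (intro allI impI)
    fix e :: real assume "0 < e"
    then obtain d where d: "d > 0" "\<And>y z. y \<in> cball 0 (R + 1) \<Longrightarrow> z \<in> cball 0 (R + 1) \<Longrightarrow> dist z y < d \<Longrightarrow> dist (f z) (f y) < e"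
      using uc unfolding uniformly_continuous_on_def by metis
    have "dist (f z) (f y) < e" if "dist z y < min d 1" for y z
    proof (cases "norm y \<le> R + 1 \<and> norm z \<le> R + 1")
      case True then show ?thesis using d(2)[of y z] that by simp
    next
      case False
      have "norm z \<le> norm y + dist z y" "norm y \<le> norm z + dist z y"
        using norm_triangle_ineq[of y "z - y"] norm_triangle_ineq[of z "y - z"]
        by (auto simp: dist_norm norm_minus_commute)
      with False that have "R \<le> norm y" "R \<le> norm z" by auto
      then show ?thesis using supp \<open>0 < e\<close> by simp
    qed
    then show "\<exists>d>0. \<forall>x\<in>UNIV. \<forall>x'\<in>UNIV. dist x' x < d \<longrightarrow> dist (f x') (f x) < e"
      using d(1) by (intro exI[of _ "min d 1"]) auto
  qed
  have "bounded (f ` cball 0 (R + 1))"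
    by (intro compact_imp_bounded compact_continuous_image continuous_on_subset[OF cont]) auto
  then obtain B where B: "\<And>x. norm x \<le> R + 1 \<Longrightarrow> \<bar>f x\<bar> \<le> B"
 
    by (auto simp: bounded_iff) (metis mem_cball_0)
  have "\<bar>f x\<bar> \<le> max B 0" for x
    using B[of x] supp[of x] by (cases "norm x \<le> R + 1") auto
  then show "\<exists>B. \<forall>x. \<bar>f x\<bar> \<le> B" by blast
qed

text \<open>Both integrations commute, which moves the smoothing from \<open>f\<close> to the measure.\<close>

lemma integral_mollified:
  fixes M :: "'a::euclidean_space measure" and f :: "'a \<Rightarrow> real"
  assumes M: "finite_measure M" and sets[measurable_cong]: "sets M = sets borel"
    and a: "0 < a" and [measurable]: "f \<in> borel_measurable borel" and int: "integrable lborel f"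
  shows "(\<integral>x. (\<integral>u. f (x + a *\<^sub>R u) * exp (- (norm u)\<^sup>2 / 2) \<partial>lborel) \<partial>M)
       = (\<integral>y. f y * (\<integral>x. exp (- (norm ((1 / a) *\<^sub>R (y - x)))\<^sup>2 / 2) \<partial>M) \<partial>lborel) / a ^ DIM('a)"
proof -
  interpret M: finite_measure M by fact
  interpret P: pair_sigma_finite M "lborel :: 'a measure" ..
  let ?k = "\<lambda>u::'a. exp (- (norm u)\<^sup>2 / 2)"
  let ?h = "\<lambda>x y. f y * ?k ((1 / a) *\<^sub>R (y - x))"
  have "(\<integral>u. f (x + a *\<^sub>R u) * ?k u \<partial>lborel) = (\<integral>y. ?h x y \<partial>lborel) / a ^ DIM('a)" for x
    using integral_lborel_affine[OF a, of "?h x" x] a by simp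
  then have "(\<integral>x. (\<integral>u. f (x + a *\<^sub>R u) * ?k u \<partial>lborel) \<partial>M)
      = (\<integral>x. (\<integral>y. ?h x y \<partial>lborel) \<partial>M) / a ^ DIM('a)"
    by simp
  also have "(\<integral>x. (\<integral>y. ?h x y \<partial>lborel) \<partial>M) = (\<integral>y. (\<integral>x. ?h x y \<partial>M) \<partial>lborel)"
  proof (rule P.Fubini_integral[symmetric])
    have "integrable (M \<Otimes>\<^sub>M lborel) (\<lambda>(x, y). f y)"
      by (rule P.Fubini_integrable) (use int in \<open>auto simp: case_prod_beta M.integrable_const\<close>)
    then show "integrable (M \<Otimes>\<^sub>M lborel) (\<lambda>(x, y). ?h x y)"
      by (rule Bochner_Integration.integrable_bound)
         (auto simp: case_prod_beta abs_mult intro!: mult_left_le)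
  qed
  finally show ?thesis by simp
qed

text \<open>Continuity theorem on a Euclidean space. Gaussian smoothings of the measures converge pointwise,
  since they are averages of the characteristic functions; hence the integrals of a mollified \<open>f\<close>
  converge, and mollification moves \<open>f\<close> by a uniformly small amount while the total masses stay bounded.\<close>

lemma integral_tendsto_of_charfun_compact_support:
  fixes M :: "nat \<Rightarrow> 'a::euclidean_space measure" and L :: "'a measure" and f :: "'a \<Rightarrow> real"
  assumes M: "\<And>n. finite_measure (M n)" "\<And>n. sets (M n) = sets borel"
    and L: "finite_measure L" "sets L = sets borel"
    and char: "\<And>\<xi>. (\<lambda>n. charfun_of (M n) \<xi>) \<longlonglongrightarrow> charfun_of L \<xi>"
    and cont: "continuous_on UNIV f" and supp: "\<And>x. R \<le> norm x \<Longrightarrow> f x = 0"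
  shows "(\<lambda>n. \<integral>x. f x \<partial>M n) \<longlonglongrightarrow> (\<integral>x. f x \<partial>L)"
proof -
  note [measurable_cong] = M(2) L(2)
  note f_measurable[measurable] = borel_measurable_continuous_onI[OF cont]
  obtain B where bd: "\<And>x. \<bar>f x\<bar> \<le> B"
    using continuous_compact_support_uniform(2)[OF cont supp] by blast
  have B0: "0 \<le> B" using bd[of 0] by linarith
  have uc: "uniformly_continuous_on UNIV f"
    by (rule continuous_compact_support_uniform(1)[OF cont supp])
  let ?k = "\<lambda>u::'a. exp (- (norm u)\<^sup>2 / 2)"
  define Z where "Z = (\<integral>u. ?k u \<partial>lborel)"
  have Z: "Z > 0" unfolding Z_def by (rule gaussian_integral_pos)
  define mo where "mo a x = (\<integral>u. f (x + a *\<^sub>R u) * ?k u \<partial>lborel)" for a x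
  have space: "space (M n) = UNIV" "space L = UNIV" for n
    using sets_eq_imp_space_eq[OF M(2)] sets_eq_imp_space_eq[OF L(2)] by auto
  have mass: "(\<lambda>n. measure (M n) UNIV) \<longlonglongrightarrow> measure L UNIV"
    using tendsto_Re[OF char[of 0]] by (simp add: space)
  then obtain m where m: "\<And>n. measure (M n) UNIV \<le> m"
    using convergent_imp_Bseq[OF convergentI[OF mass]] unfolding Bseq_def real_norm_def abs_le_iff by blast
  have mL: "measure L UNIV \<le> m"
    by (rule LIMSEQ_le_const2[OF mass]) (use m in auto)
  have int_f: "integrable lborel f"
  proof (rule Bochner_Integration.integrable_bound)
    show "integrable lborel (\<lambda>x. B * indicator (cball 0 R) x)"
      by (intro integrable_mult_right integrable_real_indicator emeasure_bounded_finite) auto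
    show "AE x in lborel. norm (f x) \<le> norm (B * indicator (cball 0 R) x)"
      by (intro AE_I2) (simp add: indicator_def B0 bd supp)
  qed auto
  have kernel: "(\<lambda>n. \<integral>x. ?k (c *\<^sub>R (y - x)) \<partial>M n) \<longlonglongrightarrow> (\<integral>x. ?k (c *\<^sub>R (y - x)) \<partial>L)" for c y
  proof -
    interpret G: prob_space "std_gaussian :: 'a measure" by (rule prob_space_std_gaussian)
    have "(\<lambda>n. \<integral>\<xi>. iexp (c * (\<xi> \<bullet> y)) * charfun_of (M n) (- c *\<^sub>R \<xi>) \<partial>std_gaussian)
      \<longlonglongrightarrow> (\<integral>\<xi>. iexp (c * (\<xi> \<bullet> y)) * charfun_of L (- c *\<^sub>R \<xi>) \<partial>std_gaussian)"
    proof (rule integral_dominated_convergence[where w = "\<lambda>_. m"])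
      show "AE \<xi> in std_gaussian. norm (iexp (c * (\<xi> \<bullet> y)) * charfun_of (M n) (- c *\<^sub>R \<xi>)) \<le> m" for n
      proof (intro AE_I2)
        fix \<xi> :: 'a
        have "norm (charfun_of (M n) (- c *\<^sub>R \<xi>)) \<le> (\<integral>x. norm (iexp ((- c *\<^sub>R \<xi>) \<bullet> x)) \<partial>M n)"
          by (rule integral_norm_bound)
        also have "\<dots> \<le> m" using m[of n] by (simp add: space)
        finally show "norm (iexp (c * (\<xi> \<bullet> y)) * charfun_of (M n) (- c *\<^sub>R \<xi>)) \<le> m"
          by (simp add: norm_mult)
      qed
      show "(\<lambda>\<xi>. iexp (c * (\<xi> \<bullet> y)) * charfun_of (M n) (- c *\<^sub>R \<xi>)) \<in> borel_measurable std_gaussian" for n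
      proof -
        interpret finite_measure "M n" by (rule M)
        show ?thesis by measurable
      qed
      show "(\<lambda>\<xi>. iexp (c * (\<xi> \<bullet> y)) * charfun_of L (- c *\<^sub>R \<xi>)) \<in> borel_measurable std_gaussian"
      proof -
        interpret finite_measure L by (rule L)
        show ?thesis by measurable
      qed
    qed (auto intro!: AE_I2 tendsto_mult tendsto_const char simp del: scaleR_minus_left inner_minus_left inner_scaleR_left)
    then have "(\<lambda>n. \<integral>x. complex_of_real (?k (c *\<^sub>R (y - x))) \<partial>M n) \<longlonglongrightarrow> (\<integral>x. complex_of_real (?k (c *\<^sub>R (y - x))) \<partial>L)"
      unfolding integral_gaussian_kernel[OF M] integral_gaussian_kernel[OF L] .
    from tendsto_Re[OF this] show ?thesis by simp
  qed
  have mo: "(\<lambda>n. \<integral>x. mo a x \<partial>M n) \<longlonglongrightarrow> (\<integral>x. mo a x \<partial>L)" if a: "0 < a" for a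
  proof -
    have "(\<lambda>n. \<integral>y. f y * (\<integral>x. ?k ((1 / a) *\<^sub>R (y - x)) \<partial>M n) \<partial>lborel)
        \<longlonglongrightarrow> (\<integral>y. f y * (\<integral>x. ?k ((1 / a) *\<^sub>R (y - x)) \<partial>L) \<partial>lborel)"
    proof (rule integral_dominated_convergence[where w = "\<lambda>y. \<bar>f y\<bar> * m"])
      show "AE y in lborel. norm (f y * (\<integral>x. ?k ((1 / a) *\<^sub>R (y - x)) \<partial>M n)) \<le> \<bar>f y\<bar> * m" for n
      proof (intro AE_I2)
        fix y
        interpret finite_measure "M n" by (rule M)
        have "(\<integral>x. ?k ((1 / a) *\<^sub>R (y - x)) \<partial>M n) \<le> (\<integral>x. 1 \<partial>M n)"
          by (intro integral_mono integrable_const_bound[where B = 1]) auto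
        also have "\<dots> \<le> m" using m[of n] by (simp add: space)
        finally show "norm (f y * (\<integral>x. ?k ((1 / a) *\<^sub>R (y - x)) \<partial>M n)) \<le> \<bar>f y\<bar> * m"
          by (simp add: abs_mult mult_left_mono)
      qed
      show "(\<lambda>y. f y * (\<integral>x. ?k ((1 / a) *\<^sub>R (y - x)) \<partial>M n)) \<in> borel_measurable lborel" for n
      proof -
        interpret finite_measure "M n" by (rule M)
        show ?thesis by measurable
      qed
      show "(\<lambda>y. f y * (\<integral>x. ?k ((1 / a) *\<^sub>R (y - x)) \<partial>L)) \<in> borel_measurable lborel"
      proof -
        interpret finite_measure L by (rule L)
        show ?thesis by measurable
      qed
      show "AE y in lborel. (\<lambda>n. f y * (\<integral>x. ?k ((1 / a) *\<^sub>R (y - x)) \<partial>M n))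
          \<longlonglongrightarrow> f y * (\<integral>x. ?k ((1 / a) *\<^sub>R (y - x)) \<partial>L)"
        by (intro AE_I2 tendsto_mult tendsto_const kernel)
      show "integrable lborel (\<lambda>y. \<bar>f y\<bar> * m)"
        by (intro integrable_mult_left integrable_abs int_f)
    qed
    then show ?thesis
      unfolding mo_def integral_mollified[OF M a f_measurable int_f] integral_mollified[OF L a f_measurable int_f]
      using a by (intro tendsto_divide tendsto_const) auto
  qed
  have close: "\<bar>(\<integral>x. mo a x \<partial>Q) - Z * (\<integral>x. f x \<partial>Q)\<bar> \<le> e * m"
    if Q: "finite_measure Q" "sets Q = sets borel" "measure Q UNIV \<le> m" and e: "0 < e"
      and a: "\<And>x. \<bar>mo a x - f x * Z\<bar> \<le> e" for Q e a
  proof -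
    interpret finite_measure Q by fact
    note [measurable_cong] = Q(2)
    have sp: "space Q = UNIV" using sets_eq_imp_space_eq[OF Q(2)] by simp
    have [measurable]: "mo a \<in> borel_measurable borel" unfolding mo_def by measurable
    have i1: "integrable Q f" by (rule integrable_const_bound[where B = B]) (use bd in auto)
    have "\<bar>mo a x\<bar> \<le> B * Z + e" for x
    proof -
      have "\<bar>f x * Z\<bar> \<le> B * Z" using bd[of x] Z by (simp add: abs_mult)
      then show ?thesis using a[of x] by linarith
    qed
    then have i2: "integrable Q (mo a)" by (intro integrable_const_bound[where B = "B * Z + e"]) auto
    have "(\<integral>x. mo a x \<partial>Q) - Z * (\<integral>x. f x \<partial>Q) = (\<integral>x. mo a x - f x * Z \<partial>Q)"
      using i1 i2 by simp
    also have "\<bar>\<dots>\<bar> \<le> (\<integral>x. \<bar>mo a x - f x * Z\<bar> \<partial>Q)" by (rule integral_abs_bound)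
    also have "\<dots> \<le> (\<integral>x. e \<partial>Q)" using i1 i2 a by (intro integral_mono) auto
    also have "\<dots> \<le> e * m" using Q(3) e by (simp add: sp)
    finally show ?thesis .
  qed
  have m0: "0 \<le> m" using mL measure_nonneg[of L UNIV] by linarith
  show ?thesis
  proof (rule LIMSEQ_I)
    fix r :: real assume r: "0 < r"
    define e where "e = r * Z / (4 * (m + 1))"
    have e: "0 < e" using r Z m0 by (simp add: e_def)
    obtain a where a: "0 < a" "\<And>x. \<bar>mo a x - f x * Z\<bar> \<le> e"
      using gaussian_mollification_uniform[OF uc bd e] unfolding mo_def Z_def by blast
    have em: "e * m \<le> r * Z / 4"
      using r Z m0 by (simp add: e_def field_simps)
    have "\<forall>\<^sub>F n in sequentially. \<bar>(\<integral>x. mo a x \<partial>M n) - (\<integral>x. mo a x \<partial>L)\<bar> < r * Z / 4"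
      using tendstoD[OF mo[OF a(1)], of "r * Z / 4"] r Z by (simp add: dist_norm)
    then have "\<forall>\<^sub>F n in sequentially. norm ((\<integral>x. f x \<partial>M n) - (\<integral>x. f x \<partial>L)) < r"
    proof eventually_elim
      case (elim n)
      have "\<bar>Z * (\<integral>x. f x \<partial>M n) - Z * (\<integral>x. f x \<partial>L)\<bar> < r * Z"
        using elim close[OF M m e a(2), of n] close[OF L mL e a(2)] em r Z mult_pos_pos[OF r Z] by linarith
      then have "Z * \<bar>(\<integral>x. f x \<partial>M n) - (\<integral>x. f x \<partial>L)\<bar> < Z * r"
        using Z by (simp add: abs_mult mult.commute flip: right_diff_distrib)
      then show ?case using Z by simp
    qed
    then show "\<exists>no. \<forall>n\<ge>no. norm ((\<integral>x. f x \<partial>M n) - (\<integral>x. f x \<partial>L)) < r"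
      by (simp add: eventually_sequentially)
  qed
qed

text \<open>Uniqueness: the continuity theorem for constant sequences, extended from compact support by
  cut-off functions.\<close>

lemma integral_eq_of_charfun_eq:
  fixes M L :: "'a::euclidean_space measure" and f :: "'a \<Rightarrow> real"
  assumes M: "finite_measure M" "sets M = sets borel"
    and L: "finite_measure L" "sets L = sets borel"
    and char: "\<And>\<xi>. charfun_of M \<xi> = charfun_of L \<xi>"
    and cont: "continuous_on UNIV f" and bd: "\<And>x. \<bar>f x\<bar> \<le> B"
  shows "(\<integral>x. f x \<partial>M) = (\<integral>x. f x \<partial>L)"
proof -
  let ?\<kappa> = "\<lambda>n::nat. \<lambda>x::'a. max 0 (min 1 (real n - norm x))"
  note [measurable_cong] = M(2) L(2)
  note [measurable] = borel_measurable_continuous_onI[OF cont]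
  have eq: "(\<integral>x. f x * ?\<kappa> n x \<partial>M) = (\<integral>x. f x * ?\<kappa> n x \<partial>L)" for n
  proof -
    have "(\<lambda>_::nat. \<integral>x. f x * ?\<kappa> n x \<partial>M) \<longlonglongrightarrow> (\<integral>x. f x * ?\<kappa> n x \<partial>L)"
      by (rule integral_tendsto_of_charfun_compact_support[where R = "real n"])
         (use M L char cont in \<open>auto intro!: continuous_intros\<close>)
    then show ?thesis by (simp add: LIMSEQ_const_iff)
  qed
  have lim: "(\<lambda>n. \<integral>x. f x * ?\<kappa> n x \<partial>Q) \<longlonglongrightarrow> (\<integral>x. f x \<partial>Q)"
    if Q: "finite_measure Q" "sets Q = sets borel" for Q
  proof (rule integral_dominated_convergence[where w = "\<lambda>_. B"])
    interpret finite_measure Q by fact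
    note [measurable_cong] = Q(2)
    show "f \<in> borel_measurable Q" "\<And>n. (\<lambda>x. f x * ?\<kappa> n x) \<in> borel_measurable Q" by measurable
    show "integrable Q (\<lambda>_. B)" by simp
    show "AE x in Q. norm (f x * ?\<kappa> n x) \<le> B" for n
    proof (intro AE_I2)
      fix x
      have "\<bar>f x\<bar> * \<bar>?\<kappa> n x\<bar> \<le> \<bar>f x\<bar> * 1" by (rule mult_left_mono) auto
      then show "norm (f x * ?\<kappa> n x) \<le> B" using bd[of x] by (simp add: abs_mult)
    qed
    show "AE x in Q. (\<lambda>n. f x * ?\<kappa> n x) \<longlonglongrightarrow> f x"
    proof (intro AE_I2 tendsto_eventually)
      fix x :: 'a
      have "\<forall>\<^sub>F n in sequentially. norm x + 1 \<le> real n"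
        using filterlim_real_sequentially unfolding filterlim_at_top by blast
      then show "\<forall>\<^sub>F n in sequentially. f x * ?\<kappa> n x = f x"
        by eventually_elim auto
    qed
  qed
  show ?thesis
    using LIMSEQ_unique[OF lim[OF M]] lim[OF L] unfolding eq by blast
qed

section \<open>Elementary inequalities\<close>

text \<open>The terms grow geometrically while \<open>2 ^ k * \<tau> < 1\<close>, because \<open>\<beta> < p\<close>, and decay geometrically
  afterwards, so the sum is comparable to its largest term, at \<open>2 ^ k\<close> about \<open>1 / \<tau>\<close>.\<close>

lemma dyadic_sum_min_powr_le:
  fixes \<beta> p :: real
  assumes \<beta>: "0 < \<beta>" and p: "\<beta> < p"
  shows "\<exists>C>0. \<forall>n. \<forall>\<tau>>0. (\<Sum>k<n. 2 powr (- \<beta> * real k) * min 1 ((2 ^ k * \<tau>) powr p)) \<le> C * \<tau> powr \<beta>"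
proof -
  define q where "q = 2 powr (- \<beta>)"
  define B where "B = 1 / (2 powr (p - \<beta>) - 1)"
  define C where "C = 1 / (1 - q)"
  define A where "A = (C + 1 + B) * 2 powr \<beta>"
  define g where "g \<tau> = (if \<tau> \<le> 1 then A * \<tau> powr \<beta> - B * \<tau> powr p else C)" for \<tau>
  have q: "0 < q" "q < 1" using \<beta> powr_less_one[of 2 "- \<beta>"] by (auto simp: q_def)
  have b2: "1 < 2 powr (p - \<beta>)" using p by simp
  then have "0 < 2 powr (p - \<beta>) - 1" by simp
  then have "0 < B" "(2 powr (p - \<beta>) - 1) * B = 1" using p by (simp_all add: B_def)
  then have B: "0 < B" "2 powr (p - \<beta>) * B = B + 1" by (simp_all add: left_diff_distrib)
  have C: "0 < C" "1 + q * C = C" using q by (auto simp: C_def field_simps)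
  have "1 \<le> 2 powr \<beta>" using \<beta> by (intro ge_one_powr_ge_zero) auto
  then have A: "C + 1 + B \<le> A" using B C by (simp add: A_def)
  have powle: "\<tau> powr p \<le> \<tau> powr \<beta>" if "0 < \<tau>" "\<tau> \<le> 1" for \<tau> :: real
    using that p by (intro powr_mono') auto
  have qk: "2 powr (- \<beta> * real k) = q ^ k" for k
    by (simp add: q_def powr_power mult.commute)
  \<comment> \<open>\<open>g\<close> is a supersolution of the recursion \<open>S \<tau> = min 1 (\<tau> powr p) + q * S (2 * \<tau>)\<close>\<close>
  have main: "(\<Sum>k<n. q ^ k * min 1 ((2 ^ k * \<tau>) powr p)) \<le> g \<tau>" if "0 < \<tau>" for n \<tau>
    using that
  proof (induction n arbitrary: \<tau>)
    case 0
    have "B * \<tau> powr p \<le> A * \<tau> powr \<beta>" if "\<tau> \<le> 1"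
      using powle[OF 0 that] A B C by (intro mult_mono) auto
    then show ?case using C by (simp add: g_def)
  next
    case (Suc n)
    have "(\<Sum>k<Suc n. q ^ k * min 1 ((2 ^ k * \<tau>) powr p))
        = min 1 (\<tau> powr p) + q * (\<Sum>k<n. q ^ k * min 1 ((2 ^ k * (2 * \<tau>)) powr p))"
      by (subst sum.lessThan_Suc_shift) (simp add: sum_distrib_left mult_ac)
    also have "\<dots> \<le> min 1 (\<tau> powr p) + q * g (2 * \<tau>)"
      using Suc.IH[of "2 * \<tau>"] Suc.prems q by (intro add_left_mono mult_left_mono) auto
    also have "\<dots> \<le> g \<tau>"
    proof -
      consider "2 * \<tau> \<le> 1" | "\<tau> \<le> 1" "1 < 2 * \<tau>" | "1 < \<tau>" by linarith
      then show ?thesis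
      proof cases
        case 1
        have "q * g (2 * \<tau>) = A * \<tau> powr \<beta> - (2 powr (p - \<beta>) * B) * \<tau> powr p"
          using 1 Suc.prems
          by (simp add: g_def q_def powr_mult right_diff_distrib powr_diff powr_minus field_simps)
        then have "q * g (2 * \<tau>) = A * \<tau> powr \<beta> - (B + 1) * \<tau> powr p" unfolding B by simp
        then show ?thesis using 1 Suc.prems by (simp add: g_def algebra_simps)
      next
        case 2
        have t1: "\<tau> powr p \<le> 1" using 2 Suc.prems \<beta> p by (intro powr_le1) auto
        have "(1 / 2) powr \<beta> \<le> \<tau> powr \<beta>" using 2 \<beta> by (intro powr_mono2) auto
        then have "C + 1 + B \<le> A * \<tau> powr \<beta>"
          using B C mult_left_mono[of "(1 / 2) powr \<beta>" "\<tau> powr \<beta>" A] A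
          by (simp add: A_def powr_divide mult_ac)
        moreover have "B * \<tau> powr p \<le> B" using t1 B by (simp add: mult_left_le)
        moreover have "min 1 (\<tau> powr p) \<le> 1" by simp
        ultimately show ?thesis using 2 C(2) by (simp add: g_def)
      next
        case 3
        then show ?thesis using C(2) by (simp add: g_def)
      qed
    qed
    finally show ?case .
  qed
  have "g \<tau> \<le> A * \<tau> powr \<beta>" if "0 < \<tau>" for \<tau>
  proof (cases "\<tau> \<le> 1")
    case True then show ?thesis using B by (simp add: g_def)
  next
    case False
    then have "1 \<le> \<tau> powr \<beta>" using \<beta> by (intro ge_one_powr_ge_zero) auto
    then have "A * 1 \<le> A * \<tau> powr \<beta>" using A B C by (intro mult_left_mono) auto
    then show ?thesis using False A B by (simp add: g_def)
  qed
  moreover have "0 < A" using A B C by linarith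
  ultimately show ?thesis
    unfolding qk using main order_trans by (intro exI[of _ A] conjI allI impI) blast+
qed

lemma one_minus_cos_le_square: "1 - cos z \<le> z\<^sup>2 / 2" for z :: real
proof -
  have "1 - cos z = 2 * (sin (z / 2))\<^sup>2" using cos_double_sin[of "z / 2"] by simp
  also have "\<dots> \<le> 2 * (z / 2)\<^sup>2"
    using abs_sin_x_le_abs_x[of "z / 2"] by (intro mult_left_mono) (simp_all only: abs_le_square_iff)
  finally show ?thesis by (simp add: power2_eq_square)
qed

lemma one_minus_cos_le_2: "1 - cos z \<le> 2" for z :: real
  using cos_ge_minus_one[of z] by linarith

lemma one_minus_cos_le_abs: "1 - cos z \<le> \<bar>z\<bar>" for z :: real
proof (cases "\<bar>z\<bar> \<le> 2")
  case True
  then have "\<bar>z\<bar> * \<bar>z\<bar> \<le> 2 * \<bar>z\<bar>" by (intro mult_right_mono) auto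
  then show ?thesis using one_minus_cos_le_square[of z] by (simp add: power2_eq_square)
next
  case False then show ?thesis using one_minus_cos_le_2[of z] by linarith
qed

text \<open>Keeping the bound \<open>1\<close> only for the part \<open>p\<close> matters: \<open>p\<close> will grow with the frequency, whereas \<open>q\<close> is
  a constant of order \<open>t\<close>.\<close>

lemma one_minus_cos_le_split:
  fixes b p q :: real
  assumes "\<bar>b\<bar> \<le> p + q" "0 \<le> p" "0 \<le> q"
  shows "1 - cos b \<le> 2 * min 1 (p\<^sup>2) + q\<^sup>2"
proof -
  have "b\<^sup>2 \<le> (p + q)\<^sup>2" using assms by (metis abs_le_square_iff abs_of_nonneg add_nonneg_nonneg)
  moreover have "0 \<le> (p - q)\<^sup>2" by simp
  ultimately have "b\<^sup>2 / 2 \<le> p\<^sup>2 + q\<^sup>2" by (simp add: power2_sum power2_diff)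
  then have "1 - cos b \<le> p\<^sup>2 + q\<^sup>2" using one_minus_cos_le_square[of b] by linarith
  moreover have "0 \<le> p\<^sup>2" "0 \<le> q\<^sup>2" by auto
  ultimately have "1 - cos b \<le> 2 * p\<^sup>2 + q\<^sup>2" "1 - cos b \<le> 2 * 1 + q\<^sup>2"
    using one_minus_cos_le_2[of b] by linarith+
  then show ?thesis unfolding min_def by presburger
qed

text \<open>Modulus and phase of the exponential are estimated separately; the linear bound \<open>t * \<bar>Im z\<bar>\<close> for the
  phase can be too coarse for small jumps.\<close>

lemma one_minus_Re_exp_le:
  assumes "0 \<le> t" "0 \<le> Re z"
  shows "1 - Re (exp (- of_real t * z)) \<le> t * Re z + (1 - cos (t * Im z))"
proof -
  have "1 - exp (- t * Re z) \<le> t * Re z"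
    using exp_ge_add_one_self[of "- t * Re z"] by simp
  moreover have "exp (- t * Re z) * (1 - cos (t * Im z)) \<le> 1 * (1 - cos (t * Im z))"
    using assms by (intro mult_right_mono) auto
  ultimately show ?thesis by (simp add: Re_exp right_diff_distrib)
qed

lemma abs_sin_minus_self_le_powr:
  fixes z \<beta> :: real
  assumes "1 \<le> \<beta>" "\<beta> \<le> 2"
  shows "\<bar>sin z - z\<bar> \<le> 2 * \<bar>z\<bar> powr \<beta>"
proof (cases "\<bar>z\<bar> \<le> 1")
  case True
  have "\<bar>Im (iexp z - (\<Sum>k\<le>1. (\<i> * z) ^ k / fact k))\<bar> \<le> \<bar>z\<bar> ^ Suc 1 / fact (Suc 1)"
    using iexp_approx1[of z 1] abs_Im_le_cmod order_trans by blast
  then have "2 * \<bar>sin z - z\<bar> \<le> z\<^sup>2" by (simp add: Im_exp power2_eq_square)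
  then have "\<bar>sin z - z\<bar> \<le> z\<^sup>2"
    by (rule order_trans[rotated]) simp
  also have "z\<^sup>2 = \<bar>z\<bar> powr 2" by (simp add: powr_numeral)
  also have "\<dots> \<le> \<bar>z\<bar> powr \<beta>" using True assms by (intro powr_mono') auto
  finally show ?thesis by (smt (verit) powr_ge_zero)
next
  case False
  have "\<bar>sin z - z\<bar> \<le> 2 * \<bar>z\<bar>" using abs_sin_x_le_abs_x[of z] by linarith
  also have "\<bar>z\<bar> \<le> \<bar>z\<bar> powr \<beta>"
    using powr_mono[of 1 \<beta> "\<bar>z\<bar>"] False assms by simp
  finally show ?thesis by simp
qed

lemma abs_sin_le_powr:
  fixes z \<beta> :: real
  assumes "0 \<le> \<beta>" "\<beta> \<le> 1"
  shows "\<bar>sin z\<bar> \<le> \<bar>z\<bar> powr \<beta>"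
proof (cases "\<bar>z\<bar> \<le> 1")
  case True
  have "\<bar>sin z\<bar> \<le> \<bar>z\<bar> powr 1" using abs_sin_x_le_abs_x[of z] by simp
  also have "\<dots> \<le> \<bar>z\<bar> powr \<beta>" using True assms by (intro powr_mono') auto
  finally show ?thesis .
next
  case False
  then have "1 \<le> \<bar>z\<bar> powr \<beta>" using assms by (intro ge_one_powr_ge_zero) auto
  then show ?thesis using abs_sin_le_one[of z] by linarith
qed

section \<open>The exponent of a Levy process without Gaussian part\<close>

abbreviation near :: "real \<Rightarrow> ('a::real_normed_vector \<Rightarrow> real) \<Rightarrow> 'a \<Rightarrow> real" where
  "near \<epsilon> F x \<equiv> indicator {x. norm x < \<epsilon>} x * \<bar>F x\<bar>"

locale levy_jump_exponent =
  fixes \<gamma> :: "real ^ 'd" and \<nu> :: "(real ^ 'd) measure"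
  assumes levy: "levy_measure \<nu>"
begin

abbreviation psi :: "real ^ 'd \<Rightarrow> complex" where
  "psi \<equiv> levy_exponent 0 \<gamma> \<nu>"

abbreviation finite_small_moment :: "real \<Rightarrow> bool" where
  "finite_small_moment \<beta> \<equiv> integrable \<nu> (\<lambda>y. indicator {y. norm y < 1} y * norm y powr \<beta>)"

lemma sets_nu [measurable_cong, simp]: "sets \<nu> = sets borel"
  using levy by (simp add: levy_measure_def)

lemma space_nu [simp]: "space \<nu> = UNIV"
  using sets_eq_imp_space_eq[OF sets_nu] by simp

lemma AE_nonzero: "AE y in \<nu>. y \<noteq> 0"
  using levy by (auto simp: levy_measure_def null_sets_def intro!: AE_I'[of "{0}"])

lemma integrable_min: "integrable \<nu> (\<lambda>y. min 1 ((norm y)\<^sup>2))"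
  using levy by (simp add: integrable_iff_bounded levy_measure_def)

lemma integrable_min_bound:
  fixes f :: "real ^ 'd \<Rightarrow> 'b::{banach, second_countable_topology}"
  assumes [measurable]: "f \<in> borel_measurable borel" and "\<And>y. norm (f y) \<le> C * min 1 ((norm y)\<^sup>2)"
  shows "integrable \<nu> f"
  by (rule Bochner_Integration.integrable_bound[OF integrable_mult_right[OF integrable_min, of C]])
     (use assms(2) order_trans[OF _ abs_ge_self] in auto)

lemma integrable_away_from_0:
  fixes f :: "real ^ 'd \<Rightarrow> 'b::{banach, second_countable_topology}"
  assumes [measurable]: "f \<in> borel_measurable borel" and \<delta>: "0 < \<delta>"
    and B: "\<And>y. \<delta> \<le> norm y \<Longrightarrow> norm (f y) \<le> B" and zero: "\<And>y. norm y < \<delta> \<Longrightarrow> f y = 0"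
  shows "integrable \<nu> f"
proof (rule integrable_min_bound[where C = "\<bar>B\<bar> / min 1 (\<delta>\<^sup>2)"])
  fix y :: "real ^ 'd"
  have m: "0 < min 1 (\<delta>\<^sup>2)" using \<delta> by simp
  show "norm (f y) \<le> \<bar>B\<bar> / min 1 (\<delta>\<^sup>2) * min 1 ((norm y)\<^sup>2)"
  proof (cases "norm y < \<delta>")
    case True then show ?thesis using zero m by simp
  next
    case False
    then have "min 1 (\<delta>\<^sup>2) \<le> min 1 ((norm y)\<^sup>2)"
      using \<delta> by (intro min.mono power_mono) auto
    then have "\<bar>B\<bar> * 1 \<le> \<bar>B\<bar> * (min 1 ((norm y)\<^sup>2) / min 1 (\<delta>\<^sup>2))"
      using m by (intro mult_left_mono) (auto simp: field_simps)
    then show ?thesis using B[of y] False by (simp add: mult_ac)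
  qed
qed simp

lemma integrable_tail: "0 < \<delta> \<Longrightarrow> integrable \<nu> (indicator {y. \<delta> \<le> norm y} :: _ \<Rightarrow> real)"
  by (rule integrable_away_from_0[where B = 1]) (auto simp: indicator_def)

definition compensated_iexp :: "real ^ 'd \<Rightarrow> real ^ 'd \<Rightarrow> complex" where
  "compensated_iexp \<xi> y = iexp (\<xi> \<bullet> y) - 1 - \<i> * of_real (\<xi> \<bullet> y) * indicator {y. norm y \<le> 1} y"

lemma compensated_iexp_measurable [measurable]: "compensated_iexp \<xi> \<in> borel_measurable borel"
  unfolding compensated_iexp_def by measurable

lemma compensated_iexp_bound: "norm (compensated_iexp \<xi> y) \<le> (2 + (norm \<xi>)\<^sup>2) * min 1 ((norm y)\<^sup>2)"
proof (cases "norm y \<le> 1")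
  case True
  have "norm (compensated_iexp \<xi> y) \<le> \<bar>\<xi> \<bullet> y\<bar>\<^sup>2 / 2"
    using iexp_approx1[of "\<xi> \<bullet> y" 1] True by (simp add: compensated_iexp_def algebra_simps power2_eq_square)
  also have "\<dots> \<le> \<bar>\<xi> \<bullet> y\<bar>\<^sup>2" by simp
  also have "\<dots> \<le> (norm \<xi> * norm y)\<^sup>2"
    by (intro power_mono Cauchy_Schwarz_ineq2) simp
  also have "\<dots> \<le> (2 + (norm \<xi>)\<^sup>2) * (norm y)\<^sup>2" by (simp add: power_mult_distrib mult_right_mono)
  also have "(norm y)\<^sup>2 = min 1 ((norm y)\<^sup>2)" using True by (simp add: power_le_one)
  finally show ?thesis .
next
  case False
  have "norm (compensated_iexp \<xi> y) \<le> norm (iexp (\<xi> \<bullet> y)) + norm (1::complex)"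
    using False norm_triangle_ineq4[of "iexp (\<xi> \<bullet> y)" 1] by (simp add: compensated_iexp_def)
  also have "\<dots> \<le> 2 + (norm \<xi>)\<^sup>2" by simp
  also have "min 1 ((norm y)\<^sup>2) = 1" using False by simp
  ultimately show ?thesis by simp
qed

lemma integrable_compensated_iexp: "integrable \<nu> (compensated_iexp \<xi>)"
  by (rule integrable_min_bound[OF _ compensated_iexp_bound]) simp

lemma psi_eq: "psi \<xi> = - \<i> * of_real (\<xi> \<bullet> \<gamma>) - (\<integral>y. compensated_iexp \<xi> y \<partial>\<nu>)"
  by (simp add: levy_exponent_def compensated_iexp_def)

lemma Re_psi: "Re (psi \<xi>) = (\<integral>y. 1 - cos (\<xi> \<bullet> y) \<partial>\<nu>)"
proof -
  have "Re (psi \<xi>) = - (\<integral>y. Re (compensated_iexp \<xi> y) \<partial>\<nu>)"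
    unfolding psi_eq using integrable_compensated_iexp by simp
  also have "\<dots> = (\<integral>y. - Re (compensated_iexp \<xi> y) \<partial>\<nu>)" by simp
  also have "(\<lambda>y. - Re (compensated_iexp \<xi> y)) = (\<lambda>y. 1 - cos (\<xi> \<bullet> y))"
    by (auto simp: compensated_iexp_def Re_exp indicator_def)
  finally show ?thesis .
qed

lemma Re_psi_nonneg: "0 \<le> Re (psi \<xi>)"
  unfolding Re_psi by (intro integral_nonneg_AE AE_I2) simp

lemma Im_psi: "Im (psi \<xi>) = - (\<xi> \<bullet> \<gamma>) - (\<integral>y. sin (\<xi> \<bullet> y) - (\<xi> \<bullet> y) * indicator {y. norm y \<le> 1} y \<partial>\<nu>)"
proof -
  have "Im (psi \<xi>) = - (\<xi> \<bullet> \<gamma>) - (\<integral>y. Im (compensated_iexp \<xi> y) \<partial>\<nu>)"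
    unfolding psi_eq using integrable_compensated_iexp by simp
  also have "(\<lambda>y. Im (compensated_iexp \<xi> y)) = (\<lambda>y. sin (\<xi> \<bullet> y) - (\<xi> \<bullet> y) * indicator {y. norm y \<le> 1} y)"
    by (auto simp: compensated_iexp_def Im_exp indicator_def)
  finally show ?thesis .
qed

lemma integrable_one_minus_cos: "integrable \<nu> (\<lambda>y. 1 - cos (\<xi> \<bullet> y))"
proof -
  have "integrable \<nu> (\<lambda>y. - Re (compensated_iexp \<xi> y))"
    using integrable_compensated_iexp by auto
  also have "(\<lambda>y. - Re (compensated_iexp \<xi> y)) = (\<lambda>y. 1 - cos (\<xi> \<bullet> y))"
    by (auto simp: compensated_iexp_def Re_exp indicator_def)
  finally show ?thesis .
qed

lemma integrable_sin_compensated: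
  "integrable \<nu> (\<lambda>y. sin (\<xi> \<bullet> y) - (\<xi> \<bullet> y) * indicator {y. norm y \<le> 1} y)"
proof -
  have "integrable \<nu> (\<lambda>y. Im (compensated_iexp \<xi> y))"
    using integrable_compensated_iexp by auto
  also have "(\<lambda>y. Im (compensated_iexp \<xi> y)) = (\<lambda>y. sin (\<xi> \<bullet> y) - (\<xi> \<bullet> y) * indicator {y. norm y \<le> 1} y)"
    by (auto simp: compensated_iexp_def Im_exp indicator_def)
  finally show ?thesis .
qed

text \<open>The terms of \<open>psi\<close> that are linear in the frequency, drift and compensator alike, drop out of
  a second difference.\<close>

lemma psi_second_difference:
  "(psi (\<eta> + \<xi>) + psi (\<eta> - \<xi>)) / 2 - psi \<eta> = (\<integral>y. iexp (\<eta> \<bullet> y) * of_real (1 - cos (\<xi> \<bullet> y)) \<partial>\<nu>)"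
proof -
  have pt: "compensated_iexp \<eta> y - (compensated_iexp (\<eta> + \<xi>) y + compensated_iexp (\<eta> - \<xi>) y) / 2
      = iexp (\<eta> \<bullet> y) * of_real (1 - cos (\<xi> \<bullet> y))" for y
  proof -
    have "iexp ((\<eta> + \<xi>) \<bullet> y) + iexp ((\<eta> - \<xi>) \<bullet> y) = iexp (\<eta> \<bullet> y) * (2 * of_real (cos (\<xi> \<bullet> y)))"
      by (simp add: inner_add_left inner_diff_left complex_eq_iff Re_exp Im_exp cos_add cos_diff sin_add sin_diff)
    then show ?thesis
      by (simp add: compensated_iexp_def inner_add_left inner_diff_left algebra_simps add_divide_distrib[symmetric])
         (simp add: algebra_simps add_divide_distrib diff_divide_distrib)
  qed
  have "(psi (\<eta> + \<xi>) + psi (\<eta> - \<xi>)) / 2 - psi \<eta>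
      = (\<integral>y. compensated_iexp \<eta> y \<partial>\<nu>) -
        ((\<integral>y. compensated_iexp (\<eta> + \<xi>) y \<partial>\<nu>) + (\<integral>y. compensated_iexp (\<eta> - \<xi>) y \<partial>\<nu>)) / 2"
    unfolding psi_eq by (simp add: inner_add_left inner_diff_left field_simps)
  also have "\<dots> = (\<integral>y. compensated_iexp \<eta> y - (compensated_iexp (\<eta> + \<xi>) y + compensated_iexp (\<eta> - \<xi>) y) / 2 \<partial>\<nu>)"
    by (simp add: integrable_compensated_iexp)
  finally show ?thesis unfolding pt .
qed

lemma norm_psi_bound: "\<exists>K\<ge>0. \<forall>\<xi>. norm (psi \<xi>) \<le> K * (1 + (norm \<xi>)\<^sup>2)"
proof -
  define m where "m = (\<integral>y. min 1 ((norm y)\<^sup>2) \<partial>\<nu>)"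
  have m: "0 \<le> m" unfolding m_def by (intro integral_nonneg_AE AE_I2) simp
  have "norm (psi \<xi>) \<le> (norm \<gamma> + 2 * m) * (1 + (norm \<xi>)\<^sup>2)" for \<xi>
  proof -
    have "norm (\<integral>y. compensated_iexp \<xi> y \<partial>\<nu>) \<le> (\<integral>y. norm (compensated_iexp \<xi> y) \<partial>\<nu>)"
      by (rule integral_norm_bound)
    also have "\<dots> \<le> (\<integral>y. (2 + (norm \<xi>)\<^sup>2) * min 1 ((norm y)\<^sup>2) \<partial>\<nu>)"
      by (intro integral_mono integrable_norm integrable_compensated_iexp integrable_mult_right
          integrable_min compensated_iexp_bound)
    also have "\<dots> = (2 + (norm \<xi>)\<^sup>2) * m" by (simp add: m_def)
    finally have 1: "norm (\<integral>y. compensated_iexp \<xi> y \<partial>\<nu>) \<le> (2 + (norm \<xi>)\<^sup>2) * m" .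
    have "norm (psi \<xi>) \<le> \<bar>\<xi> \<bullet> \<gamma>\<bar> + norm (\<integral>y. compensated_iexp \<xi> y \<partial>\<nu>)"
      unfolding psi_eq by (rule order_trans[OF norm_triangle_ineq4]) (simp add: norm_mult)
    also have "\<dots> \<le> norm \<gamma> * (1 + (norm \<xi>)\<^sup>2) + (2 + (norm \<xi>)\<^sup>2) * m"
    proof -
      have "2 * norm \<xi> \<le> 1 + (norm \<xi>)\<^sup>2" using sum_squares_bound[of 1 "norm \<xi>"] by simp
      then have "norm \<xi> \<le> 1 + (norm \<xi>)\<^sup>2" using norm_ge_zero[of \<xi>] by linarith
      then have "norm \<xi> * norm \<gamma> \<le> (1 + (norm \<xi>)\<^sup>2) * norm \<gamma>" by (intro mult_right_mono) auto
      then show ?thesis using Cauchy_Schwarz_ineq2[of \<xi> \<gamma>] 1 by (simp add: mult_ac)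
    qed
    also have "\<dots> \<le> norm \<gamma> * (1 + (norm \<xi>)\<^sup>2) + (2 + 2 * (norm \<xi>)\<^sup>2) * m"
      using m by (intro add_left_mono mult_right_mono) auto
    finally show ?thesis by (simp add: algebra_simps)
  qed
  then show ?thesis using m by (intro exI[of _ "norm \<gamma> + 2 * m"]) auto
qed

lemma psi_0: "psi 0 = 0"
  by (simp add: psi_eq compensated_iexp_def)

lemma continuous_psi: "continuous_on UNIV psi"
proof (rule continuous_at_imp_continuous_on, intro ballI)
  fix \<xi> :: "real ^ 'd"
  show "isCont psi \<xi>"
    unfolding continuous_at_sequentially
  proof (intro allI impI)
    fix x assume x: "x \<longlonglongrightarrow> \<xi>"
    then have "Bseq x" by (intro convergent_imp_Bseq convergentI)
    then obtain K where K: "K > 0" "\<And>n. norm (x n) \<le> K" unfolding Bseq_def by blast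
    have "(\<lambda>n. \<integral>y. compensated_iexp (x n) y \<partial>\<nu>) \<longlonglongrightarrow> (\<integral>y. compensated_iexp \<xi> y \<partial>\<nu>)"
    proof (rule integral_dominated_convergence[where w = "\<lambda>y. (2 + K\<^sup>2) * min 1 ((norm y)\<^sup>2)"])
      show "AE y in \<nu>. norm (compensated_iexp (x n) y) \<le> (2 + K\<^sup>2) * min 1 ((norm y)\<^sup>2)" for n
        using K(2)[of n]
        by (intro AE_I2 order_trans[OF compensated_iexp_bound] mult_right_mono add_left_mono power_mono) auto
      show "AE y in \<nu>. (\<lambda>n. compensated_iexp (x n) y) \<longlonglongrightarrow> compensated_iexp \<xi> y"
        unfolding compensated_iexp_def by (intro AE_I2 tendsto_intros x)
      show "integrable \<nu> (\<lambda>y. (2 + K\<^sup>2) * min 1 ((norm y)\<^sup>2))"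
        by (intro integrable_mult_right integrable_min)
    qed simp_all
    then show "(psi \<circ> x) \<longlonglongrightarrow> psi \<xi>"
      unfolding comp_def psi_eq by (intro tendsto_intros x)
  qed
qed

lemma psi_measurable [measurable]: "psi \<in> borel_measurable borel"
  by (rule borel_measurable_continuous_onI[OF continuous_psi])

end

section \<open>Convergence of the rescaled laws away from the origin\<close>

text \<open>The derivative at time \<open>0\<close> of the characteristic function.\<close>

lemma tendsto_exp_quotient:
  fixes u :: complex and s :: "nat \<Rightarrow> real"
  assumes s: "\<And>n. 0 < s n" "s \<longlonglongrightarrow> 0"
  shows "(\<lambda>n. (exp (- of_real (s n) * u) - 1) / of_real (s n)) \<longlonglongrightarrow> - u"
proof -
  have "((\<lambda>z. exp (- z * u)) has_field_derivative - u) (at 0)"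
    by (auto intro!: derivative_eq_intros)
  then have "((\<lambda>h. (exp (- h * u) - 1) / h) \<longlongrightarrow> - u) (at 0)"
    by (simp add: DERIV_def)
  moreover have "filterlim (\<lambda>n. complex_of_real (s n)) (at 0) sequentially"
    using tendsto_of_real[OF s(2), where 'a = complex] s(1)
    by (auto simp: filterlim_at less_imp_neq[symmetric] intro!: always_eventually)
  ultimately show ?thesis by (rule filterlim_compose)
qed

lemma finite_measure_density_integrable:
  assumes "integrable M w" "\<And>x. 0 \<le> w x"
  shows "finite_measure (density M (\<lambda>x. ennreal (w x)))"
proof (rule finite_measureI)
  have [measurable]: "w \<in> borel_measurable M" using assms(1) by auto
  have "emeasure (density M (\<lambda>x. ennreal (w x))) (space M) = (\<integral>\<^sup>+x. ennreal (w x) \<partial>M)"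
    by (simp add: emeasure_density cong: nn_integral_cong)
  also have "\<dots> < \<infinity>" using assms by (simp add: integrable_iff_bounded)
  finally show "emeasure (density M (\<lambda>x. ennreal (w x))) (space (density M (\<lambda>x. ennreal (w x)))) \<noteq> \<infinity>"
    by simp
qed

text \<open>Random multiples \<open>s *\<^sub>R v\<close> of one frequency, with \<open>s\<close> Gaussian, replace the periodic
  \<open>1 - cos\<close> by a function that is bounded away from \<open>0\<close> for large \<open>v \<bullet> x\<close>.\<close>

lemma integral_gaussian_average:
  fixes Q :: "'a::euclidean_space measure"
  assumes Q: "prob_space Q" and [measurable_cong]: "sets Q = sets borel"
  shows "(\<integral>x. 1 - exp (- (v \<bullet> x)\<^sup>2 / 2) \<partial>Q)
       = (\<integral>s. 1 - Re (charfun_of Q (s *\<^sub>R v)) \<partial>std_normal)"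
proof -
  interpret Q: prob_space Q by fact
  interpret N: prob_space std_normal by (rule prob_space_std_normal)
  interpret QN: pair_sigma_finite Q std_normal ..
  interpret F: finite_measure "Q \<Otimes>\<^sub>M std_normal"
    by (rule finite_measure_pair_measure) unfold_locales
  have meas: "(\<lambda>p. cos (snd p * (v \<bullet> fst p))) \<in> borel_measurable (Q \<Otimes>\<^sub>M std_normal)"
    by measurable
  have int: "integrable (Q \<Otimes>\<^sub>M std_normal) (\<lambda>(x, s). 1 - cos (s * (v \<bullet> x)))"
    unfolding case_prod_beta
    by (intro Bochner_Integration.integrable_diff F.integrable_const F.integrable_const_bound[where B = 1] meas)
       (auto intro!: AE_I2)
  have cosint: "integrable std_normal (\<lambda>s. cos (s * z))" for z
    by (rule N.integrable_const_bound[where B = 1]) auto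
  have 1: "1 - exp (- (v \<bullet> x)\<^sup>2 / 2) = (\<integral>s. 1 - cos (s * (v \<bullet> x)) \<partial>std_normal)" for x
  proof -
    have "exp (- (v \<bullet> x)\<^sup>2 / 2) = Re (\<integral>s. iexp (s * (v \<bullet> x)) \<partial>std_normal)"
      unfolding integral_std_normal_iexp by simp
    also have "\<dots> = (\<integral>s. Re (iexp (s * (v \<bullet> x))) \<partial>std_normal)"
      by (rule integral_Re[symmetric]) (intro finite_measure_integrable_iexp N.finite_measure_axioms, measurable)
    also have "\<dots> = (\<integral>s. cos (s * (v \<bullet> x)) \<partial>std_normal)" by (simp add: Re_exp)
    finally show ?thesis using cosint N.prob_space by simp
  qed
  have 2: "1 - Re (charfun_of Q (s *\<^sub>R v)) = (\<integral>x. 1 - cos (s * (v \<bullet> x)) \<partial>Q)" for s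
  proof -
    have "Re (charfun_of Q (s *\<^sub>R v)) = (\<integral>x. Re (iexp ((s *\<^sub>R v) \<bullet> x)) \<partial>Q)"
      by (rule integral_Re[symmetric]) (intro finite_measure_integrable_iexp Q.finite_measure_axioms, measurable)
    also have "\<dots> = (\<integral>x. cos (s * (v \<bullet> x)) \<partial>Q)" by (simp add: Re_exp)
    moreover have "integrable Q (\<lambda>x. cos (s * (v \<bullet> x)))"
      by (rule Q.integrable_const_bound[where B = 1]) auto
    ultimately show ?thesis using Q.prob_space by simp
  qed
  show ?thesis unfolding 1 2 by (rule QN.Fubini_integral[OF int, symmetric])
qed

lemma exists_large_component:
  fixes x :: "'a::euclidean_space"
  shows "\<exists>b\<in>Basis. norm x \<le> real DIM('a) * \<bar>x \<bullet> b\<bar>"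
proof (rule ccontr)
  assume "\<not> ?thesis"
  then have "(\<Sum>b\<in>(Basis::'a set). real DIM('a) * \<bar>x \<bullet> b\<bar>) < (\<Sum>b\<in>(Basis::'a set). norm x)"
    by (intro sum_strict_mono) auto
  then have "real DIM('a) * (\<Sum>b\<in>Basis. \<bar>x \<bullet> b\<bar>) < real DIM('a) * norm x"
    by (simp add: sum_distrib_left)
  then show False using norm_le_l1[of x] by simp
qed

lemma one_le_gaussian_defect:
  fixes z :: real
  assumes "1 \<le> \<bar>z\<bar>"
  shows "1 \<le> 4 * (1 - exp (- z\<^sup>2 / 2))"
proof -
  have "1 \<le> z\<^sup>2" using assms power_mono[of 1 "\<bar>z\<bar>" 2] by simp
  then have "exp (- z\<^sup>2 / 2) \<le> exp (- (1 / 2))" by simp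
  also have "\<dots> \<le> 3 / 4"
    using exp_ge_add_one_self[of "1 / 2 :: real"] by (simp add: exp_minus field_simps)
  finally show ?thesis by simp
qed

lemma integrable_std_normal_powers:
  "integrable std_normal (\<lambda>s. 1 + (c * s)\<^sup>2)"
  "integrable std_normal (\<lambda>s. (1 + s\<^sup>2)\<^sup>2)"
proof -
  interpret N: prob_space std_normal by (rule prob_space_std_normal)
  note [simp] = integrable_std_normal_distribution_moment
  show "integrable std_normal (\<lambda>s. 1 + (c * s)\<^sup>2)"
    unfolding power_mult_distrib by (intro Bochner_Integration.integrable_add integrable_mult_right) simp_all
  have "(\<lambda>s::real. (1 + s\<^sup>2)\<^sup>2) = (\<lambda>s. 1 + 2 * s ^ 2 + s ^ 4)"
    by (auto simp: power2_eq_square algebra_simps eval_nat_numeral)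
  then show "integrable std_normal (\<lambda>s. (1 + s\<^sup>2)\<^sup>2)"
    by (auto intro!: Bochner_Integration.integrable_add integrable_mult_right)
qed

text \<open>The heat content at time \<open>t\<close> is an integral against the law at time \<open>t\<close>, so the process is represented
  by these laws.\<close>

locale levy_laws = levy_jump_exponent \<gamma> \<nu> for \<gamma> :: "real ^ 'd" and \<nu> +
  fixes P :: "real \<Rightarrow> (real ^ 'd) measure"
  assumes prob: "\<And>t. 0 \<le> t \<Longrightarrow> prob_space (P t)"
    and sets_P: "\<And>t. 0 \<le> t \<Longrightarrow> sets (P t) = sets borel"
    and charfun: "\<And>t \<xi>. 0 \<le> t \<Longrightarrow> charfun_of (P t) \<xi> = exp (- of_real t * psi \<xi>)"
begin

lemma space_P: "0 \<le> t \<Longrightarrow> space (P t) = UNIV"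
  using sets_eq_imp_space_eq[OF sets_P] by simp

lemma integrable_P_bounded:
  fixes f :: "real ^ 'd \<Rightarrow> 'b::{banach, second_countable_topology}"
  assumes "0 \<le> t" "f \<in> borel_measurable borel" "\<And>x. norm (f x) \<le> B"
  shows "integrable (P t) f"
proof -
  interpret prob_space "P t" by (rule prob) fact
  note [measurable_cong] = sets_P[OF assms(1)]
  show ?thesis using assms by (intro integrable_const_bound[where B = B]) auto
qed

text \<open>With the weight \<open>1 - cos (\<xi> \<bullet> x)\<close> the measures \<open>P t / t\<close> and \<open>\<nu>\<close> become finite, and the
  characteristic function of the weighted \<open>P t / t\<close> at \<open>\<eta>\<close> is a difference quotient in time of a second
  difference in frequency. Its limit is given by \<open>psi_second_difference\<close>.\<close>

lemma tendsto_integral_cos_weight: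
  fixes f :: "real ^ 'd \<Rightarrow> real"
  assumes cont: "continuous_on UNIV f" and supp: "\<And>x. R \<le> norm x \<Longrightarrow> f x = 0"
    and s: "\<And>n. 0 < s n" "s \<longlonglongrightarrow> 0"
  shows "(\<lambda>n. (\<integral>x. f x * (1 - cos (\<xi> \<bullet> x)) \<partial>P (s n)) / s n)
           \<longlonglongrightarrow> (\<integral>x. f x * (1 - cos (\<xi> \<bullet> x)) \<partial>\<nu>)"
proof -
  have s0: "0 \<le> s n" for n using s(1)[of n] by simp
  note [measurable] = borel_measurable_continuous_onI[OF cont]
  note [measurable_cong] = sets_P[OF s0]
  define w where "w x = 1 - cos (\<xi> \<bullet> x)" for x
  have [measurable]: "w \<in> borel_measurable borel" unfolding w_def by measurable
  have w: "0 \<le> w x" "w x \<le> 2" for x using one_minus_cos_le_2 by (auto simp: w_def)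
  define M where "M n = density (P (s n)) (\<lambda>x. ennreal (w x / s n))" for n
  define L where "L = density \<nu> (\<lambda>x. ennreal (w x))"
  have intP: "integrable (P (s n)) (\<lambda>x. w x / s n)" for n
    by (rule integrable_P_bounded[OF s0, where B = "2 / s n"])
       (use w s(1)[of n] in \<open>auto simp: divide_right_mono\<close>)
  \<comment> \<open>\<open>M n\<close> and \<open>L\<close> are the weighted versions of \<open>P (s n) / s n\<close> and \<open>\<nu>\<close>\<close>
  have "(\<lambda>n. \<integral>x. f x \<partial>M n) \<longlonglongrightarrow> (\<integral>x. f x \<partial>L)"
  proof (rule integral_tendsto_of_charfun_compact_support[OF _ _ _ _ _ cont supp])
    show "finite_measure (M n)" for n
      unfolding M_def using w s(1)[of n] by (intro finite_measure_density_integrable intP) auto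
    show "finite_measure L"
      unfolding L_def using w integrable_one_minus_cos
      by (intro finite_measure_density_integrable) (auto simp: w_def)
    show "sets (M n) = sets borel" for n unfolding M_def using sets_P[OF s0] by simp
    show "sets L = sets borel" unfolding L_def by simp
    fix \<eta> :: "real ^ 'd"
    let ?q = "\<lambda>\<zeta> n. (exp (- of_real (s n) * psi \<zeta>) - 1) / of_real (s n)"
    have *: "charfun_of (M n) \<eta> = ?q \<eta> n - (?q (\<eta> + \<xi>) n + ?q (\<eta> - \<xi>) n) / 2" for n
    proof -
      have int: "integrable (P (s n)) (\<lambda>x. iexp (\<zeta> \<bullet> x))" for \<zeta>
        by (rule integrable_P_bounded[OF s0, where B = 1]) auto
      have pt: "(w x / s n) *\<^sub>R iexp (\<eta> \<bullet> x)
          = (iexp (\<eta> \<bullet> x) - (iexp ((\<eta> + \<xi>) \<bullet> x) + iexp ((\<eta> - \<xi>) \<bullet> x)) / 2) / of_real (s n)" for x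
      proof -
        have "iexp ((\<eta> + \<xi>) \<bullet> x) + iexp ((\<eta> - \<xi>) \<bullet> x) = iexp (\<eta> \<bullet> x) * (2 * of_real (cos (\<xi> \<bullet> x)))"
          by (simp add: inner_add_left inner_diff_left complex_eq_iff Re_exp Im_exp cos_add cos_diff sin_add sin_diff)
        then show ?thesis by (simp add: w_def scaleR_conv_of_real algebra_simps)
      qed
      have "charfun_of (M n) \<eta> = (\<integral>x. (w x / s n) *\<^sub>R iexp (\<eta> \<bullet> x) \<partial>P (s n))"
        unfolding M_def using w s(1)[of n] by (intro integral_density) auto
      also have "\<dots> = (charfun_of (P (s n)) \<eta>
          - (charfun_of (P (s n)) (\<eta> + \<xi>) + charfun_of (P (s n)) (\<eta> - \<xi>)) / 2) / of_real (s n)"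
        unfolding pt using int by simp
      also have "\<dots> = ?q \<eta> n - (?q (\<eta> + \<xi>) n + ?q (\<eta> - \<xi>) n) / 2"
        unfolding charfun[OF s0] using s(1)[of n] by (simp add: field_simps)
      finally show ?thesis .
    qed
    have "(\<lambda>n. charfun_of (M n) \<eta>) \<longlonglongrightarrow> - psi \<eta> - (- psi (\<eta> + \<xi>) + - psi (\<eta> - \<xi>)) / 2"
      unfolding * by (intro tendsto_intros tendsto_exp_quotient s) auto
    also have "- psi \<eta> - (- psi (\<eta> + \<xi>) + - psi (\<eta> - \<xi>)) / 2 = (psi (\<eta> + \<xi>) + psi (\<eta> - \<xi>)) / 2 - psi \<eta>"
      by (simp add: field_simps)
    also have "\<dots> = (\<integral>x. iexp (\<eta> \<bullet> x) * of_real (1 - cos (\<xi> \<bullet> x)) \<partial>\<nu>)"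
      by (rule psi_second_difference)
    also have "\<dots> = (\<integral>x. w x *\<^sub>R iexp (\<eta> \<bullet> x) \<partial>\<nu>)"
      by (simp add: w_def scaleR_conv_of_real mult.commute)
    also have "\<dots> = charfun_of L \<eta>"
      unfolding L_def using w by (intro integral_density[symmetric]) auto
    finally show "(\<lambda>n. charfun_of (M n) \<eta>) \<longlonglongrightarrow> charfun_of L \<eta>" .
  qed
  moreover have "(\<integral>x. f x \<partial>M n) = (\<integral>x. f x * (1 - cos (\<xi> \<bullet> x)) \<partial>P (s n)) / s n" for n
  proof -
    have "(\<integral>x. f x \<partial>M n) = (\<integral>x. (w x / s n) *\<^sub>R f x \<partial>P (s n))"
      unfolding M_def using w s(1)[of n] by (intro integral_density) auto
    also have "\<dots> = (\<integral>x. f x * (1 - cos (\<xi> \<bullet> x)) / s n \<partial>P (s n))"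
      by (simp add: w_def mult_ac)
    finally show ?thesis by simp
  qed
  moreover have "(\<integral>x. f x \<partial>L) = (\<integral>x. f x * (1 - cos (\<xi> \<bullet> x)) \<partial>\<nu>)"
  proof -
    have "(\<integral>x. f x \<partial>L) = (\<integral>x. w x *\<^sub>R f x \<partial>\<nu>)"
      unfolding L_def using w by (intro integral_density) auto
    then show ?thesis by (simp add: w_def mult_ac)
  qed
  ultimately show ?thesis by simp
qed

text \<open>Weights along the coordinate directions, with frequency so low that no \<open>1 - cos\<close> has a second zero in
  the support of \<open>f\<close>, add up to a positive function \<open>w\<close> there; then \<open>f\<close> is the weighted
  form of the continuous function \<open>f / w\<close>.\<close>

lemma tendsto_integral_annulus:
  fixes f :: "real ^ 'd \<Rightarrow> real"
  assumes cont: "continuous_on UNIV f" and \<epsilon>: "0 < \<epsilon>" "0 < R"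
    and near: "\<And>x. norm x \<le> \<epsilon> \<Longrightarrow> f x = 0" and far: "\<And>x. R \<le> norm x \<Longrightarrow> f x = 0"
    and s: "\<And>n. 0 < s n" "s \<longlonglongrightarrow> 0"
  shows "(\<lambda>n. (\<integral>x. f x \<partial>P (s n)) / s n) \<longlonglongrightarrow> (\<integral>x. f x \<partial>\<nu>)"
proof -
  define W where "W b x = 1 - cos ((b /\<^sub>R (R + 1)) \<bullet> x)" for b x :: "real ^ 'd"
  define w where "w x = (\<Sum>b\<in>Basis. W b x)" for x
  \<comment> \<open>where \<open>w\<close> vanishes, so does \<open>f\<close>, and division by \<open>0\<close> gives the right value \<open>0\<close>\<close>
  define u where "u x = f x / w x" for x
  have W: "0 \<le> W b x" "W b x \<le> 2" for b x
    using one_minus_cos_le_2 by (auto simp: W_def)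
  have W_cont: "continuous_on S (W b)" for S b unfolding W_def by (intro continuous_intros)
  have wpos: "0 < w x" if x: "x \<noteq> 0" "norm x < R + 1" for x
  proof -
    obtain b where b: "b \<in> Basis" "x \<bullet> b \<noteq> 0" using x(1) euclidean_all_zero_iff[of x] by blast
    have "\<bar>x \<bullet> b\<bar> \<le> norm x" using b(1) by (rule Basis_le_norm)
    then have "\<bar>x \<bullet> b\<bar> / (R + 1) \<le> 1" using x(2) \<epsilon> by simp
    moreover have "\<bar>(b /\<^sub>R (R + 1)) \<bullet> x\<bar> = \<bar>x \<bullet> b\<bar> / (R + 1)"
      using \<epsilon> by (simp add: inner_commute abs_mult divide_inverse mult.commute)
    moreover have "0 < \<bar>x \<bullet> b\<bar> / (R + 1)" using b(2) \<epsilon> by simp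
    ultimately have z: "0 < \<bar>(b /\<^sub>R (R + 1)) \<bullet> x\<bar>" "\<bar>(b /\<^sub>R (R + 1)) \<bullet> x\<bar> \<le> pi"
      using pi_ge_two by linarith+
    have "cos \<bar>(b /\<^sub>R (R + 1)) \<bullet> x\<bar> < cos 0" using z by (intro cos_monotone_0_pi) auto
    then have "0 < W b x" by (simp add: W_def)
    also have "W b x \<le> w x" unfolding w_def using b(1) W by (intro member_le_sum) auto
    finally show ?thesis .
  qed
  have u_zero: "u x = 0" if "norm x < \<epsilon> \<or> R < norm x" for x using that near[of x] far[of x] by (auto simp: u_def)
  have u_cont: "continuous_on UNIV u"
  proof -
    let ?A = "{x :: real ^ 'd. 0 < norm x \<and> norm x < R + 1}" and ?B = "{x :: real ^ 'd. norm x < \<epsilon>} \<union> {x. R < norm x}"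
    have "open ?A" "open ?B"
      by (intro open_Collect_conj open_Un open_Collect_less continuous_intros)+
    moreover have "continuous_on ?A u"
      unfolding u_def w_def using wpos
      by (intro continuous_on_divide continuous_on_sum W_cont continuous_on_subset[OF cont])
         (force simp: w_def)+
    moreover have "continuous_on ?B u"
      using u_zero by (subst continuous_on_cong[OF refl, of _ _ "\<lambda>_. 0"]) auto
    ultimately have "continuous_on (?A \<union> ?B) u" by (rule continuous_on_open_Un)
    also have "?A \<union> ?B = UNIV" using \<epsilon> by auto
    finally show ?thesis .
  qed
  have u_far: "u x = 0" if "R \<le> norm x" for x using far[OF that] by (simp add: u_def)
  obtain B where B: "\<And>x. \<bar>u x\<bar> \<le> B" using continuous_compact_support_uniform(2)[OF u_cont u_far] by blast
  note [measurable] = borel_measurable_continuous_onI[OF u_cont]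
  have [measurable]: "W b \<in> borel_measurable borel" for b using W_cont by (rule borel_measurable_continuous_onI)
  have feq: "f x = (\<Sum>b\<in>Basis. u x * W b x)" for x
  proof -
    have "f x = u x * w x"
    proof (cases "x = 0 \<or> R + 1 \<le> norm x")
      case True then show ?thesis using near[of x] far[of x] \<epsilon> by (auto simp: u_def)
    next
      case False then show ?thesis using wpos[of x] by (simp add: u_def)
    qed
    then show ?thesis by (simp add: w_def sum_distrib_left)
  qed
  have bd: "\<bar>u x * W b x\<bar> \<le> B * 2" for b x
    unfolding abs_mult using B[of x] W[of b x] by (intro mult_mono) (auto intro: order_trans[OF abs_ge_zero])
  have s0: "0 \<le> s n" for n using s(1)[of n] by simp
  have intP: "integrable (P (s n)) (\<lambda>x. u x * W b x)" for n b
    by (rule integrable_P_bounded[OF s0, where B = "B * 2"]) (use bd in auto)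
  have intnu: "integrable \<nu> (\<lambda>x. u x * W b x)" for b
    by (rule integrable_away_from_0[OF _ \<epsilon>(1), where B = "B * 2"]) (use bd u_zero in auto)
  have "(\<lambda>n. \<Sum>b\<in>Basis. (\<integral>x. u x * W b x \<partial>P (s n)) / s n) \<longlonglongrightarrow> (\<Sum>b\<in>Basis. \<integral>x. u x * W b x \<partial>\<nu>)"
    unfolding W_def by (intro tendsto_sum tendsto_integral_cos_weight[OF u_cont u_far s])
  then show ?thesis
    unfolding feq using intP intnu by (simp add: sum_divide_distrib)
qed

section \<open>Tightness of the rescaled laws\<close>

lemma integral_gaussian_defect:
  assumes t: "0 \<le> t"
  shows "(\<integral>x. 1 - exp (- (v \<bullet> x)\<^sup>2 / 2) \<partial>P t)
       = (\<integral>s. 1 - Re (exp (- of_real t * psi (s *\<^sub>R v))) \<partial>std_normal)"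
  using integral_gaussian_average[OF prob[OF t] sets_P[OF t], of v] unfolding charfun[OF t] .

text \<open>A bound proportional to \<open>t\<close>, sufficient for the tails, where \<open>psi\<close> is evaluated near \<open>0\<close>.\<close>

lemma one_minus_Re_charfun_bounds:
  assumes "0 \<le> t"
  shows "0 \<le> 1 - Re (exp (- of_real t * psi \<xi>))" "1 - Re (exp (- of_real t * psi \<xi>)) \<le> 2 * t * norm (psi \<xi>)"
proof -
  have "norm (exp (- of_real t * psi \<xi>)) \<le> 1"
    using assms Re_psi_nonneg[of \<xi>] by simp
  then show "0 \<le> 1 - Re (exp (- of_real t * psi \<xi>))"
    using complex_Re_le_cmod[of "exp (- of_real t * psi \<xi>)"] by linarith
  have "1 - Re (exp (- of_real t * psi \<xi>)) \<le> t * Re (psi \<xi>) + \<bar>t * Im (psi \<xi>)\<bar>"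
    using one_minus_Re_exp_le[OF assms Re_psi_nonneg[of \<xi>]] one_minus_cos_le_abs[of "t * Im (psi \<xi>)"] by linarith
  also have "\<dots> = t * Re (psi \<xi>) + t * \<bar>Im (psi \<xi>)\<bar>" using assms by (simp add: abs_mult)
  also have "\<dots> \<le> t * norm (psi \<xi>) + t * norm (psi \<xi>)"
    using assms by (intro add_mono mult_left_mono complex_Re_le_cmod abs_Im_le_cmod)
  finally show "1 - Re (exp (- of_real t * psi \<xi>)) \<le> 2 * t * norm (psi \<xi>)" by simp
qed

lemma integrable_norm_psi: "integrable std_normal (\<lambda>s. norm (psi (s *\<^sub>R v)))"
proof -
  obtain K where K: "\<And>\<xi>. norm (psi \<xi>) \<le> K * (1 + (norm \<xi>)\<^sup>2)" using norm_psi_bound by blast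
  show ?thesis
  proof (rule Bochner_Integration.integrable_bound[OF integrable_mult_right[OF integrable_std_normal_powers(1)[of "norm v"], of K]])
    show "AE s in std_normal. norm (norm (psi (s *\<^sub>R v))) \<le> norm (K * (1 + (norm v * s)\<^sup>2))"
      using K[of "s *\<^sub>R v" for s] order_trans[OF _ abs_ge_self]
      by (intro AE_I2) (auto simp: power_mult_distrib mult.commute)
  qed measurable
qed

lemma integral_gaussian_defect_le:
  assumes t: "0 \<le> t"
  shows "(\<integral>x. 1 - exp (- (v \<bullet> x)\<^sup>2 / 2) \<partial>P t)
       \<le> 2 * t * (\<integral>s. norm (psi (s *\<^sub>R v)) \<partial>std_normal)"
proof -
  have "(\<integral>x. 1 - exp (- (v \<bullet> x)\<^sup>2 / 2) \<partial>P t)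
      \<le> (\<integral>s. 2 * t * norm (psi (s *\<^sub>R v)) \<partial>std_normal)"
    unfolding integral_gaussian_defect[OF t]
    by (intro integral_mono_AE' AE_I2 integrable_mult_right integrable_norm_psi one_minus_Re_charfun_bounds t)
       (use t in simp)
  then show ?thesis by simp
qed

lemma measure_tail_le:
  assumes t: "0 \<le> t" and R: "0 < R"
  shows "measure (P t) {x. R \<le> norm x}
       \<le> 8 * t * (\<Sum>b\<in>Basis. \<integral>s. norm (psi (s *\<^sub>R ((real CARD('d) / R) *\<^sub>R b))) \<partial>std_normal)"
proof -
  interpret prob_space "P t" by (rule prob) fact
  note [measurable_cong] = sets_P[OF t]
  let ?v = "\<lambda>b :: real ^ 'd. (real CARD('d) / R) *\<^sub>R b"
  let ?D = "\<lambda>b x. 1 - exp (- (?v b \<bullet> x)\<^sup>2 / 2)"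
  have int: "integrable (P t) (\<lambda>x. 4 * (\<Sum>b\<in>Basis. ?D b x))"
    by (intro integrable_mult_right Bochner_Integration.integrable_sum integrable_P_bounded[OF t, where B = 1]) auto
  have "measure (P t) {x. R \<le> norm x} = (\<integral>x. indicator {x. R \<le> norm x} x \<partial>P t)"
    using space_P[OF t] by simp
  also have "\<dots> \<le> (\<integral>x. 4 * (\<Sum>b\<in>Basis. ?D b x) \<partial>P t)"
  proof (rule integral_mono_AE'[OF int])
    show "AE x in P t. indicator {x. R \<le> norm x} x \<le> 4 * (\<Sum>b\<in>Basis. ?D b x)"
    proof (intro AE_I2)
      fix x
      show "indicator {x. R \<le> norm x} x \<le> 4 * (\<Sum>b\<in>Basis. ?D b x)"
      proof (cases "R \<le> norm x")
        case True
        obtain b where b: "b \<in> Basis" "norm x \<le> real CARD('d) * \<bar>x \<bullet> b\<bar>"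
          using exists_large_component[of x] by auto
        have "1 \<le> \<bar>?v b \<bullet> x\<bar>"
          using b(2) True R by (auto simp: abs_mult inner_commute field_simps)
        from one_le_gaussian_defect[OF this] have "1 \<le> 4 * ?D b x" .
        also have "?D b x \<le> (\<Sum>b\<in>Basis. ?D b x)" using b(1) by (intro member_le_sum) auto
        finally show ?thesis using True by simp
      qed (auto intro!: sum_nonneg)
    qed
  qed (auto intro!: AE_I2 sum_nonneg)
  also have "\<dots> = 4 * (\<Sum>b\<in>Basis. \<integral>x. ?D b x \<partial>P t)"
    by (subst integral_mult_right_zero, subst Bochner_Integration.integral_sum)
       (auto intro!: integrable_P_bounded[OF t, where B = 1])
  also have "\<dots> \<le> 4 * (\<Sum>b\<in>Basis. 2 * t * (\<integral>s. norm (psi (s *\<^sub>R ?v b)) \<partial>std_normal))"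
    by (intro mult_left_mono sum_mono integral_gaussian_defect_le t) auto
  finally show ?thesis by (simp add: sum_distrib_left mult_ac)
qed

text \<open>Large values of \<open>x\<close> correspond to low frequencies, and \<open>psi\<close> is continuous with value \<open>0\<close> at \<open>0\<close>.\<close>

lemma uniformly_small_tail:
  assumes \<delta>: "0 < \<delta>"
  shows "\<exists>R>0. \<forall>t\<ge>0. measure (P t) {x. R \<le> norm x} \<le> \<delta> * t"
proof -
  obtain K where K: "K \<ge> 0" "\<And>\<xi>. norm (psi \<xi>) \<le> K * (1 + (norm \<xi>)\<^sup>2)" using norm_psi_bound by blast
  let ?d = "real CARD('d)"
  let ?I = "\<lambda>n b. \<integral>s. norm (psi (s *\<^sub>R ((?d / real (Suc n)) *\<^sub>R b))) \<partial>std_normal"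
  have lim: "(\<lambda>n. ?I n b) \<longlonglongrightarrow> (\<integral>s. 0 \<partial>std_normal)" if b: "b \<in> Basis" for b :: "real ^ 'd"
  proof (rule integral_dominated_convergence[where w = "\<lambda>s. K * (1 + (?d * s)\<^sup>2)"])
    show "integrable std_normal (\<lambda>s. K * (1 + (?d * s)\<^sup>2))"
      by (intro integrable_mult_right integrable_std_normal_powers)
    show "AE s in std_normal. (\<lambda>n. norm (psi (s *\<^sub>R ((?d / real (Suc n)) *\<^sub>R b)))) \<longlonglongrightarrow> 0"
    proof (intro AE_I2 tendsto_norm_zero)
      fix s :: real
      have "(\<lambda>n. (s * ?d * inverse (real (Suc n))) *\<^sub>R b) \<longlonglongrightarrow> (s * ?d * 0) *\<^sub>R b"
        by (intro tendsto_intros LIMSEQ_inverse_real_of_nat)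
      then have "(\<lambda>n. s *\<^sub>R ((?d / real (Suc n)) *\<^sub>R b)) \<longlonglongrightarrow> 0"
        by (simp add: divide_inverse mult_ac)
      then have "(\<lambda>n. psi (s *\<^sub>R ((?d / real (Suc n)) *\<^sub>R b))) \<longlonglongrightarrow> psi 0"
        by (rule continuous_on_tendsto_compose[OF continuous_psi]) auto
      then show "(\<lambda>n. psi (s *\<^sub>R ((?d / real (Suc n)) *\<^sub>R b))) \<longlonglongrightarrow> 0" by (simp add: psi_0)
    qed
    show "AE s in std_normal. norm (norm (psi (s *\<^sub>R ((?d / real (Suc n)) *\<^sub>R b)))) \<le> K * (1 + (?d * s)\<^sup>2)" for n
    proof (intro AE_I2)
      fix s :: real
      have "?d / real (Suc n) \<le> ?d / 1" by (intro divide_left_mono) auto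
      then have "\<bar>s\<bar> * (?d / real (Suc n)) \<le> \<bar>s\<bar> * ?d" by (intro mult_left_mono) auto
      moreover have "norm (s *\<^sub>R ((?d / real (Suc n)) *\<^sub>R b)) = \<bar>s\<bar> * (?d / real (Suc n))"
        using b by (simp add: abs_mult)
      ultimately have "norm (s *\<^sub>R ((?d / real (Suc n)) *\<^sub>R b)) \<le> \<bar>s\<bar> * ?d" by simp
      then have "(norm (s *\<^sub>R ((?d / real (Suc n)) *\<^sub>R b)))\<^sup>2 \<le> (\<bar>s\<bar> * ?d)\<^sup>2" by (intro power_mono) auto
      then have "K * (1 + (norm (s *\<^sub>R ((?d / real (Suc n)) *\<^sub>R b)))\<^sup>2) \<le> K * (1 + (?d * s)\<^sup>2)"
        using K(1) by (intro mult_left_mono) (auto simp: power_mult_distrib mult.commute)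
      then show "norm (norm (psi (s *\<^sub>R ((?d / real (Suc n)) *\<^sub>R b)))) \<le> K * (1 + (?d * s)\<^sup>2)"
        using K(2)[of "s *\<^sub>R ((?d / real (Suc n)) *\<^sub>R b)"] by simp
    qed
  qed measurable
  have "(\<lambda>n. 8 * (\<Sum>b\<in>Basis. ?I n b)) \<longlonglongrightarrow> 8 * (\<Sum>b\<in>(Basis :: (real ^ 'd) set). 0)"
    using lim by (intro tendsto_intros) simp
  then have "\<forall>\<^sub>F n in sequentially. 8 * (\<Sum>b\<in>Basis. ?I n b) < \<delta>"
    using \<delta> by (intro order_tendstoD(2)) auto
  then obtain n where n: "8 * (\<Sum>b\<in>Basis. ?I n b) < \<delta>"
    by (meson eventually_happens trivial_limit_sequentially)
  have "measure (P t) {x. real (Suc n) \<le> norm x} \<le> \<delta> * t" if "0 \<le> t" for t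
  proof -
    have "measure (P t) {x. real (Suc n) \<le> norm x} \<le> (8 * (\<Sum>b\<in>Basis. ?I n b)) * t"
      using measure_tail_le[OF that, of "real (Suc n)"] by (simp add: mult_ac)
    also have "\<dots> \<le> \<delta> * t" using n that by (intro mult_right_mono) auto
    finally show ?thesis .
  qed
  then show ?thesis by (intro exI[of _ "real (Suc n)"]) auto
qed

end

section \<open>Moments of small jumps\<close>

lemma min_one_scaled_le:
  fixes u v c :: real
  assumes "\<bar>u\<bar> \<le> c * v" "1 \<le> c" "0 \<le> v"
  shows "min 1 (u\<^sup>2) \<le> c\<^sup>2 * min 1 (v\<^sup>2)"
proof -
  have "u\<^sup>2 \<le> (c * v)\<^sup>2" using power_mono[OF assms(1), of 2] by simp
  moreover have "1 \<le> c\<^sup>2" using assms(2) by simp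
  ultimately show ?thesis
    by (cases "v\<^sup>2 \<le> 1") (auto simp: min_def power_mult_distrib)
qed

lemma powr_le_one_plus_square:
  fixes s \<beta> :: real
  assumes "0 \<le> \<beta>" "\<beta> \<le> 2"
  shows "\<bar>s\<bar> powr \<beta> \<le> 1 + s\<^sup>2"
proof (cases "\<bar>s\<bar> \<le> 1")
  case True
  then have "\<bar>s\<bar> powr \<beta> \<le> 1" using assms by (intro powr_le1) auto
  then show ?thesis using zero_le_power2[of s] by linarith
next
  case False
  then have "\<bar>s\<bar> powr \<beta> \<le> \<bar>s\<bar> powr 2" using assms by (intro powr_mono) auto
  also have "\<bar>s\<bar> powr 2 = s\<^sup>2" using False by (simp add: powr_numeral)
  finally show ?thesis by simp
qed

lemma exists_dyadic_shell:
  fixes r :: real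
  assumes "0 < r" "r < 1 / 2 ^ n"
  shows "\<exists>k\<ge>n. 1 / 2 ^ Suc k \<le> r \<and> r < 1 / 2 ^ k"
proof -
  have ex: "\<exists>k. 1 / 2 ^ Suc k \<le> r"
  proof -
    obtain k where "(1 / 2) ^ k < r" using real_arch_pow_inv[of r "1 / 2"] assms(1) by auto
    then have "1 / 2 ^ Suc k \<le> r" using assms(1) by (simp add: power_divide field_simps)
    then show ?thesis ..
  qed
  define k where "k = (LEAST k. 1 / 2 ^ Suc k \<le> r)"
  have k: "1 / 2 ^ Suc k \<le> r" unfolding k_def using ex by (rule LeastI_ex)
  have "\<not> k < n"
  proof
    assume "k < n"
    then have "(1::real) / 2 ^ n \<le> 1 / 2 ^ Suc k"
      by (intro divide_left_mono power_increasing) auto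
    then show False using k assms(2) by linarith
  qed
  moreover have "r < 1 / 2 ^ k"
  proof (cases k)
    case 0
    have "(1::real) / 2 ^ n \<le> 1" by simp
    then have "r < 1" using assms(2) by linarith
    then show ?thesis using 0 by simp
  next
    case (Suc j)
    then have "j < (LEAST k. 1 / 2 ^ Suc k \<le> r)" unfolding k_def by simp
    then have "\<not> 1 / 2 ^ Suc j \<le> r" by (rule not_less_Least)
    then show ?thesis using Suc by simp
  qed
  ultimately show ?thesis using k by (intro exI[of _ k]) auto
qed

text \<open>Bookkeeping for \<open>small_jump_moment\<close>: \<open>d\<close> is the dimension, \<open>T\<close> a tail of the series of truncated
  moments and \<open>Q\<close> the power of the scale factor of the frequencies.\<close>

lemma collect_dyadic_bound:
  "4 * (d * (2 * M * (t * T + D * (t * \<eta> * Q)) + (t * K)\<^sup>2 * S))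
    = t * (8 * d * M * T + (8 * d * M * D * Q) * \<eta> + (4 * d * K\<^sup>2 * S) * t)"
  for d M t T D \<eta> Q K S :: real
proof -
  have "(8::real) = 4 * 2" by simp
  then show ?thesis by (simp only: power2_eq_square ring_distribs mult_ac)
qed

context levy_laws
begin

text \<open>The factor \<open>2 * CARD('d)\<close> makes the Gaussian defect at least \<open>1 / 4\<close> on the
  dyadic shell of index \<open>k\<close> for at least one direction \<open>b\<close>; see \<open>norm_powr_le_dyadic_defects\<close>.\<close>

definition dyadic_vec :: "nat \<Rightarrow> real ^ 'd \<Rightarrow> real ^ 'd" where
  "dyadic_vec k b = (2 ^ k * (2 * real CARD('d))) *\<^sub>R b"

definition defect :: "real ^ 'd \<Rightarrow> real ^ 'd \<Rightarrow> real" where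
  "defect v x = 1 - exp (- (v \<bullet> x)\<^sup>2 / 2)"

lemma defect_measurable [measurable]: "defect v \<in> borel_measurable borel"
  unfolding defect_def by measurable

lemma defect_nonneg: "0 \<le> defect v x" and defect_le_1: "defect v x \<le> 1"
  by (auto simp: defect_def)

abbreviation small_moment :: "real \<Rightarrow> real \<Rightarrow> real \<Rightarrow> ennreal" where
  "small_moment \<beta> \<epsilon> t \<equiv> \<integral>\<^sup>+x. ennreal (indicator {x. norm x < \<epsilon>} x * norm x powr \<beta>) \<partial>P t"

text \<open>A single summand suffices: the one for the dyadic shell that contains \<open>x\<close> and a largest coordinate of \<open>x\<close>.
  Starting the sum at \<open>n\<close> is possible because \<open>x\<close> lies in a small ball.\<close>

lemma norm_powr_le_dyadic_defects:
  assumes \<beta>: "0 < \<beta>" and x: "norm x < 1 / 2 ^ n"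
  shows "ennreal (norm x powr \<beta>)
    \<le> (\<Sum>j. \<Sum>b\<in>Basis. ennreal (4 * (2 powr (- \<beta> * real (j + n)) * defect (dyadic_vec (j + n) b) x)))"
proof (cases "x = 0")
  case False
  then obtain k where k: "n \<le> k" "1 / 2 ^ Suc k \<le> norm x" "norm x < 1 / 2 ^ k"
    using exists_dyadic_shell[OF _ x] by auto
  obtain b where b: "b \<in> Basis" "norm x \<le> real CARD('d) * \<bar>x \<bullet> b\<bar>"
    using exists_large_component[of x] by auto
  have "1 \<le> 2 ^ Suc k * norm x" using k(2) by (simp add: field_simps)
  also have "\<dots> \<le> 2 ^ Suc k * (real CARD('d) * \<bar>x \<bullet> b\<bar>)"
    using b(2) by (intro mult_left_mono) auto
  also have "\<dots> = \<bar>dyadic_vec k b \<bullet> x\<bar>"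
    by (simp add: dyadic_vec_def abs_mult inner_commute mult_ac)
  finally have d: "1 \<le> 4 * defect (dyadic_vec k b) x"
    unfolding defect_def by (rule one_le_gaussian_defect)
  have "norm x powr \<beta> \<le> (1 / 2 ^ k) powr \<beta>"
    using k(3) \<beta> by (intro powr_mono2) auto
  also have "(1 / 2 ^ k) powr \<beta> = 2 powr (- \<beta> * real k)"
    by (simp add: powr_divide powr_minus_divide powr_powr mult.commute flip: powr_realpow)
  also have "\<dots> \<le> 2 powr (- \<beta> * real k) * (4 * defect (dyadic_vec k b) x)"
    using mult_left_mono[OF d, of "2 powr (- \<beta> * real k)"] by simp
  finally have "ennreal (norm x powr \<beta>) \<le> ennreal (4 * (2 powr (- \<beta> * real k) * defect (dyadic_vec k b) x))"
    by (intro ennreal_leI) (simp add: mult_ac)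
  also have "\<dots> \<le> (\<Sum>b\<in>Basis. ennreal (4 * (2 powr (- \<beta> * real k) * defect (dyadic_vec k b) x)))"
    using b(1) by (intro member_le_sum) auto
  also have "\<dots> = (\<Sum>b\<in>Basis. ennreal (4 * (2 powr (- \<beta> * real ((k - n) + n)) * defect (dyadic_vec ((k - n) + n) b) x)))"
    using k(1) by simp
  also have "\<dots> \<le> (\<Sum>j. \<Sum>b\<in>Basis. ennreal (4 * (2 powr (- \<beta> * real (j + n)) * defect (dyadic_vec (j + n) b) x)))"
    using sum_le_suminf[of "\<lambda>j. \<Sum>b\<in>Basis. ennreal (4 * (2 powr (- \<beta> * real (j + n)) * defect (dyadic_vec (j + n) b) x))" "{k - n}"]
    by simp
  finally show ?thesis .
qed simp

text \<open>The size of \<open>Re psi\<close> at frequencies of order \<open>2 ^ k\<close>.\<close>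

definition truncated_moment :: "nat \<Rightarrow> real" where
  "truncated_moment k = (\<integral>y. min 1 ((2 ^ k * (2 * real CARD('d)) * norm y)\<^sup>2) \<partial>\<nu>)"

lemma integrable_truncated_moment: "integrable \<nu> (\<lambda>y. min 1 ((a * norm y)\<^sup>2))"
proof (rule integrable_min_bound[where C = "1 + a\<^sup>2"])
  fix y :: "real ^ 'd"
  show "norm (min 1 ((a * norm y)\<^sup>2)) \<le> (1 + a\<^sup>2) * min 1 ((norm y)\<^sup>2)"
  proof (cases "1 \<le> (norm y)\<^sup>2")
    case True then show ?thesis by (auto simp: min_def intro: order_trans[of _ "1::real"])
  next
    case False
    have "min 1 ((a * norm y)\<^sup>2) \<le> a\<^sup>2 * (norm y)\<^sup>2" by (simp add: power_mult_distrib)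
    also have "\<dots> \<le> (1 + a\<^sup>2) * (norm y)\<^sup>2" by (intro mult_right_mono) auto
    finally show ?thesis using False by (simp add: min_def)
  qed
qed measurable

text \<open>Summation under the integral turns the weighted truncated second moments into the moment of order
  \<open>\<beta>\<close> of the small jumps, by \<open>dyadic_sum_min_powr_le\<close>.\<close>

lemma summable_truncated_moment:
  assumes \<beta>: "0 < \<beta>" "\<beta> < 2" and int: "finite_small_moment \<beta>"
  shows "summable (\<lambda>k. 2 powr (- \<beta> * real k) * truncated_moment k)"
proof -
  let ?d = "2 * real CARD('d)"
  let ?w = "\<lambda>k. 2 powr (- \<beta> * real k)"
  obtain C where C: "C > 0" "\<And>n \<tau>. 0 < \<tau> \<Longrightarrow> (\<Sum>k<n. ?w k * min 1 ((2 ^ k * \<tau>) powr 2)) \<le> C * \<tau> powr \<beta>"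
    using dyadic_sum_min_powr_le[OF \<beta>] by blast
  let ?G = "\<lambda>y. C * ?d powr \<beta> * (indicator {y. norm y < 1} y * norm y powr \<beta>)
      + C * indicator {y. 1 \<le> norm y} y"
  have intG: "integrable \<nu> ?G"
    by (intro Bochner_Integration.integrable_add integrable_mult_right int integrable_tail) auto
  have bound: "(\<Sum>k<n. ?w k * min 1 ((2 ^ k * ?d * norm y)\<^sup>2)) \<le> ?G y" for n y
  proof -
    consider "y = 0" | "y \<noteq> 0" "norm y < 1" | "1 \<le> norm y" by linarith
    then show ?thesis
    proof cases
      case 1 then show ?thesis by simp
    next
      case 2
      have "(\<Sum>k<n. ?w k * min 1 ((2 ^ k * ?d * norm y)\<^sup>2)) = (\<Sum>k<n. ?w k * min 1 ((2 ^ k * (?d * norm y)) powr 2))"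
        using 2 by (simp add: powr_numeral mult_ac)
      also have "\<dots> \<le> C * (?d * norm y) powr \<beta>" using 2 by (intro C) auto
      finally show ?thesis using 2 by (simp add: powr_mult mult_ac)
    next
      case 3
      have "(\<Sum>k<n. ?w k * min 1 ((2 ^ k * ?d * norm y)\<^sup>2)) \<le> (\<Sum>k<n. ?w k * min 1 ((2 ^ k * 1) powr 2))"
      proof (intro sum_mono mult_left_mono)
        fix k
        have "(1::real) \<le> 2 ^ k" by simp
        then show "min 1 ((2 ^ k * ?d * norm y)\<^sup>2) \<le> min 1 ((2 ^ k * 1) powr (2::real))"
          by (auto simp: min_def ge_one_powr_ge_zero)
      qed simp
      also have "\<dots> \<le> C * 1 powr \<beta>" by (intro C) auto
      finally show ?thesis using 3 by simp
    qed
  qed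
  show ?thesis
  proof (rule summableI_nonneg_bounded)
    show "0 \<le> ?w k * truncated_moment k" for k
      unfolding truncated_moment_def by (intro mult_nonneg_nonneg integral_nonneg_AE AE_I2) auto
    show "(\<Sum>k<n. ?w k * truncated_moment k) \<le> (\<integral>y. ?G y \<partial>\<nu>)" for n
    proof -
      have "(\<Sum>k<n. ?w k * truncated_moment k) = (\<integral>y. (\<Sum>k<n. ?w k * min 1 ((2 ^ k * ?d * norm y)\<^sup>2)) \<partial>\<nu>)"
        unfolding truncated_moment_def by (simp add: Bochner_Integration.integral_sum integrable_truncated_moment)
      also have "\<dots> \<le> (\<integral>y. ?G y \<partial>\<nu>)"
        by (intro integral_mono Bochner_Integration.integrable_sum integrable_mult_right
            integrable_truncated_moment intG bound)
      finally show ?thesis .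
    qed
  qed
qed

lemma Re_psi_dyadic_le:
  assumes b: "b \<in> Basis"
  shows "Re (psi (s *\<^sub>R dyadic_vec k b)) \<le> 2 * (1 + s\<^sup>2)\<^sup>2 * truncated_moment k"
proof -
  let ?a = "2 ^ k * (2 * real CARD('d))"
  have "Re (psi (s *\<^sub>R dyadic_vec k b)) \<le> (\<integral>y. 2 * (1 + s\<^sup>2)\<^sup>2 * min 1 ((?a * norm y)\<^sup>2) \<partial>\<nu>)"
    unfolding Re_psi
  proof (intro integral_mono integrable_one_minus_cos integrable_mult_right integrable_truncated_moment)
    fix y :: "real ^ 'd"
    let ?z = "(s *\<^sub>R dyadic_vec k b) \<bullet> y"
    have "1 - cos ?z \<le> 2 * min 1 (?z\<^sup>2)"
      using one_minus_cos_le_split[of ?z "\<bar>?z\<bar>" 0] by simp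
    also have "min 1 (?z\<^sup>2) \<le> (1 + s\<^sup>2)\<^sup>2 * min 1 ((?a * norm y)\<^sup>2)"
    proof (rule min_one_scaled_le)
      have "\<bar>?z\<bar> = \<bar>s\<bar> * (?a * \<bar>b \<bullet> y\<bar>)" by (simp add: dyadic_vec_def abs_mult mult_ac)
      also have "\<dots> \<le> (1 + s\<^sup>2) * (?a * norm y)"
        using b Basis_le_norm[OF b, of y] powr_le_one_plus_square[of 1 s]
        by (intro mult_mono mult_left_mono) (auto simp: inner_commute)
      finally show "\<bar>?z\<bar> \<le> (1 + s\<^sup>2) * (?a * norm y)" .
    qed auto
    finally show "1 - cos ?z \<le> 2 * (1 + s\<^sup>2)\<^sup>2 * min 1 ((?a * norm y)\<^sup>2)" by simp
  qed
  then show ?thesis by (simp add: truncated_moment_def)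
qed

text \<open>The powers of \<open>1 + s\<^sup>2\<close> absorb the random factor \<open>s\<close> of the frequency; their Gaussian mean is finite.\<close>

lemma integral_defect_dyadic_le:
  assumes t: "0 \<le> t" and b: "b \<in> Basis" and \<beta>: "0 \<le> \<beta>" "\<beta> \<le> 2" and \<eta>: "0 \<le> \<eta>" "0 \<le> K"
    and Im: "\<And>\<xi>. \<bar>Im (psi \<xi>)\<bar> \<le> \<eta> * norm \<xi> powr \<beta> + K"
  shows "(\<integral>x. defect (dyadic_vec k b) x \<partial>P t)
      \<le> 2 * (\<integral>s. (1 + s\<^sup>2)\<^sup>2 \<partial>std_normal)
          * (t * truncated_moment k + min 1 ((t * \<eta> * (2 ^ k * (2 * real CARD('d))) powr \<beta>)\<^sup>2)) + (t * K)\<^sup>2"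
proof -
  interpret N: prob_space std_normal by (rule prob_space_std_normal)
  let ?a = "2 ^ k * (2 * real CARD('d))"
  let ?v = "dyadic_vec k b"
  let ?m = "t * truncated_moment k + min 1 ((t * \<eta> * ?a powr \<beta>)\<^sup>2)"
  have int: "integrable std_normal (\<lambda>s. 2 * ?m * (1 + s\<^sup>2)\<^sup>2 + (t * K)\<^sup>2)"
    by (intro Bochner_Integration.integrable_add integrable_mult_right integrable_std_normal_powers) simp
  have pt: "1 - Re (exp (- of_real t * psi (s *\<^sub>R ?v))) \<le> 2 * ?m * (1 + s\<^sup>2)\<^sup>2 + (t * K)\<^sup>2" for s
  proof -
    let ?p = "t * \<eta> * (\<bar>s\<bar> * ?a) powr \<beta>"
    have norm: "norm (s *\<^sub>R ?v) = \<bar>s\<bar> * ?a" using b by (simp add: dyadic_vec_def abs_mult)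
    have "\<bar>t * Im (psi (s *\<^sub>R ?v))\<bar> \<le> t * (\<eta> * (\<bar>s\<bar> * ?a) powr \<beta> + K)"
      using Im[of "s *\<^sub>R ?v"] t unfolding norm by (simp add: abs_mult mult_left_mono)
    then have "1 - cos (t * Im (psi (s *\<^sub>R ?v))) \<le> 2 * min 1 (?p\<^sup>2) + (t * K)\<^sup>2"
      using t \<eta> by (intro one_minus_cos_le_split) (auto simp: algebra_simps)
    also have "min 1 (?p\<^sup>2) \<le> (1 + s\<^sup>2)\<^sup>2 * min 1 ((t * \<eta> * ?a powr \<beta>)\<^sup>2)"
    proof (rule min_one_scaled_le)
      have "\<bar>?p\<bar> = \<bar>s\<bar> powr \<beta> * (t * \<eta> * ?a powr \<beta>)"
        using t \<eta> by (simp add: powr_mult abs_mult mult_ac)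
      also have "\<dots> \<le> (1 + s\<^sup>2) * (t * \<eta> * ?a powr \<beta>)"
        using t \<eta> by (intro mult_right_mono powr_le_one_plus_square \<beta>) auto
      finally show "\<bar>?p\<bar> \<le> (1 + s\<^sup>2) * (t * \<eta> * ?a powr \<beta>)" .
    qed (use t \<eta> in auto)
    finally have 1: "1 - cos (t * Im (psi (s *\<^sub>R ?v)))
        \<le> 2 * ((1 + s\<^sup>2)\<^sup>2 * min 1 ((t * \<eta> * ?a powr \<beta>)\<^sup>2)) + (t * K)\<^sup>2" by simp
    have 2: "t * Re (psi (s *\<^sub>R ?v)) \<le> t * (2 * (1 + s\<^sup>2)\<^sup>2 * truncated_moment k)"
      by (intro mult_left_mono Re_psi_dyadic_le b t)
    have "1 - Re (exp (- of_real t * psi (s *\<^sub>R ?v)))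
        \<le> t * Re (psi (s *\<^sub>R ?v)) + (1 - cos (t * Im (psi (s *\<^sub>R ?v))))"
      by (rule one_minus_Re_exp_le[OF t Re_psi_nonneg])
    also have "\<dots> \<le> t * (2 * (1 + s\<^sup>2)\<^sup>2 * truncated_moment k)
        + (2 * ((1 + s\<^sup>2)\<^sup>2 * min 1 ((t * \<eta> * ?a powr \<beta>)\<^sup>2)) + (t * K)\<^sup>2)"
      using 1 2 by linarith
    also have "\<dots> = 2 * ?m * (1 + s\<^sup>2)\<^sup>2 + (t * K)\<^sup>2" by (simp add: algebra_simps)
    finally show ?thesis .
  qed
  have m0: "0 \<le> ?m"
  proof -
    have "0 \<le> truncated_moment k"
      unfolding truncated_moment_def by (intro integral_nonneg_AE AE_I2) auto
    then show ?thesis using t by simp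
  qed
  have "(\<integral>x. defect ?v x \<partial>P t) \<le> (\<integral>s. 2 * ?m * (1 + s\<^sup>2)\<^sup>2 + (t * K)\<^sup>2 \<partial>std_normal)"
    unfolding defect_def integral_gaussian_defect[OF t]
    by (intro integral_mono_AE'[OF int] AE_I2 pt) (use m0 in \<open>auto intro!: add_nonneg_nonneg mult_nonneg_nonneg\<close>)
  also have "\<dots> = 2 * ?m * (\<integral>s. (1 + s\<^sup>2)\<^sup>2 \<partial>std_normal) + (t * K)\<^sup>2"
    by (subst Bochner_Integration.integral_add)
       (auto simp: N.prob_space[simplified] intro!: integrable_mult_right integrable_std_normal_powers)
  finally show ?thesis by (simp only: mult_ac)
qed

text \<open>The constant \<open>C\<close> does not depend on \<open>\<eta>\<close>, so that a small \<open>\<eta>\<close> makes the \<open>\<beta>\<close>-th moment over a small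
  ball small compared with \<open>t\<close>; a fixed \<open>\<eta>\<close> still makes it \<open>O(t)\<close>. The tail of the series over \<open>k \<ge> n\<close>
  is what shrinks with the radius \<open>1 / 2 ^ n\<close>.\<close>

lemma small_jump_moment:
  assumes \<beta>: "0 < \<beta>" "\<beta> < 2" and int: "finite_small_moment \<beta>"
  shows "\<exists>C>0. \<forall>\<eta>\<ge>0. \<forall>K\<ge>0. (\<forall>\<xi>. \<bar>Im (psi \<xi>)\<bar> \<le> \<eta> * norm \<xi> powr \<beta> + K) \<longrightarrow>
    (\<forall>\<delta>>0. \<exists>\<epsilon>>0. \<exists>L. \<forall>t>0.
      small_moment \<beta> \<epsilon> t \<le> ennreal (t * (\<delta> + C * \<eta> + L * t)))"
proof -
  let ?d = "real CARD('d)"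
  let ?w = "\<lambda>k. 2 powr (- \<beta> * real k)"
  define M where "M = (\<integral>s. (1 + s\<^sup>2)\<^sup>2 \<partial>std_normal)"
  have M0: "0 \<le> M" unfolding M_def by simp
  obtain D where D: "D > 0"
    "\<And>n \<tau>. 0 < \<tau> \<Longrightarrow> (\<Sum>k<n. ?w k * min 1 ((2 ^ k * \<tau>) powr (2 * \<beta>))) \<le> D * \<tau> powr \<beta>"
    using dyadic_sum_min_powr_le[OF \<beta>(1), of "2 * \<beta>"] \<beta> by auto
  define S where "S = (\<Sum>k. ?w k)"
  have wk: "?w k = (2 powr - \<beta>) ^ k" for k by (simp add: powr_power mult.commute)
  have sum_w: "summable ?w"
    unfolding wk using \<beta> powr_less_one[of 2 "- \<beta>"] by (intro summable_geometric) auto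
  define tail where "tail n = (\<Sum>j. ?w (j + n) * truncated_moment (j + n))" for n
  have tm0: "0 \<le> truncated_moment k" for k
    unfolding truncated_moment_def by (intro integral_nonneg_AE AE_I2) auto
  note summ = summable_truncated_moment[OF \<beta> int]
  have shift_le: "(\<Sum>j<N. f (j + n)) \<le> (\<Sum>k<N + n. f k)" if "\<And>k. 0 \<le> f k" for f :: "nat \<Rightarrow> real" and N n
  proof -
    have "(\<Sum>j<N. f (j + n)) = sum f {n..<N + n}"
      using sum.shift_bounds_nat_ivl[of f 0 n N] by (simp add: atLeast0LessThan)
    also have "\<dots> \<le> sum f {..<N + n}" using that by (intro sum_mono2) auto
    finally show ?thesis .
  qed
  have summ_shift: "summable (\<lambda>j. ?w (j + n) * truncated_moment (j + n))" for n
    using summable_ignore_initial_segment[OF summ, of n] .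
  have card_Basis_sum: "(\<Sum>b\<in>(Basis :: (real ^ 'd) set). c) = ?d * c" for c :: real by simp
  define C where "C = 8 * ?d * M * D * (2 * ?d) powr \<beta> + 1"
  have C: "0 < C" unfolding C_def using M0 D by (intro add_nonneg_pos mult_nonneg_nonneg) auto
  have main: "\<exists>\<epsilon>>0. \<exists>L. \<forall>t>0. small_moment \<beta> \<epsilon> t
      \<le> ennreal (t * (\<delta> + C * \<eta> + L * t))"
    if \<eta>: "0 \<le> \<eta>" "0 \<le> K" and Im: "\<And>\<xi>. \<bar>Im (psi \<xi>)\<bar> \<le> \<eta> * norm \<xi> powr \<beta> + K" and \<delta>: "0 < \<delta>" for \<eta> K \<delta>
  proof -
    have "0 < \<delta> / (8 * ?d * M + 1)" using \<delta> M0 by (intro divide_pos_pos add_nonneg_pos mult_nonneg_nonneg) auto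
    then obtain n where "norm (\<Sum>i. ?w (i + n) * truncated_moment (i + n)) < \<delta> / (8 * ?d * M + 1)"
      using suminf_exist_split[OF _ summ] by blast
    then have tn: "tail n < \<delta> / (8 * ?d * M + 1)" by (simp add: tail_def abs_less_iff)
    have tail0: "0 \<le> tail n"
      unfolding tail_def using tm0 by (intro suminf_nonneg summ_shift) auto
    have pos: "0 < 8 * ?d * M + 1" using M0 by (intro add_nonneg_pos mult_nonneg_nonneg) auto
    have "(8 * ?d * M + 1) * tail n < \<delta>" using tn pos by (simp add: field_simps)
    then have tn: "8 * ?d * M * tail n \<le> \<delta>" using tail0 by (simp add: algebra_simps)
    have partial: "(\<Sum>j<N. ?w (j + n) * (\<integral>x. defect (dyadic_vec (j + n) b) x \<partial>P t))
        \<le> 2 * M * (t * tail n + D * (t * \<eta> * (2 * ?d) powr \<beta>)) + (t * K)\<^sup>2 * S"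
      if t: "0 < t" and b: "b \<in> Basis" for N t b
    proof -
      let ?m = "\<lambda>k. min 1 ((t * \<eta> * (2 ^ k * (2 * ?d)) powr \<beta>)\<^sup>2)"
      have "(\<Sum>j<N. ?w (j + n) * (\<integral>x. defect (dyadic_vec (j + n) b) x \<partial>P t))
          \<le> (\<Sum>j<N. ?w (j + n) * (2 * M * (t * truncated_moment (j + n) + ?m (j + n)) + (t * K)\<^sup>2))"
        unfolding M_def using t \<beta> \<eta>
        by (intro sum_mono mult_left_mono integral_defect_dyadic_le b Im) auto
      also have "\<dots> = 2 * M * (t * (\<Sum>j<N. ?w (j + n) * truncated_moment (j + n)) + (\<Sum>j<N. ?w (j + n) * ?m (j + n)))
          + (t * K)\<^sup>2 * (\<Sum>j<N. ?w (j + n))"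
        by (simp only: sum_distrib_left distrib_left sum.distrib mult_ac)
      also have "\<dots> \<le> 2 * M * (t * tail n + D * (t * \<eta> * (2 * ?d) powr \<beta>)) + (t * K)\<^sup>2 * S"
      proof (intro add_mono mult_left_mono)
        show "(\<Sum>j<N. ?w (j + n) * truncated_moment (j + n)) \<le> tail n"
          unfolding tail_def using tm0 by (intro sum_le_suminf summ_shift) auto
        have "(\<Sum>j<N. ?w (j + n)) \<le> (\<Sum>k<N + n. ?w k)" by (rule shift_le) simp
        also have "\<dots> \<le> S" unfolding S_def using sum_w by (intro sum_le_suminf) auto
        finally show "(\<Sum>j<N. ?w (j + n)) \<le> S" .
        show "(\<Sum>j<N. ?w (j + n) * ?m (j + n)) \<le> D * (t * \<eta> * (2 * ?d) powr \<beta>)"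
        proof (cases "\<eta> = 0")
          case False
          \<comment> \<open>this \<open>\<tau>\<close> makes the squared phase a power of \<open>2 ^ k * \<tau>\<close> with exponent \<open>2 * \<beta> > \<beta>\<close>\<close>
          define \<tau> where "\<tau> = (t * \<eta>) powr (1 / \<beta>) * (2 * ?d)"
          have t\<eta>: "0 < t * \<eta>" using t \<eta> False by simp
          then have \<tau>: "0 < \<tau>" unfolding \<tau>_def by (intro mult_pos_pos) auto
          have \<tau>\<beta>: "\<tau> powr \<beta> = t * \<eta> * (2 * ?d) powr \<beta>"
            using t\<eta> \<beta> t \<eta> by (simp add: \<tau>_def powr_mult powr_powr)
          have "?m k = min 1 ((2 ^ k * \<tau>) powr (2 * \<beta>))" for k
          proof -
            have "(2 ^ k * \<tau>) powr (2 * \<beta>) = ((2 ^ k * \<tau>) powr \<beta>) powr 2"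
              by (simp add: powr_powr mult.commute)
            also have "\<dots> = ((2 ^ k * \<tau>) powr \<beta>)\<^sup>2" using \<tau> by (simp add: powr_numeral)
            also have "(2 ^ k * \<tau>) powr \<beta> = t * \<eta> * (2 ^ k * (2 * ?d)) powr \<beta>"
              using \<tau> \<tau>\<beta> by (simp add: powr_mult mult_ac)
            finally show ?thesis by simp
          qed
          then have "(\<Sum>j<N. ?w (j + n) * ?m (j + n)) \<le> (\<Sum>k<N + n. ?w k * min 1 ((2 ^ k * \<tau>) powr (2 * \<beta>)))"
            using shift_le[of "\<lambda>k. ?w k * ?m k" n N] by simp
          also have "\<dots> \<le> D * \<tau> powr \<beta>" using \<tau> by (rule D)
          finally show ?thesis unfolding \<tau>\<beta> .
        qed (use D t in simp)
      qed (use t M0 in auto)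
      finally show ?thesis .
    qed
    define L where "L = 4 * ?d * K\<^sup>2 * S"
    have "small_moment \<beta> (1 / 2 ^ n) t
        \<le> ennreal (t * (\<delta> + C * \<eta> + L * t))" if t: "0 < t" for t
    proof -
      have t0: "0 \<le> t" using t by simp
      interpret prob_space "P t" by (rule prob) fact
      note [measurable_cong] = sets_P[OF t0]
      let ?I = "\<lambda>k b. \<integral>x. defect (dyadic_vec k b) x \<partial>P t"
      have int: "integrable (P t) (\<lambda>x. defect v x)" for v
        by (rule integrable_P_bounded[OF t0, where B = 1]) (auto simp: defect_nonneg defect_le_1)
      have "small_moment \<beta> (1 / 2 ^ n) t
          \<le> (\<integral>\<^sup>+x. (\<Sum>j. \<Sum>b\<in>Basis. ennreal (4 * (?w (j + n) * defect (dyadic_vec (j + n) b) x))) \<partial>P t)"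
        using norm_powr_le_dyadic_defects[OF \<beta>(1)]
        by (intro nn_integral_mono) (auto simp: indicator_def)
      also have "\<dots> = (\<Sum>j. \<Sum>b\<in>Basis. \<integral>\<^sup>+x. ennreal (4 * (?w (j + n) * defect (dyadic_vec (j + n) b) x)) \<partial>P t)"
        by (subst nn_integral_suminf, measurable) (subst nn_integral_sum, auto)
      also have "\<dots> = (\<Sum>j. \<Sum>b\<in>Basis. ennreal (4 * (?w (j + n) * ?I (j + n) b)))"
        by (subst nn_integral_eq_integral) (auto intro!: integrable_mult_right int AE_I2 mult_nonneg_nonneg defect_nonneg)
      also have "\<dots> \<le> ennreal (t * (\<delta> + C * \<eta> + L * t))"
      proof (rule suminf_le_const[OF summableI])
        fix N
        have I0: "0 \<le> ?I k b" for k b by (intro integral_nonneg_AE AE_I2 defect_nonneg)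
        have "(\<Sum>j<N. \<Sum>b\<in>Basis. 4 * (?w (j + n) * ?I (j + n) b))
            = 4 * (\<Sum>b\<in>Basis. \<Sum>j<N. ?w (j + n) * ?I (j + n) b)"
          by (subst sum.swap) (simp add: sum_distrib_left)
        also have "\<dots> \<le> 4 * (\<Sum>b\<in>(Basis :: (real ^ 'd) set).
            2 * M * (t * tail n + D * (t * \<eta> * (2 * ?d) powr \<beta>)) + (t * K)\<^sup>2 * S)"
          using partial[OF t] by (intro mult_left_mono sum_mono) auto
        also have "\<dots> = t * (8 * ?d * M * tail n + (8 * ?d * M * D * (2 * ?d) powr \<beta>) * \<eta> + L * t)"
          unfolding L_def card_Basis_sum by (rule collect_dyadic_bound)
        also have "\<dots> \<le> t * (\<delta> + C * \<eta> + L * t)"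
        proof (intro order_refl mult_left_mono add_mono mult_right_mono)
          show "8 * ?d * M * D * (2 * ?d) powr \<beta> \<le> C" by (simp add: C_def)
        qed (use tn t \<eta> in auto)
        finally have bound: "(\<Sum>j<N. \<Sum>b\<in>Basis. 4 * (?w (j + n) * ?I (j + n) b)) \<le> t * (\<delta> + C * \<eta> + L * t)" .
        have "(\<Sum>j<N. \<Sum>b\<in>Basis. ennreal (4 * (?w (j + n) * ?I (j + n) b)))
            = ennreal (\<Sum>j<N. \<Sum>b\<in>Basis. 4 * (?w (j + n) * ?I (j + n) b))"
          by (subst sum_ennreal[symmetric], (intro sum_nonneg mult_nonneg_nonneg I0; simp),
              intro sum.cong refl sum_ennreal mult_nonneg_nonneg I0; simp)
        also have "\<dots> \<le> ennreal (t * (\<delta> + C * \<eta> + L * t))" by (rule ennreal_leI[OF bound])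
        finally show "(\<Sum>j<N. \<Sum>b\<in>Basis. ennreal (4 * (?w (j + n) * ?I (j + n) b)))
            \<le> ennreal (t * (\<delta> + C * \<eta> + L * t))" .
      qed
      finally show ?thesis .
    qed
    then show ?thesis by (intro exI[of _ "1 / 2 ^ n"] conjI exI[of _ L]) auto
  qed
  show ?thesis using C main by (intro exI[of _ C]) blast
qed

end

section \<open>From small jumps to bounded continuous functions\<close>

context levy_jump_exponent
begin

lemma integral_nu_small:
  fixes F :: "real ^ 'd \<Rightarrow> real"
  assumes "integrable \<nu> F" "0 < \<delta>"
  shows "\<exists>\<epsilon>0>0. \<forall>\<epsilon>. 0 < \<epsilon> \<longrightarrow> \<epsilon> \<le> \<epsilon>0 \<longrightarrow> (\<integral>x. near \<epsilon> F x \<partial>\<nu>) \<le> \<delta>"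
proof -
  have F[measurable]: "F \<in> borel_measurable \<nu>" using assms(1) by auto
  have int: "integrable \<nu> (\<lambda>x. indicator A x * \<bar>F x\<bar>)" if "A \<in> sets borel" for A
    by (rule Bochner_Integration.integrable_bound[OF assms(1)]) (use that in \<open>auto simp: indicator_def\<close>)
  have "(\<lambda>n. \<integral>x. near (inverse (real (Suc n))) F x \<partial>\<nu>) \<longlonglongrightarrow> (\<integral>x. (0::real) \<partial>\<nu>)"
  proof (rule integral_dominated_convergence[where w = "\<lambda>x. \<bar>F x\<bar>"])
    show "AE x in \<nu>. (\<lambda>n. near (inverse (real (Suc n))) F x) \<longlonglongrightarrow> 0"
      using AE_nonzero
    proof eventually_elim
      case (elim x)
      then have "\<forall>\<^sub>F n in sequentially. inverse (real (Suc n)) < norm x"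
        using LIMSEQ_inverse_real_of_nat by (intro order_tendstoD(2)) auto
      then have "\<forall>\<^sub>F n in sequentially. near (inverse (real (Suc n))) F x = 0"
        by eventually_elim auto
      then show ?case by (rule tendsto_eventually)
    qed
  qed (use assms(1) in \<open>auto simp: indicator_def\<close>)
  then have "\<forall>\<^sub>F n in sequentially. (\<integral>x. near (inverse (real (Suc n))) F x \<partial>\<nu>) < \<delta>"
    using assms(2) by (intro order_tendstoD(2)) auto
  then obtain n where n: "(\<integral>x. near (inverse (real (Suc n))) F x \<partial>\<nu>) < \<delta>"
    by (meson eventually_happens trivial_limit_sequentially)
  have "(\<integral>x. near \<epsilon> F x \<partial>\<nu>) \<le> \<delta>" if "0 < \<epsilon>" "\<epsilon> \<le> inverse (real (Suc n))" for \<epsilon>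
  proof -
    have "(\<integral>x. near \<epsilon> F x \<partial>\<nu>)
        \<le> (\<integral>x. near (inverse (real (Suc n))) F x \<partial>\<nu>)"
      using that by (intro integral_mono int mult_right_mono) (auto simp: indicator_def)
    then show ?thesis using n by linarith
  qed
  then show ?thesis by (intro exI[of _ "inverse (real (Suc n))"]) auto
qed

lemma integral_nu_tail:
  fixes \<delta> :: real
  assumes "0 < \<delta>"
  shows "\<exists>R>0. (\<integral>x. indicator {x. R \<le> norm x} x \<partial>\<nu>) \<le> \<delta>"
proof -
  have "(\<lambda>n. \<integral>x. indicator {x. real (Suc n) \<le> norm x} x \<partial>\<nu>) \<longlonglongrightarrow> (\<integral>x. (0::real) \<partial>\<nu>)"
  proof (rule integral_dominated_convergence[where w = "indicator {x. 1 \<le> norm x} :: _ \<Rightarrow> real"])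
    show "AE x in \<nu>. (\<lambda>n. indicator {x. real (Suc n) \<le> norm x} x :: real) \<longlonglongrightarrow> 0"
    proof (intro AE_I2 tendsto_eventually)
      fix x :: "real ^ 'd"
      have "\<forall>\<^sub>F n in sequentially. norm x \<le> real n"
        using filterlim_real_sequentially unfolding filterlim_at_top by blast
      then show "\<forall>\<^sub>F n in sequentially. indicator {x. real (Suc n) \<le> norm x} x = (0::real)"
        by eventually_elim auto
    qed
    show "integrable \<nu> (indicator {x. 1 \<le> norm x} :: _ \<Rightarrow> real)" by (rule integrable_tail) simp
  qed (auto simp: indicator_def)
  then have "\<forall>\<^sub>F n in sequentially. (\<integral>x. indicator {x. real (Suc n) \<le> norm x} x \<partial>\<nu>) < \<delta>"
    using assms by (intro order_tendstoD(2)) auto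
  then obtain n where n: "(\<integral>x. indicator {x. real (Suc n) \<le> norm x} x \<partial>\<nu>) < \<delta>"
    by (meson eventually_happens trivial_limit_sequentially)
  then show ?thesis by (intro exI[of _ "real (Suc n)"]) auto
qed

end

context levy_laws
begin

text \<open>Cutting \<open>F\<close> off near \<open>0\<close> and near infinity leaves a function on an annulus. The error near \<open>0\<close> is
  controlled by the assumption \<open>small\<close> and by integrability of \<open>F\<close>, the error near infinity by tightness.\<close>

lemma tendsto_integral_of_small_jumps:
  fixes F :: "real ^ 'd \<Rightarrow> real"
  assumes cont: "continuous_on UNIV F" and bd: "\<And>x. \<bar>F x\<bar> \<le> B" and intF: "integrable \<nu> F"
    and small: "\<And>\<delta>. 0 < \<delta> \<Longrightarrow> \<exists>\<epsilon>>0. \<exists>t0>0. \<forall>t. 0 < t \<longrightarrow> t < t0 \<longrightarrow>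
        (\<integral>x. near \<epsilon> F x \<partial>P t) \<le> \<delta> * t"
    and s: "\<And>n. 0 < s n" "s \<longlonglongrightarrow> 0"
  shows "(\<lambda>n. (\<integral>x. F x \<partial>P (s n)) / s n) \<longlonglongrightarrow> (\<integral>x. F x \<partial>\<nu>)"
proof (rule LIMSEQ_I)
  fix r :: real assume r: "0 < r"
  have B0: "0 \<le> B" using bd[of 0] by linarith
  note F[measurable] = borel_measurable_continuous_onI[OF cont]
  define \<delta> where "\<delta> = r / 4 / (1 + B)"
  have \<delta>: "0 < \<delta>" using r B0 by (simp add: \<delta>_def)
  have \<delta>r: "(\<delta> + B * \<delta>) + (\<delta> + B * \<delta>) = r / 2"
  proof -
    have "1 + B \<noteq> 0" using B0 by linarith
    then have "\<delta> * (1 + B) = r / 4"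
      by (rule nonzero_eq_divide_eq[THEN iffD1]) (rule \<delta>_def)
    then show ?thesis by (simp add: algebra_simps)
  qed
  obtain \<epsilon>1 t0 where \<epsilon>1: "0 < \<epsilon>1" and t0: "0 < t0"
    and sm: "\<And>t. 0 < t \<Longrightarrow> t < t0 \<Longrightarrow> (\<integral>x. near \<epsilon>1 F x \<partial>P t) \<le> \<delta> * t"
    using small[OF \<delta>] by blast
  obtain \<epsilon>2 where \<epsilon>2: "0 < \<epsilon>2" "\<And>\<epsilon>. 0 < \<epsilon> \<Longrightarrow> \<epsilon> \<le> \<epsilon>2 \<Longrightarrow> (\<integral>x. near \<epsilon> F x \<partial>\<nu>) \<le> \<delta>"
    using integral_nu_small[OF intF \<delta>] by blast
  obtain R1 where R1: "0 < R1" "\<And>t. 0 \<le> t \<Longrightarrow> measure (P t) {x. R1 \<le> norm x} \<le> \<delta> * t"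
    using uniformly_small_tail[OF \<delta>] by blast
  obtain R2 where R2: "0 < R2" "(\<integral>x. indicator {x. R2 \<le> norm x} x \<partial>\<nu>) \<le> \<delta>"
    using integral_nu_tail[OF \<delta>] by blast
  define \<epsilon> where "\<epsilon> = min \<epsilon>1 \<epsilon>2"
  define R where "R = max R1 R2"
  have \<epsilon>: "0 < \<epsilon>" "\<epsilon> \<le> \<epsilon>1" "\<epsilon> \<le> \<epsilon>2" using \<epsilon>1 \<epsilon>2 by (auto simp: \<epsilon>_def)
  have R: "0 < R" "R1 \<le> R" "R2 \<le> R" using R1 by (auto simp: R_def)
  define \<kappa> where "\<kappa> x = max 0 (min 1 (2 * norm x / \<epsilon> - 1)) * max 0 (min 1 (R + 1 - norm x))" for x :: "real ^ 'd"
  have \<kappa>01: "0 \<le> \<kappa> x" "\<kappa> x \<le> 1" for x unfolding \<kappa>_def by (auto intro!: mult_le_one)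
  have \<kappa>1: "\<kappa> x = 1" if "\<epsilon> \<le> norm x" "norm x \<le> R" for x
  proof -
    have "1 \<le> 2 * norm x / \<epsilon> - 1" using that \<epsilon> by (simp add: field_simps)
    then show ?thesis using that by (simp add: \<kappa>_def)
  qed
  have \<kappa>0: "\<kappa> x = 0" if "norm x \<le> \<epsilon> / 2 \<or> R + 1 \<le> norm x" for x
    using that \<epsilon> by (auto simp: \<kappa>_def field_simps max_def min_def)
  have \<kappa>_cont: "continuous_on UNIV \<kappa>"
    unfolding \<kappa>_def using \<epsilon> by (intro continuous_intros) auto
  then have [measurable]: "\<kappa> \<in> borel_measurable borel" by (rule borel_measurable_continuous_onI)
  let ?F0 = "\<lambda>x. F x * \<kappa> x"
  let ?E = "\<lambda>x. near \<epsilon> F x + B * indicator {x. R \<le> norm x} x"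
  have close: "\<bar>F x - ?F0 x\<bar> \<le> ?E x" for x
  proof -
    have "F x - ?F0 x = F x * (1 - \<kappa> x)" by (simp add: right_diff_distrib)
    then have "\<bar>F x - ?F0 x\<bar> = \<bar>F x\<bar> * (1 - \<kappa> x)" using \<kappa>01[of x] by (simp add: abs_mult)
    also have "\<dots> \<le> ?E x"
    proof (cases "\<epsilon> \<le> norm x \<and> norm x \<le> R")
      case True then show ?thesis using \<kappa>1 B0 by (auto simp: indicator_def)
    next
      case False
      have "\<bar>F x\<bar> * (1 - \<kappa> x) \<le> \<bar>F x\<bar>" using \<kappa>01[of x] by (intro mult_left_le) auto
      then show ?thesis using False bd[of x] B0 by (auto simp: indicator_def)
    qed
    finally show ?thesis .
  qed
  have F0: "\<bar>?F0 x\<bar> \<le> B" for x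
  proof -
    have "\<bar>F x\<bar> * \<bar>\<kappa> x\<bar> \<le> \<bar>F x\<bar> * 1" using \<kappa>01[of x] by (intro mult_left_mono) auto
    then show ?thesis using bd[of x] by (simp add: abs_mult)
  qed
  have intF0: "integrable \<nu> ?F0"
    using \<epsilon> F0 \<kappa>0 by (intro integrable_away_from_0[where \<delta> = "\<epsilon> / 2" and B = B]) auto
  have diff_nu: "\<bar>(\<integral>x. F x \<partial>\<nu>) - (\<integral>x. ?F0 x \<partial>\<nu>)\<bar> \<le> \<delta> + B * \<delta>"
  proof -
    have i1: "integrable \<nu> (\<lambda>x. near \<epsilon> F x)"
      by (rule Bochner_Integration.integrable_bound[OF intF]) (auto simp: indicator_def)
    have i2: "integrable \<nu> (indicator {x. R' \<le> norm x} :: _ \<Rightarrow> real)" if "0 < R'" for R'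
      using that by (rule integrable_tail)
    have "\<bar>(\<integral>x. F x \<partial>\<nu>) - (\<integral>x. ?F0 x \<partial>\<nu>)\<bar> = \<bar>\<integral>x. F x - ?F0 x \<partial>\<nu>\<bar>"
      using intF intF0 by simp
    also have "\<dots> \<le> (\<integral>x. \<bar>F x - ?F0 x\<bar> \<partial>\<nu>)" by (rule integral_abs_bound)
    also have "\<dots> \<le> (\<integral>x. ?E x \<partial>\<nu>)"
      using i1 i2 R intF intF0 close by (intro integral_mono) auto
    also have "\<dots> = (\<integral>x. near \<epsilon> F x \<partial>\<nu>) + B * (\<integral>x. indicator {x. R \<le> norm x} x \<partial>\<nu>)"
      using i1 i2 R by simp
    also have "\<dots> \<le> \<delta> + B * \<delta>"
    proof (intro add_mono mult_left_mono B0)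
      show "(\<integral>x. near \<epsilon> F x \<partial>\<nu>) \<le> \<delta>" using \<epsilon> by (intro \<epsilon>2)
      have "(\<integral>x. indicator {x. R \<le> norm x} x \<partial>\<nu>) \<le> (\<integral>x. (indicator {x. R2 \<le> norm x} x :: real) \<partial>\<nu>)"
        using R R2 by (intro integral_mono i2) (auto simp: indicator_def)
      then show "(\<integral>x. indicator {x. R \<le> norm x} x \<partial>\<nu>) \<le> \<delta>" using R2(2) by linarith
    qed
    finally show ?thesis .
  qed
  have diff_P: "\<bar>(\<integral>x. F x \<partial>P t) / t - (\<integral>x. ?F0 x \<partial>P t) / t\<bar> \<le> \<delta> + B * \<delta>" if t: "0 < t" "t < t0" for t
  proof -
    have t': "0 \<le> t" using t by simp
    interpret prob_space "P t" by (rule prob) fact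
    note [measurable_cong] = sets_P[OF t']
    note intP = integrable_P_bounded[OF t', where B = B]
    have i0: "integrable (P t) F" "integrable (P t) ?F0" using bd F0 by (auto intro!: intP)
    have i1: "integrable (P t) (\<lambda>x. near e F x)" for e
      using bd B0 by (intro intP) (auto simp: indicator_def)
    have i2: "integrable (P t) (indicator {x. R' \<le> norm x} :: _ \<Rightarrow> real)" for R'
      by (rule integrable_P_bounded[OF t', where B = 1]) (auto simp: indicator_def)
    have "\<bar>(\<integral>x. F x \<partial>P t) - (\<integral>x. ?F0 x \<partial>P t)\<bar> = \<bar>\<integral>x. F x - ?F0 x \<partial>P t\<bar>" using i0 by simp
    also have "\<dots> \<le> (\<integral>x. \<bar>F x - ?F0 x\<bar> \<partial>P t)" by (rule integral_abs_bound)
    also have "\<dots> \<le> (\<integral>x. ?E x \<partial>P t)"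
      using i0 i1 i2 close by (intro integral_mono) auto
    also have "\<dots> = (\<integral>x. near \<epsilon> F x \<partial>P t) + B * (\<integral>x. indicator {x. R \<le> norm x} x \<partial>P t)"
      using i1 i2 by simp
    also have "\<dots> \<le> \<delta> * t + B * (\<delta> * t)"
    proof (intro add_mono mult_left_mono B0)
      have "(\<integral>x. near \<epsilon> F x \<partial>P t) \<le> (\<integral>x. near \<epsilon>1 F x \<partial>P t)"
        using \<epsilon> by (intro integral_mono i1) (auto simp: indicator_def)
      then show "(\<integral>x. near \<epsilon> F x \<partial>P t) \<le> \<delta> * t" using sm[OF t] by linarith
      have "(\<integral>x. indicator {x. R \<le> norm x} x \<partial>P t) \<le> (\<integral>x. (indicator {x. R1 \<le> norm x} x :: real) \<partial>P t)"
        using R by (intro integral_mono i2) (auto simp: indicator_def)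
      also have "\<dots> = measure (P t) {x. R1 \<le> norm x}" using space_P[OF t'] by simp
      finally show "(\<integral>x. indicator {x. R \<le> norm x} x \<partial>P t) \<le> \<delta> * t" using R1(2)[OF t'] by linarith
    qed
    also have "\<dots> = (\<delta> + B * \<delta>) * t" by (simp add: algebra_simps)
    finally have "\<bar>(\<integral>x. F x \<partial>P t) - (\<integral>x. ?F0 x \<partial>P t)\<bar> / t \<le> \<delta> + B * \<delta>"
      using t(1) by (simp add: pos_divide_le_eq)
    then show ?thesis using t(1) by (simp add: abs_divide flip: diff_divide_distrib)
  qed
  have "(\<lambda>n. (\<integral>x. ?F0 x \<partial>P (s n)) / s n) \<longlonglongrightarrow> (\<integral>x. ?F0 x \<partial>\<nu>)"
    by (rule tendsto_integral_annulus[where \<epsilon> = "\<epsilon> / 2" and R = "R + 1"])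
       (use \<epsilon> R \<kappa>0 s in \<open>auto intro!: continuous_intros cont \<kappa>_cont\<close>)
  from tendstoD[OF this, of "r / 2"]
  have "\<forall>\<^sub>F n in sequentially. \<bar>(\<integral>x. ?F0 x \<partial>P (s n)) / s n - (\<integral>x. ?F0 x \<partial>\<nu>)\<bar> < r / 2"
    using r unfolding dist_real_def by simp
  moreover have "\<forall>\<^sub>F n in sequentially. s n < t0" using s(2) t0 by (rule order_tendstoD)
  ultimately have "\<forall>\<^sub>F n in sequentially. norm ((\<integral>x. F x \<partial>P (s n)) / s n - (\<integral>x. F x \<partial>\<nu>)) < r"
  proof eventually_elim
    case (elim n)
    have "\<bar>(\<integral>x. F x \<partial>P (s n)) / s n - (\<integral>x. F x \<partial>\<nu>)\<bar>
        \<le> \<bar>(\<integral>x. F x \<partial>P (s n)) / s n - (\<integral>x. ?F0 x \<partial>P (s n)) / s n\<bar>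
          + \<bar>(\<integral>x. ?F0 x \<partial>P (s n)) / s n - (\<integral>x. ?F0 x \<partial>\<nu>)\<bar>
          + \<bar>(\<integral>x. F x \<partial>\<nu>) - (\<integral>x. ?F0 x \<partial>\<nu>)\<bar>"
      by (simp add: abs_if)
    also have "\<dots> < (\<delta> + B * \<delta>) + r / 2 + (\<delta> + B * \<delta>)"
      using elim(1) diff_P[OF s(1) elim(2)] diff_nu by (intro add_less_le_mono add_le_less_mono)
    also have "\<dots> = r" using \<delta>r by simp
    finally show ?case by (simp only: real_norm_def)
  qed
  then show "\<exists>no. \<forall>n\<ge>no. norm ((\<integral>x. F x \<partial>P (s n)) / s n - (\<integral>x. F x \<partial>\<nu>)) < r"
    by (simp add: eventually_sequentially)
qed

end

section \<open>Growth of the imaginary part of the exponent\<close>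

text \<open>The powers balance at the threshold \<open>T\<close>; below it the constant \<open>a * T\<close> is enough.\<close>

lemma linear_le_powr:
  fixes \<beta> \<eta> a :: real
  assumes "1 < \<beta>" "0 < \<eta>" "0 \<le> a"
  shows "\<exists>K\<ge>0. \<forall>u\<ge>0. a * u \<le> \<eta> * u powr \<beta> + K"
proof -
  define T where "T = (a / \<eta>) powr (1 / (\<beta> - 1))"
  have "a * u \<le> \<eta> * u powr \<beta> + a * T" if u: "0 \<le> u" for u
  proof (cases "u \<le> T")
    case True
    then have "a * u \<le> a * T" using assms by (intro mult_left_mono) auto
    then show ?thesis using assms by (simp add: add_increasing)
  next
    case False
    have T0: "0 \<le> T" by (simp add: T_def)
    have "a / \<eta> = T powr (\<beta> - 1)" using assms by (simp add: T_def powr_powr)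
    also have "\<dots> \<le> u powr (\<beta> - 1)" using False T0 assms by (intro powr_mono2) auto
    finally have "a \<le> \<eta> * u powr (\<beta> - 1)" using assms by (simp add: field_simps)
    then have "a * u \<le> \<eta> * u powr (\<beta> - 1) * u" using u by (rule mult_right_mono)
    also have "\<dots> = \<eta> * u powr \<beta>" using False T0 by (simp add: powr_diff)
    finally show ?thesis using assms T0 by (simp add: add_increasing2)
  qed
  then show ?thesis using assms by (intro exI[of _ "a * T"]) (auto simp: T_def)
qed

context levy_jump_exponent
begin

lemma integrable_of_powr_bound:
  fixes F :: "real ^ 'd \<Rightarrow> real"
  assumes int: "finite_small_moment \<beta>"
    and [measurable]: "F \<in> borel_measurable borel" and B: "\<And>x. \<bar>F x\<bar> \<le> B"
    and C: "\<And>x. norm x < 1 \<Longrightarrow> \<bar>F x\<bar> \<le> C * norm x powr \<beta>"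
  shows "integrable \<nu> F"
proof (rule Bochner_Integration.integrable_bound)
  show "integrable \<nu> (\<lambda>x. C * (indicator {y. norm y < 1} x * norm x powr \<beta>) + B * indicator {y. 1 \<le> norm y} x)"
    by (intro Bochner_Integration.integrable_add integrable_mult_right int integrable_tail) auto
  show "AE x in \<nu>. norm (F x) \<le> norm (C * (indicator {y. norm y < 1} x * norm x powr \<beta>) + B * indicator {y. 1 \<le> norm y} x)"
    using B C order_trans[OF _ abs_ge_self] by (intro AE_I2) (auto simp: indicator_def)
qed simp

text \<open>Zero drift means that \<open>\<gamma>\<close> is exactly the compensator, so both disappear together.\<close>

lemma Im_psi_eq_sine_integral:
  assumes \<beta>: "\<beta> \<le> 1" and int: "finite_small_moment \<beta>"
    and drift: "(LINT y:{y. norm y \<le> 1}|\<nu>. y) - \<gamma> = 0"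
  shows "Im (psi \<xi>) = - (\<integral>y. sin (\<xi> \<bullet> y) \<partial>\<nu>)" "integrable \<nu> (\<lambda>y. sin (\<xi> \<bullet> y))"
proof -
  have inty: "integrable \<nu> (\<lambda>y. indicat_real {y. norm y \<le> 1} y *\<^sub>R y)"
  proof (rule Bochner_Integration.integrable_bound)
    show "integrable \<nu> (\<lambda>x. indicator {y. norm y < 1} x * norm x powr \<beta> + indicat_real {y. 1 \<le> norm y} x)"
      by (intro Bochner_Integration.integrable_add int integrable_tail) auto
    show "AE y in \<nu>. norm (indicat_real {y. norm y \<le> 1} y *\<^sub>R y)
        \<le> norm (indicator {y. norm y < 1} y * norm y powr \<beta> + indicat_real {y. 1 \<le> norm y} y)"
    proof (intro AE_I2)
      fix y :: "real ^ 'd"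
      show "norm (indicat_real {y. norm y \<le> 1} y *\<^sub>R y)
        \<le> norm (indicator {y. norm y < 1} y * norm y powr \<beta> + indicat_real {y. 1 \<le> norm y} y)"
      proof (cases "norm y < 1")
        case True
        have "norm y powr 1 \<le> norm y powr \<beta>" using True \<beta> by (intro powr_mono') auto
        then show ?thesis using True by simp
      qed (auto simp: indicator_def)
    qed
  qed measurable
  have eq: "\<xi> \<bullet> (indicat_real {y. norm y \<le> 1} y *\<^sub>R y) = (\<xi> \<bullet> y) * indicator {y. norm y \<le> 1} y" for y
    by simp
  have int1: "integrable \<nu> (\<lambda>y. (\<xi> \<bullet> y) * indicator {y. norm y \<le> 1} y)"
    using integrable_inner_right[OF inty, of \<xi>] unfolding eq by simp
  have "\<xi> \<bullet> \<gamma> = \<xi> \<bullet> (\<integral>y. indicat_real {y. norm y \<le> 1} y *\<^sub>R y \<partial>\<nu>)"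
    using drift by (simp add: set_lebesgue_integral_def)
  also have "\<dots> = (\<integral>y. (\<xi> \<bullet> y) * indicator {y. norm y \<le> 1} y \<partial>\<nu>)"
    using integral_inner_right[of \<xi>, OF inty] unfolding eq by simp
  finally have g: "\<xi> \<bullet> \<gamma> = (\<integral>y. (\<xi> \<bullet> y) * indicator {y. norm y \<le> 1} y \<partial>\<nu>)" .
  have "integrable \<nu> (\<lambda>y. (sin (\<xi> \<bullet> y) - (\<xi> \<bullet> y) * indicator {y. norm y \<le> 1} y) + (\<xi> \<bullet> y) * indicator {y. norm y \<le> 1} y)"
    by (intro Bochner_Integration.integrable_add integrable_sin_compensated int1)
  then show i: "integrable \<nu> (\<lambda>y. sin (\<xi> \<bullet> y))" by simp
  show "Im (psi \<xi>) = - (\<integral>y. sin (\<xi> \<bullet> y) \<partial>\<nu>)"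
    unfolding Im_psi g using i int1 by simp
qed

text \<open>Jumps below \<open>\<epsilon>\<close> contribute at most their small \<open>\<beta>\<close>-th moment times \<open>norm \<xi> powr \<beta>\<close>; the larger
  ones form a finite measure and contribute a constant.\<close>

lemma Im_psi_small_without_drift:
  assumes \<beta>: "0 \<le> \<beta>" "\<beta> \<le> 1" and int: "finite_small_moment \<beta>"
    and drift: "(LINT y:{y. norm y \<le> 1}|\<nu>. y) - \<gamma> = 0" and \<eta>: "0 < \<eta>"
  shows "\<exists>K\<ge>0. \<forall>\<xi>. \<bar>Im (psi \<xi>)\<bar> \<le> \<eta> * norm \<xi> powr \<beta> + K"
proof -
  let ?p = "\<lambda>y :: real ^ 'd. indicator {y. norm y < 1} y * norm y powr \<beta>"
  obtain \<epsilon> where \<epsilon>: "0 < \<epsilon>" "(\<integral>y. indicator {y. norm y < \<epsilon>} y * \<bar>?p y\<bar> \<partial>\<nu>) \<le> \<eta>" "\<epsilon> \<le> 1"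
  proof -
    obtain e where e: "0 < e" "\<And>d. 0 < d \<Longrightarrow> d \<le> e \<Longrightarrow> (\<integral>y. indicator {y. norm y < d} y * \<bar>?p y\<bar> \<partial>\<nu>) \<le> \<eta>"
      using integral_nu_small[OF int \<eta>] by blast
    show ?thesis using that[of "min e 1"] e(1) e(2)[of "min e 1"] by simp
  qed
  define K where "K = (\<integral>y. indicat_real {y. \<epsilon> \<le> norm y} y \<partial>\<nu>)"
  have int2: "integrable \<nu> (\<lambda>y. indicator {y. norm y < \<epsilon>} y * \<bar>?p y\<bar>)"
    by (rule Bochner_Integration.integrable_bound[OF int]) (auto simp: indicator_def)
  have "\<bar>Im (psi \<xi>)\<bar> \<le> \<eta> * norm \<xi> powr \<beta> + K" for \<xi>
  proof -
    note Im = Im_psi_eq_sine_integral[OF \<beta>(2) int drift, of \<xi>]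
    have "\<bar>Im (psi \<xi>)\<bar> \<le> (\<integral>y. \<bar>sin (\<xi> \<bullet> y)\<bar> \<partial>\<nu>)"
      unfolding Im(1) abs_minus_cancel by (rule integral_abs_bound)
    also have "\<dots> \<le> (\<integral>y. norm \<xi> powr \<beta> * (indicator {y. norm y < \<epsilon>} y * \<bar>?p y\<bar>) + indicat_real {y. \<epsilon> \<le> norm y} y \<partial>\<nu>)"
    proof (intro integral_mono integrable_abs Im(2) Bochner_Integration.integrable_add integrable_mult_right int2 integrable_tail \<epsilon>)
      fix y :: "real ^ 'd"
      have "\<bar>sin (\<xi> \<bullet> y)\<bar> \<le> \<bar>\<xi> \<bullet> y\<bar> powr \<beta>" using \<beta> by (rule abs_sin_le_powr)
      also have "\<dots> \<le> (norm \<xi> * norm y) powr \<beta>"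
        using \<beta> Cauchy_Schwarz_ineq2[of \<xi> y] by (intro powr_mono2) auto
      finally show "\<bar>sin (\<xi> \<bullet> y)\<bar> \<le> norm \<xi> powr \<beta> * (indicator {y. norm y < \<epsilon>} y * \<bar>?p y\<bar>) + indicat_real {y. \<epsilon> \<le> norm y} y"
        using \<epsilon>(3) abs_sin_le_one[of "\<xi> \<bullet> y"] by (auto simp: indicator_def powr_mult)
    qed
    also have "\<dots> = norm \<xi> powr \<beta> * (\<integral>y. indicator {y. norm y < \<epsilon>} y * \<bar>?p y\<bar> \<partial>\<nu>) + K"
      unfolding K_def using int2 integrable_tail[OF \<epsilon>(1)] by simp
    also have "\<dots> \<le> norm \<xi> powr \<beta> * \<eta> + K"
      using \<epsilon>(2) by (intro add_right_mono mult_left_mono) auto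
    finally show ?thesis by (simp add: mult.commute)
  qed
  moreover have "0 \<le> K" unfolding K_def by (intro integral_nonneg_AE AE_I2) auto
  ultimately show ?thesis by blast
qed

text \<open>The case \<open>\<beta> = 0\<close>, in which \<open>\<nu>\<close> is finite and the process is compound Poisson. The convention
  \<open>0 powr 0 = 0\<close> is harmless, because sine and \<open>1 - cos\<close> vanish at the origin.\<close>

lemma psi_bounded_of_finite:
  assumes int: "finite_small_moment 0"
    and drift: "(LINT y:{y. norm y \<le> 1}|\<nu>. y) - \<gamma> = 0"
  shows "\<exists>K\<ge>0. \<forall>\<xi>. norm (psi \<xi>) \<le> K"
proof -
  let ?u = "\<lambda>y :: real ^ 'd. indicator {y. norm y < 1} y * norm y powr 0 + indicat_real {y. 1 \<le> norm y} y"
  define U where "U = (\<integral>y. ?u y \<partial>\<nu>)"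
  have intu: "integrable \<nu> ?u"
    by (intro Bochner_Integration.integrable_add int integrable_tail) auto
  have "norm (psi \<xi>) \<le> 3 * U" for \<xi>
  proof -
    note Im = Im_psi_eq_sine_integral[OF _ int drift, of \<xi>]
    have "\<bar>Im (psi \<xi>)\<bar> \<le> (\<integral>y. \<bar>sin (\<xi> \<bullet> y)\<bar> \<partial>\<nu>)"
      using Im(1) integral_abs_bound[of \<nu> "\<lambda>y. sin (\<xi> \<bullet> y)"] by simp
    also have "\<dots> \<le> U"
      unfolding U_def using Im(2) by (intro integral_mono integrable_abs intu) (auto simp: indicator_def)
    finally have 1: "\<bar>Im (psi \<xi>)\<bar> \<le> U" .
    have "Re (psi \<xi>) \<le> (\<integral>y. 2 * ?u y \<partial>\<nu>)"
      unfolding Re_psi using one_minus_cos_le_2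
      by (intro integral_mono integrable_one_minus_cos integrable_mult_right intu) (auto simp: indicator_def)
    also have "\<dots> = 2 * U" unfolding U_def by (rule integral_mult_right_zero)
    finally have "Re (psi \<xi>) \<le> 2 * U" .
    then show ?thesis using 1 cmod_le[of "psi \<xi>"] Re_psi_nonneg[of \<xi>] by linarith
  qed
  moreover have "0 \<le> U" unfolding U_def by (intro integral_nonneg_AE AE_I2) auto
  ultimately show ?thesis by (intro exI[of _ "3 * U"]) auto
qed

text \<open>As without drift, but the drift and the compensator of the jumps between \<open>\<epsilon>\<close> and \<open>1\<close> leave a linear
  term. It is of lower order for \<open>\<beta> > 1\<close> and of the same order for \<open>\<beta> = 1\<close>.\<close>

lemma Im_psi_bound:
  assumes \<beta>: "1 \<le> \<beta>" "\<beta> \<le> 2" and int: "finite_small_moment \<beta>"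
    and \<eta>: "0 < \<eta>"
  shows "\<exists>a\<ge>0. \<exists>K\<ge>0. \<forall>\<xi>. \<bar>Im (psi \<xi>)\<bar> \<le> \<eta> * norm \<xi> powr \<beta> + a * norm \<xi> + K"
proof -
  let ?p = "\<lambda>y :: real ^ 'd. indicator {y. norm y < 1} y * norm y powr \<beta>"
  obtain \<epsilon> where \<epsilon>: "0 < \<epsilon>" "(\<integral>y. indicator {y. norm y < \<epsilon>} y * \<bar>?p y\<bar> \<partial>\<nu>) \<le> \<eta> / 2" "\<epsilon> \<le> 1"
  proof -
    obtain e where e: "0 < e" "\<And>d. 0 < d \<Longrightarrow> d \<le> e \<Longrightarrow> (\<integral>y. indicator {y. norm y < d} y * \<bar>?p y\<bar> \<partial>\<nu>) \<le> \<eta> / 2"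
      using integral_nu_small[OF int, of "\<eta> / 2"] \<eta> by auto
    show ?thesis using that[of "min e 1"] e(1) e(2)[of "min e 1"] by simp
  qed
  define K where "K = (\<integral>y. indicat_real {y. \<epsilon> \<le> norm y} y \<partial>\<nu>)"
  have K: "0 \<le> K" unfolding K_def by (intro integral_nonneg_AE AE_I2) auto
  have int2: "integrable \<nu> (\<lambda>y. indicator {y. norm y < \<epsilon>} y * \<bar>?p y\<bar>)"
    by (rule Bochner_Integration.integrable_bound[OF int]) (auto simp: indicator_def)
  have "\<bar>Im (psi \<xi>)\<bar> \<le> \<eta> * norm \<xi> powr \<beta> + (norm \<gamma> + 2 * K) * norm \<xi> + K" for \<xi>
  proof -
    let ?g = "\<lambda>y. sin (\<xi> \<bullet> y) - (\<xi> \<bullet> y) * indicator {y. norm y \<le> 1} y"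
    let ?h = "\<lambda>y. 2 * norm \<xi> powr \<beta> * (indicator {y. norm y < \<epsilon>} y * \<bar>?p y\<bar>) + (1 + 2 * norm \<xi>) * indicat_real {y. \<epsilon> \<le> norm y} y"
    have "\<bar>\<integral>y. ?g y \<partial>\<nu>\<bar> \<le> (\<integral>y. \<bar>?g y\<bar> \<partial>\<nu>)" by (rule integral_abs_bound)
    also have "\<dots> \<le> (\<integral>y. ?h y \<partial>\<nu>)"
    proof (intro integral_mono integrable_abs integrable_sin_compensated Bochner_Integration.integrable_add
        integrable_mult_right int2 integrable_tail \<epsilon>)
      fix y :: "real ^ 'd"
      have cs: "\<bar>\<xi> \<bullet> y\<bar> \<le> norm \<xi> * norm y" by (rule Cauchy_Schwarz_ineq2)
      consider "norm y < \<epsilon>" | "\<epsilon> \<le> norm y" "norm y \<le> 1" | "1 < norm y" by linarith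
      then show "\<bar>?g y\<bar> \<le> ?h y"
      proof cases
        case 1
        have "\<bar>sin (\<xi> \<bullet> y) - \<xi> \<bullet> y\<bar> \<le> 2 * \<bar>\<xi> \<bullet> y\<bar> powr \<beta>" using \<beta> by (rule abs_sin_minus_self_le_powr)
        also have "\<dots> \<le> 2 * (norm \<xi> * norm y) powr \<beta>"
          using \<beta> cs by (intro mult_left_mono powr_mono2) auto
        finally show ?thesis using 1 \<epsilon>(3) by (simp add: powr_mult)
      next
        case 2
        have "norm \<xi> * norm y \<le> norm \<xi>" using 2 by (intro mult_left_le) auto
        then have "\<bar>sin (\<xi> \<bullet> y) - \<xi> \<bullet> y\<bar> \<le> 1 + 2 * norm \<xi>"
          using cs abs_sin_le_one[of "\<xi> \<bullet> y"] norm_ge_zero[of \<xi>] by linarith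
        then show ?thesis using 2 by simp
      next
        case 3
        have "\<bar>sin (\<xi> \<bullet> y)\<bar> \<le> 1 + 2 * norm \<xi>"
          using abs_sin_le_one[of "\<xi> \<bullet> y"] norm_ge_zero[of \<xi>] by linarith
        then show ?thesis using 3 \<epsilon>(3) by simp
      qed
    qed
    also have "\<dots> = 2 * norm \<xi> powr \<beta> * (\<integral>y. indicator {y. norm y < \<epsilon>} y * \<bar>?p y\<bar> \<partial>\<nu>) + (1 + 2 * norm \<xi>) * K"
      unfolding K_def using int2 integrable_tail[OF \<epsilon>(1)]
      by (subst Bochner_Integration.integral_add) (auto intro!: integrable_mult_right)
    also have "\<dots> \<le> 2 * norm \<xi> powr \<beta> * (\<eta> / 2) + (1 + 2 * norm \<xi>) * K"
      using \<epsilon>(2) by (intro add_right_mono mult_left_mono) auto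
    finally have g: "\<bar>\<integral>y. ?g y \<partial>\<nu>\<bar> \<le> \<eta> * norm \<xi> powr \<beta> + (1 + 2 * norm \<xi>) * K"
      by (simp add: mult.commute)
    have "\<bar>Im (psi \<xi>)\<bar> \<le> \<bar>\<xi> \<bullet> \<gamma>\<bar> + \<bar>\<integral>y. ?g y \<partial>\<nu>\<bar>" unfolding Im_psi by linarith
    also have "\<dots> \<le> norm \<xi> * norm \<gamma> + (\<eta> * norm \<xi> powr \<beta> + (1 + 2 * norm \<xi>) * K)"
      by (intro add_mono Cauchy_Schwarz_ineq2 g)
    finally show ?thesis by (simp add: distrib_left distrib_right mult_ac)
  qed
  then show ?thesis using K by (intro exI[of _ "norm \<gamma> + 2 * K"] conjI exI[of _ K]) auto
qed

lemma distr_uminus_symmetric: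
  assumes "symmetric_measure \<nu>"
  shows "distr \<nu> borel uminus = \<nu>"
proof (rule measure_eqI)
  fix A assume "A \<in> sets (distr \<nu> borel uminus)"
  then have A: "A \<in> sets borel" by simp
  have "uminus -` A = uminus ` A" by (auto simp: image_iff) (metis minus_minus)
  then have "emeasure (distr \<nu> borel uminus) A = emeasure \<nu> (uminus ` A)"
    using A by (simp add: emeasure_distr)
  also have "\<dots> = emeasure \<nu> A" using assms A by (simp add: symmetric_measure_def)
  finally show "emeasure (distr \<nu> borel uminus) A = emeasure \<nu> A" .
qed simp

text \<open>The integrand is odd.\<close>

lemma Im_psi_symmetric:
  assumes "symmetric_measure \<nu>" "\<gamma> = 0"
  shows "Im (psi \<xi>) = 0"
proof -
  let ?g = "\<lambda>y. sin (\<xi> \<bullet> y) - (\<xi> \<bullet> y) * indicator {y. norm y \<le> 1} y"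
  have "(\<integral>y. ?g y \<partial>\<nu>) = (\<integral>y. ?g y \<partial>distr \<nu> borel uminus)"
    using distr_uminus_symmetric[OF assms(1)] by simp
  also have "\<dots> = (\<integral>y. ?g (- y) \<partial>\<nu>)" by (rule integral_distr) auto
  also have "\<dots> = (\<integral>y. - ?g y \<partial>\<nu>)" by (intro Bochner_Integration.integral_cong refl) (auto simp: indicator_def)
  also have "\<dots> = - (\<integral>y. ?g y \<partial>\<nu>)" by (rule Bochner_Integration.integral_minus)
  finally show ?thesis unfolding Im_psi using assms(2) by simp
qed

end

section \<open>Small-time limits under the three regularity assumptions\<close>

context levy_laws
begin

lemma integral_small_le:
  fixes F :: "real ^ 'd \<Rightarrow> real"
  assumes t: "0 \<le> t" and [measurable]: "F \<in> borel_measurable borel" and c: "0 \<le> c" and A: "0 \<le> A"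
    and F: "\<And>x. norm x < \<epsilon> \<Longrightarrow> \<bar>F x\<bar> \<le> c * norm x powr \<beta>" and \<epsilon>: "\<epsilon> \<le> \<epsilon>'"
    and mom: "small_moment \<beta> \<epsilon>' t \<le> ennreal A"
  shows "(\<integral>x. near \<epsilon> F x \<partial>P t) \<le> c * A"
proof (rule integral_real_bounded)
  note [measurable_cong] = sets_P[OF t]
  have "(\<integral>\<^sup>+x. ennreal (near \<epsilon> F x) \<partial>P t)
      \<le> (\<integral>\<^sup>+x. ennreal c * ennreal (indicator {x. norm x < \<epsilon>'} x * norm x powr \<beta>) \<partial>P t)"
    using F c \<epsilon> by (intro nn_integral_mono) (auto simp: indicator_def ennreal_leI simp flip: ennreal_mult)
  also have "\<dots> = ennreal c * small_moment \<beta> \<epsilon>' t"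
    by (rule nn_integral_cmult) measurable
  also have "\<dots> \<le> ennreal c * ennreal A" using mom by (rule mult_left_mono) simp
  also have "\<dots> = ennreal (c * A)" using c A by (simp add: ennreal_mult)
  finally show "(\<integral>\<^sup>+x. ennreal (near \<epsilon> F x) \<partial>P t) \<le> ennreal (c * A)" .
qed (use c A in simp)

lemma tendsto_integral_of_powr_bound:
  fixes F :: "real ^ 'd \<Rightarrow> real"
  assumes \<beta>: "0 < \<beta>" "\<beta> < 2" and int: "finite_small_moment \<beta>"
    and Im: "\<And>\<eta>. 0 < \<eta> \<Longrightarrow> \<exists>K\<ge>0. \<forall>\<xi>. \<bar>Im (psi \<xi>)\<bar> \<le> \<eta> * norm \<xi> powr \<beta> + K"
    and cont: "continuous_on UNIV F" and bd: "\<And>x. \<bar>F x\<bar> \<le> B"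
    and C: "0 < C" "\<And>x. norm x < 1 \<Longrightarrow> \<bar>F x\<bar> \<le> C * norm x powr \<beta>"
    and s: "\<And>n. 0 < s n" "s \<longlonglongrightarrow> 0"
  shows "(\<lambda>n. (\<integral>x. F x \<partial>P (s n)) / s n) \<longlonglongrightarrow> (\<integral>x. F x \<partial>\<nu>)"
proof (rule tendsto_integral_of_small_jumps[OF cont bd _ _ s])
  note [measurable] = borel_measurable_continuous_onI[OF cont]
  show "integrable \<nu> F" by (rule integrable_of_powr_bound[OF int _ bd C(2)]) simp
  fix \<delta> :: real assume \<delta>: "0 < \<delta>"
  \<comment> \<open>the three error terms of the moment estimate receive \<open>d\<close> each\<close>
  define d where "d = \<delta> / (3 * C)"
  have d: "0 < d" "C * (3 * d) = \<delta>" using \<delta> C by (auto simp: d_def)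
  obtain C0 where C0: "0 < C0" and moment: "\<forall>\<eta>\<ge>0. \<forall>K\<ge>0. (\<forall>\<xi>. \<bar>Im (psi \<xi>)\<bar> \<le> \<eta> * norm \<xi> powr \<beta> + K) \<longrightarrow>
    (\<forall>\<delta>>0. \<exists>\<epsilon>>0. \<exists>L. \<forall>t>0.
      small_moment \<beta> \<epsilon> t \<le> ennreal (t * (\<delta> + C0 * \<eta> + L * t)))"
    using small_jump_moment[OF \<beta> int] by (elim exE conjE)
  obtain K where K: "0 \<le> K" "\<And>\<xi>. \<bar>Im (psi \<xi>)\<bar> \<le> (d / C0) * norm \<xi> powr \<beta> + K"
    using Im[of "d / C0"] d C0 by auto
  have "\<exists>\<epsilon>>0. \<exists>L. \<forall>t>0. small_moment \<beta> \<epsilon> t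
      \<le> ennreal (t * (d + C0 * (d / C0) + L * t))"
    by (rule moment[rule_format]) (use K d C0 in auto)
  then obtain \<epsilon> L where \<epsilon>: "0 < \<epsilon>"
    and mom: "\<And>t. 0 < t \<Longrightarrow> small_moment \<beta> \<epsilon> t \<le> ennreal (t * (d + C0 * (d / C0) + L * t))"
    by blast
  define t0 where "t0 = d / (\<bar>L\<bar> + 1)"
  have t0: "0 < t0" using d by (simp add: t0_def add_nonneg_pos)
  have "(\<integral>x. near (min \<epsilon> 1) F x \<partial>P t) \<le> \<delta> * t" if t: "0 < t" "t < t0" for t
  proof -
    have "L * t \<le> (\<bar>L\<bar> + 1) * t" using t by (intro mult_right_mono) auto
    also have "\<dots> \<le> d" using t by (simp add: t0_def field_simps)
    finally have "d + C0 * (d / C0) + L * t \<le> 3 * d" using C0 by simp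
    then have "t * (d + C0 * (d / C0) + L * t) \<le> t * (3 * d)" using t by (intro mult_left_mono) auto
    then have m: "small_moment \<beta> \<epsilon> t \<le> ennreal (t * (3 * d))"
      using mom[OF t(1)] by (meson ennreal_leI order_trans)
    have "(\<integral>x. near (min \<epsilon> 1) F x \<partial>P t) \<le> C * (t * (3 * d))"
      by (rule integral_small_le[OF _ _ _ _ C(2) _ m]) (use t d C in auto)
    also have "\<dots> = C * (3 * d) * t" by (simp only: mult_ac)
    finally show ?thesis unfolding d(2) .
  qed
  then show "\<exists>\<epsilon>>0. \<exists>t0>0. \<forall>t. 0 < t \<longrightarrow> t < t0 \<longrightarrow>
        (\<integral>x. near \<epsilon> F x \<partial>P t) \<le> \<delta> * t"
    using \<epsilon> t0 by (intro exI[of _ "min \<epsilon> 1"] conjI exI[of _ t0]) auto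
qed

text \<open>When \<open>\<eta>\<close> cannot be made small, the \<open>\<beta>\<close>-th moment over a ball is still \<open>O(t)\<close>, which suffices
  for functions of smaller order than \<open>norm x powr \<beta>\<close>.\<close>

lemma tendsto_integral_of_little_o:
  fixes F :: "real ^ 'd \<Rightarrow> real"
  assumes \<beta>: "0 < \<beta>" "\<beta> < 2" and int: "finite_small_moment \<beta>"
    and Im: "0 \<le> \<eta>" "0 \<le> K" "\<And>\<xi>. \<bar>Im (psi \<xi>)\<bar> \<le> \<eta> * norm \<xi> powr \<beta> + K"
    and cont: "continuous_on UNIV F" and bd: "\<And>x. \<bar>F x\<bar> \<le> B" and intF: "integrable \<nu> F"
    and o: "\<And>e. 0 < e \<Longrightarrow> \<exists>\<rho>>0. \<forall>x. norm x < \<rho> \<longrightarrow> \<bar>F x\<bar> \<le> e * norm x powr \<beta>"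
    and s: "\<And>n. 0 < s n" "s \<longlonglongrightarrow> 0"
  shows "(\<lambda>n. (\<integral>x. F x \<partial>P (s n)) / s n) \<longlonglongrightarrow> (\<integral>x. F x \<partial>\<nu>)"
proof (rule tendsto_integral_of_small_jumps[OF cont bd intF _ s])
  note [measurable] = borel_measurable_continuous_onI[OF cont]
  fix \<delta> :: real assume \<delta>: "0 < \<delta>"
  obtain C0 where C0: "0 < C0" and moment: "\<forall>\<eta>\<ge>0. \<forall>K\<ge>0. (\<forall>\<xi>. \<bar>Im (psi \<xi>)\<bar> \<le> \<eta> * norm \<xi> powr \<beta> + K) \<longrightarrow>
    (\<forall>\<delta>>0. \<exists>\<epsilon>>0. \<exists>L. \<forall>t>0.
      small_moment \<beta> \<epsilon> t \<le> ennreal (t * (\<delta> + C0 * \<eta> + L * t)))"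
    using small_jump_moment[OF \<beta> int] by (elim exE conjE)
  have "\<exists>\<epsilon>>0. \<exists>L. \<forall>t>0. small_moment \<beta> \<epsilon> t
      \<le> ennreal (t * (1 + C0 * \<eta> + L * t))"
    by (rule moment[rule_format, of \<eta> K]) (use Im in auto)
  then obtain \<epsilon> L where \<epsilon>: "0 < \<epsilon>"
    and mom: "\<And>t. 0 < t \<Longrightarrow> small_moment \<beta> \<epsilon> t \<le> ennreal (t * (1 + C0 * \<eta> + L * t))"
    by blast
  define A where "A = 1 + C0 * \<eta> + \<bar>L\<bar>"
  have A: "0 < A" using C0 Im(1) by (simp add: A_def add_pos_nonneg)
  obtain \<rho> where \<rho>: "0 < \<rho>" "\<And>x. norm x < \<rho> \<Longrightarrow> \<bar>F x\<bar> \<le> (\<delta> / A) * norm x powr \<beta>"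
    using o[of "\<delta> / A"] \<delta> A by auto
  have "(\<integral>x. near (min \<epsilon> \<rho>) F x \<partial>P t) \<le> \<delta> * t" if t: "0 < t" "t < 1" for t
  proof -
    have "L * t \<le> \<bar>L\<bar> * 1" using t by (intro mult_mono) auto
    then have "t * (1 + C0 * \<eta> + L * t) \<le> t * A" using t by (intro mult_left_mono) (auto simp: A_def)
    then have m: "small_moment \<beta> \<epsilon> t \<le> ennreal (t * A)"
      using mom[OF t(1)] by (meson ennreal_leI order_trans)
    have "(\<integral>x. near (min \<epsilon> \<rho>) F x \<partial>P t) \<le> (\<delta> / A) * (t * A)"
      by (rule integral_small_le[OF _ _ _ _ \<rho>(2) _ m]) (use t A \<delta> in auto)
    then show ?thesis using A by simp
  qed
  then show "\<exists>\<epsilon>>0. \<exists>t0>0. \<forall>t. 0 < t \<longrightarrow> t < t0 \<longrightarrow>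
        (\<integral>x. near \<epsilon> F x \<partial>P t) \<le> \<delta> * t"
    using \<epsilon> \<rho>(1) by (intro exI[of _ "min \<epsilon> \<rho>"] conjI exI[of _ 1]) auto
qed

text \<open>The tail estimate for a bounded exponent is uniform in the radius, which can therefore tend to \<open>0\<close>.\<close>

lemma measure_nonzero_le:
  assumes K: "\<And>\<xi>. norm (psi \<xi>) \<le> K" and t: "0 \<le> t"
  shows "measure (P t) {x. x \<noteq> 0} \<le> 8 * t * (real CARD('d) * K)"
proof -
  interpret prob_space "P t" by (rule prob) fact
  interpret N: prob_space std_normal by (rule prob_space_std_normal)
  have sp: "{x. 1 / real (Suc n) \<le> norm x} \<in> sets (P t)" for n
    unfolding sets_P[OF t] by measurable
  have le: "measure (P t) {x. 1 / real (Suc n) \<le> norm x} \<le> 8 * t * (real CARD('d) * K)" for n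
  proof -
    have psi_int: "(\<integral>s. norm (psi (s *\<^sub>R v)) \<partial>std_normal) \<le> K" for v
    proof -
      have "(\<integral>s. norm (psi (s *\<^sub>R v)) \<partial>std_normal) \<le> (\<integral>s. K \<partial>std_normal)"
        by (intro integral_mono integrable_norm_psi N.integrable_const K)
      then show ?thesis using N.prob_space by simp
    qed
    have "measure (P t) {x. 1 / real (Suc n) \<le> norm x}
        \<le> 8 * t * (\<Sum>b\<in>Basis. \<integral>s. norm (psi (s *\<^sub>R ((real CARD('d) / (1 / real (Suc n))) *\<^sub>R b))) \<partial>std_normal)"
      by (rule measure_tail_le[OF t]) simp
    also have "\<dots> \<le> 8 * t * (\<Sum>b\<in>(Basis :: (real ^ 'd) set). K)"
      using t by (intro mult_left_mono sum_mono psi_int) auto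
    finally show ?thesis by simp
  qed
  have "incseq (\<lambda>n. {x :: real ^ 'd. 1 / real (Suc n) \<le> norm x})"
  proof (intro incseq_SucI subsetI)
    fix n and x :: "real ^ 'd" assume "x \<in> {x. 1 / real (Suc n) \<le> norm x}"
    moreover have "1 / real (Suc (Suc n)) \<le> 1 / real (Suc n)" by (intro divide_left_mono) auto
    ultimately show "x \<in> {x. 1 / real (Suc (Suc n)) \<le> norm x}" by (auto intro: order_trans)
  qed
  then have "(\<lambda>n. measure (P t) {x. 1 / real (Suc n) \<le> norm x}) \<longlonglongrightarrow> measure (P t) (\<Union>n. {x. 1 / real (Suc n) \<le> norm x})"
    using sp by (intro finite_Lim_measure_incseq) auto
  moreover have "(\<Union>n. {x :: real ^ 'd. 1 / real (Suc n) \<le> norm x}) = {x. x \<noteq> 0}"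
  proof (intro equalityI subsetI)
    fix x :: "real ^ 'd" assume "x \<in> {x. x \<noteq> 0}"
    then obtain n where "inverse (real (Suc n)) < norm x" using reals_Archimedean[of "norm x"] by auto
    then show "x \<in> (\<Union>n. {x. 1 / real (Suc n) \<le> norm x})" by (auto simp: inverse_eq_divide intro!: exI[of _ n])
  next
    fix x :: "real ^ 'd" assume "x \<in> (\<Union>n. {x. 1 / real (Suc n) \<le> norm x})"
    then obtain n where "1 / real (Suc n) \<le> norm x" by blast
    moreover have "0 < 1 / real (Suc n)" by simp
    ultimately show "x \<in> {x. x \<noteq> 0}" by auto
  qed
  ultimately show ?thesis using le by (intro LIMSEQ_le_const2) auto
qed

text \<open>Since \<open>P t\<close> charges the complement of the origin with mass \<open>O(t)\<close>, continuity of \<open>F\<close> with \<open>F 0 = 0\<close> suffices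
  near the origin.\<close>

lemma tendsto_integral_bounded_exponent:
  fixes F :: "real ^ 'd \<Rightarrow> real"
  assumes K: "0 \<le> K" "\<And>\<xi>. norm (psi \<xi>) \<le> K"
    and cont: "continuous_on UNIV F" and bd: "\<And>x. \<bar>F x\<bar> \<le> B" and intF: "integrable \<nu> F" and F0: "F 0 = 0"
    and s: "\<And>n. 0 < s n" "s \<longlonglongrightarrow> 0"
  shows "(\<lambda>n. (\<integral>x. F x \<partial>P (s n)) / s n) \<longlonglongrightarrow> (\<integral>x. F x \<partial>\<nu>)"
proof (rule tendsto_integral_of_small_jumps[OF cont bd intF _ s])
  note [measurable] = borel_measurable_continuous_onI[OF cont]
  fix \<delta> :: real assume \<delta>: "0 < \<delta>"
  define A where "A = 8 * (real CARD('d) * K) + 1"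
  have A: "0 < A" using K(1) by (simp add: A_def add_nonneg_pos)
  have "isCont F 0" using cont by (simp add: continuous_on_eq_continuous_at)
  moreover have "0 < \<delta> / A" using \<delta> A by simp
  ultimately obtain \<epsilon> where "0 < \<epsilon>" "\<forall>x. dist x 0 < \<epsilon> \<longrightarrow> dist (F x) (F 0) < \<delta> / A"
    unfolding continuous_at_eps_delta by blast
  then have \<epsilon>: "0 < \<epsilon>" "\<And>x. norm x < \<epsilon> \<Longrightarrow> \<bar>F x\<bar> < \<delta> / A" using F0 by (auto simp: dist_norm)
  have "(\<integral>x. near \<epsilon> F x \<partial>P t) \<le> \<delta> * t" if t: "0 < t" for t
  proof -
    have t': "0 \<le> t" using t by simp
    interpret prob_space "P t" by (rule prob) fact
    note [measurable_cong] = sets_P[OF t']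
    have nz: "{x. x \<noteq> 0} \<in> sets (P t)" unfolding sets_P[OF t'] by measurable
    have "(\<integral>x. near \<epsilon> F x \<partial>P t) \<le> (\<integral>x. (\<delta> / A) * indicator {x. x \<noteq> 0} x \<partial>P t)"
    proof (rule integral_mono)
      show "integrable (P t) (\<lambda>x. near \<epsilon> F x)"
        using bd order_trans[OF abs_ge_zero bd[of 0]]
        by (intro integrable_P_bounded[OF t', where B = B]) (auto simp: indicator_def)
      show "integrable (P t) (\<lambda>x. (\<delta> / A) * indicator {x. x \<noteq> 0} x)"
        using \<delta> A by (intro integrable_P_bounded[OF t', where B = "\<delta> / A"]) (auto simp: indicator_def)
      show "near \<epsilon> F x \<le> (\<delta> / A) * indicator {x. x \<noteq> 0} x" for x
        using \<epsilon>(2)[of x] F0 \<delta> A by (auto simp: indicator_def less_imp_le)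
    qed
    also have "\<dots> = (\<delta> / A) * measure (P t) {x. x \<noteq> 0}" using nz space_P[OF t'] by simp
    also have "\<dots> \<le> (\<delta> / A) * (A * t)"
    proof (rule mult_left_mono)
      show "measure (P t) {x. x \<noteq> 0} \<le> A * t"
      proof -
        have "A * t = 8 * t * (real CARD('d) * K) + t"
          unfolding A_def distrib_right by (simp only: mult_ac mult_1)
        then show ?thesis using measure_nonzero_le[OF K(2) t'] t by linarith
      qed
    qed (use \<delta> A in simp)
    also have "\<dots> = \<delta> * t" using A by simp
    finally show ?thesis .
  qed
  then show "\<exists>\<epsilon>>0. \<exists>t0>0. \<forall>t. 0 < t \<longrightarrow> t < t0 \<longrightarrow>
        (\<integral>x. near \<epsilon> F x \<partial>P t) \<le> \<delta> * t"
    using \<epsilon>(1) by (intro exI[of _ \<epsilon>] conjI exI[of _ 1]) auto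
qed

text \<open>The power weight \<open>norm x powr \<beta>\<close> dominates the increment of \<open>r\<close>; for \<open>\<beta> = 0\<close> it carries no
  information at the origin and continuity of \<open>r\<close> takes over.\<close>

proposition small_time_bounded_variation:
  fixes r :: "real ^ 'd \<Rightarrow> real"
  assumes \<beta>: "0 \<le> \<beta>" "\<beta> \<le> 1" and int: "finite_small_moment \<beta>"
    and drift: "(LINT y:{y. norm y \<le> 1}|\<nu>. y) - \<gamma> = 0"
    and cont: "continuous_on UNIV r" and bd: "\<And>x. \<bar>r x\<bar> \<le> B"
    and C: "0 < C" "\<And>x. norm x < 1 \<Longrightarrow> \<bar>r x - r 0\<bar> \<le> C * norm x powr \<beta>"
  shows "integrable \<nu> (\<lambda>x. r x - r 0)"
    and "\<And>s. (\<And>n. 0 < s n) \<Longrightarrow> s \<longlonglongrightarrow> 0 \<Longrightarrow> (\<lambda>n. (\<integral>x. r x - r 0 \<partial>P (s n)) / s n) \<longlonglongrightarrow> (\<integral>x. r x - r 0 \<partial>\<nu>)"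
proof -
  note [measurable] = borel_measurable_continuous_onI[OF cont]
  have cont': "continuous_on UNIV (\<lambda>x. r x - r 0)" by (intro continuous_intros cont)
  have bd': "\<bar>r x - r 0\<bar> \<le> 2 * B" for x using bd[of x] bd[of 0] by linarith
  show intF: "integrable \<nu> (\<lambda>x. r x - r 0)"
    by (rule integrable_of_powr_bound[OF int _ bd' C(2)]) simp_all
  fix s :: "nat \<Rightarrow> real" assume s: "\<And>n. 0 < s n" "s \<longlonglongrightarrow> 0"
  show "(\<lambda>n. (\<integral>x. r x - r 0 \<partial>P (s n)) / s n) \<longlonglongrightarrow> (\<integral>x. r x - r 0 \<partial>\<nu>)"
  proof (cases "\<beta> = 0")
    case True
    obtain K where "0 \<le> K" "\<And>\<xi>. norm (psi \<xi>) \<le> K"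
      using psi_bounded_of_finite[OF int[unfolded True] drift] by blast
    then show ?thesis by (rule tendsto_integral_bounded_exponent[OF _ _ cont' bd' intF _ s]) simp
  next
    case False
    show ?thesis
      by (rule tendsto_integral_of_powr_bound[OF _ _ int _ cont' bd' C s])
         (use \<beta> False Im_psi_small_without_drift[OF \<beta> int drift] in auto)
  qed
qed

text \<open>A real exponent is even, so \<open>P t\<close> and its reflection have the same characteristic function.\<close>

lemma integral_P_symmetric:
  fixes r :: "real ^ 'd \<Rightarrow> real"
  assumes sym: "symmetric_measure \<nu>" "\<gamma> = 0" and t: "0 \<le> t"
    and cont: "continuous_on UNIV r" and bd: "\<And>x. \<bar>r x\<bar> \<le> B"
  shows "(\<integral>x. r (- x) \<partial>P t) = (\<integral>x. r x \<partial>P t)"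
proof -
  interpret prob_space "P t" by (rule prob) fact
  note [measurable_cong] = sets_P[OF t]
  note [measurable] = borel_measurable_continuous_onI[OF cont]
  have [measurable]: "uminus \<in> P t \<rightarrow>\<^sub>M borel" by measurable
  have psi_even: "psi (- \<xi>) = psi \<xi>" for \<xi>
    by (rule complex_eqI) (simp_all add: Re_psi Im_psi_symmetric[OF sym])
  have "(\<integral>x. r (- x) \<partial>P t) = (\<integral>x. r x \<partial>distr (P t) borel uminus)"
    by (rule integral_distr[symmetric]) measurable
  also have "\<dots> = (\<integral>x. r x \<partial>P t)"
  proof (rule integral_eq_of_charfun_eq[OF _ _ _ _ _ cont bd])
    show "finite_measure (distr (P t) borel uminus)" by (rule finite_measure_distr) measurable
    show "finite_measure (P t)" by (rule finite_measure_axioms)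
    fix \<xi> :: "real ^ 'd"
    have "charfun_of (distr (P t) borel uminus) \<xi> = charfun_of (P t) (- \<xi>)"
      by (subst integral_distr) auto
    then show "charfun_of (distr (P t) borel uminus) \<xi> = charfun_of (P t) \<xi>"
      unfolding charfun[OF t] psi_even .
  qed (simp_all add: sets_P[OF t])
  finally show ?thesis .
qed

text \<open>By symmetry of \<open>P t\<close> only the even part of \<open>r\<close> matters, and that is where the assumption \<open>C\<close> gives
  regularity; moreover \<open>\<eta> = 0\<close> is admissible in the moment estimate.\<close>

proposition small_time_symmetric:
  fixes r :: "real ^ 'd \<Rightarrow> real"
  assumes \<beta>: "0 < \<beta>" "\<beta> < 2" and int: "finite_small_moment \<beta>"
    and sym: "symmetric_measure \<nu>" "\<gamma> = 0"
    and cont: "continuous_on UNIV r" and bd: "\<And>x. \<bar>r x\<bar> \<le> B"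
    and C: "0 < C" "\<And>x. norm x < 1 \<Longrightarrow> \<bar>r x + r (- x) - 2 * r 0\<bar> \<le> C * norm x powr \<beta>"
  shows "integrable \<nu> (\<lambda>x. r x + r (- x) - 2 * r 0)"
    and "\<And>s. (\<And>n. 0 < s n) \<Longrightarrow> s \<longlonglongrightarrow> 0 \<Longrightarrow>
      (\<lambda>n. (\<integral>x. r x - r 0 \<partial>P (s n)) / s n) \<longlonglongrightarrow> 1 / 2 * (\<integral>x. r x + r (- x) - 2 * r 0 \<partial>\<nu>)"
proof -
  let ?F = "\<lambda>x. r x + r (- x) - 2 * r 0"
  have cont_m: "continuous_on UNIV (\<lambda>x. r (- x))"
    by (rule continuous_on_compose2[OF cont]) (auto intro!: continuous_intros)
  have cont': "continuous_on UNIV ?F" by (intro continuous_intros cont cont_m)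
  note [measurable] = borel_measurable_continuous_onI[OF cont]
  have bd': "\<bar>?F x\<bar> \<le> 4 * B" for x using bd[of x] bd[of "- x"] bd[of 0] by linarith
  show "integrable \<nu> ?F"
    by (rule integrable_of_powr_bound[OF int _ bd' C(2)]) simp_all
  fix s :: "nat \<Rightarrow> real" assume s: "\<And>n. 0 < s n" "s \<longlonglongrightarrow> 0"
  have s0: "0 \<le> s n" for n using s(1)[of n] by simp
  have "(\<lambda>n. (\<integral>x. ?F x \<partial>P (s n)) / s n) \<longlonglongrightarrow> (\<integral>x. ?F x \<partial>\<nu>)"
    by (rule tendsto_integral_of_powr_bound[OF \<beta> int _ cont' bd' C s])
       (auto simp: Im_psi_symmetric[OF sym] intro!: exI[of _ 0])
  then have "(\<lambda>n. 1 / 2 * ((\<integral>x. ?F x \<partial>P (s n)) / s n)) \<longlonglongrightarrow> 1 / 2 * (\<integral>x. ?F x \<partial>\<nu>)"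
    by (intro tendsto_intros)
  moreover have "1 / 2 * ((\<integral>x. ?F x \<partial>P (s n)) / s n) = (\<integral>x. r x - r 0 \<partial>P (s n)) / s n" for n
  proof -
    interpret prob_space "P (s n)" by (rule prob[OF s0])
    note I = integrable_P_bounded[OF s0, of _ B n]
    have i: "integrable (P (s n)) r" "integrable (P (s n)) (\<lambda>x. r (- x))"
      using bd by (auto intro!: I)
    have "(\<integral>x. ?F x \<partial>P (s n)) = 2 * (\<integral>x. r x - r 0 \<partial>P (s n))"
      using i integral_P_symmetric[OF sym s0 cont bd, of n] by simp
    then show ?thesis by simp
  qed
  ultimately show "(\<lambda>n. (\<integral>x. r x - r 0 \<partial>P (s n)) / s n) \<longlonglongrightarrow> 1 / 2 * (\<integral>x. ?F x \<partial>\<nu>)" by simp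
qed

text \<open>Subtracting \<open>sin (D \<bullet> x)\<close> instead of \<open>D \<bullet> x\<close> keeps the function bounded and removes the linear part,
  and the integral of the sine is the imaginary part of the characteristic function at \<open>D\<close>. Its
  derivative in time yields the drift term together with the compensator.\<close>

proposition small_time_general:
  fixes r :: "real ^ 'd \<Rightarrow> real"
  assumes \<beta>: "1 \<le> \<beta>" "\<beta> < 2" and int: "finite_small_moment \<beta>"
    and cont: "continuous_on UNIV r" and bd: "\<And>x. \<bar>r x\<bar> \<le> B" and D: "GDERIV r 0 :> D"
    and C: "0 < C" "\<And>x. norm x < 1 \<Longrightarrow> \<bar>r x - r 0 - x \<bullet> D\<bar> \<le> C * norm x powr \<beta>"
  shows "integrable \<nu> (\<lambda>x. r x - r 0 - x \<bullet> D * indicator {x. norm x \<le> 1} x)"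
    and "\<And>s. (\<And>n. 0 < s n) \<Longrightarrow> s \<longlonglongrightarrow> 0 \<Longrightarrow>
      (\<lambda>n. (\<integral>x. r x - r 0 \<partial>P (s n)) / s n) \<longlonglongrightarrow>
        \<gamma> \<bullet> D + (\<integral>x. r x - r 0 - x \<bullet> D * indicator {x. norm x \<le> 1} x \<partial>\<nu>)"
proof -
  let ?F = "\<lambda>x. r x - r 0 - sin (D \<bullet> x)"
  let ?S = "\<lambda>x. sin (D \<bullet> x) - (D \<bullet> x) * indicator {x. norm x \<le> 1} x"
  note [measurable] = borel_measurable_continuous_onI[OF cont]
  have cont': "continuous_on UNIV ?F" by (intro continuous_intros cont)
  have bd': "\<bar>?F x\<bar> \<le> 2 * B + 1" for x
    using bd[of x] bd[of 0] abs_sin_le_one[of "D \<bullet> x"] by linarith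
  define C' where "C' = C + 2 * norm D powr \<beta>"
  have sin_le: "\<bar>sin (D \<bullet> x) - D \<bullet> x\<bar> \<le> 2 * norm D powr p * norm x powr p" if "1 \<le> p" "p \<le> 2" for p x
  proof -
    have "\<bar>sin (D \<bullet> x) - D \<bullet> x\<bar> \<le> 2 * \<bar>D \<bullet> x\<bar> powr p" using that by (rule abs_sin_minus_self_le_powr)
    also have "\<dots> \<le> 2 * (norm D * norm x) powr p"
      using that Cauchy_Schwarz_ineq2[of D x] by (intro mult_left_mono powr_mono2) auto
    finally show ?thesis by (simp add: powr_mult)
  qed
  have C': "0 < C'" "\<And>x. norm x < 1 \<Longrightarrow> \<bar>?F x\<bar> \<le> C' * norm x powr \<beta>"
  proof -
    show "0 < C'" using C(1) by (simp add: C'_def add_pos_nonneg)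
    fix x :: "real ^ 'd" assume "norm x < 1"
    then have "\<bar>?F x\<bar> \<le> C * norm x powr \<beta> + 2 * norm D powr \<beta> * norm x powr \<beta>"
      using C(2)[of x] sin_le[of \<beta> x] \<beta> by (simp add: inner_commute)
    then show "\<bar>?F x\<bar> \<le> C' * norm x powr \<beta>" by (simp add: C'_def distrib_right)
  qed
  have intF: "integrable \<nu> ?F"
    by (rule integrable_of_powr_bound[OF int _ bd' C'(2)]) simp_all
  have intS: "integrable \<nu> ?S" by (rule integrable_sin_compensated)
  have sum_eq: "?F x + ?S x = r x - r 0 - x \<bullet> D * indicator {x. norm x \<le> 1} x" for x
    by (simp add: inner_commute)
  show "integrable \<nu> (\<lambda>x. r x - r 0 - x \<bullet> D * indicator {x. norm x \<le> 1} x)"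
    using Bochner_Integration.integrable_add[OF intF intS] unfolding sum_eq .
  fix s :: "nat \<Rightarrow> real" assume s: "\<And>n. 0 < s n" "s \<longlonglongrightarrow> 0"
  have s0: "0 \<le> s n" for n using s(1)[of n] by simp
  have limF: "(\<lambda>n. (\<integral>x. ?F x \<partial>P (s n)) / s n) \<longlonglongrightarrow> (\<integral>x. ?F x \<partial>\<nu>)"
  proof (cases "\<beta> = 1")
    case False
    then have \<beta>1: "1 < \<beta>" using \<beta> by simp
    show ?thesis
    proof (rule tendsto_integral_of_powr_bound[OF _ _ int _ cont' bd' C' s])
      fix \<eta> :: real assume \<eta>: "0 < \<eta>"
      obtain a K where a: "0 \<le> a" "0 \<le> K" "\<And>\<xi>. \<bar>Im (psi \<xi>)\<bar> \<le> \<eta> / 2 * norm \<xi> powr \<beta> + a * norm \<xi> + K"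
        using Im_psi_bound[OF \<beta>(1) _ int, of "\<eta> / 2"] \<beta> \<eta> by auto
      obtain K' where K': "0 \<le> K'" "\<And>u. 0 \<le> u \<Longrightarrow> a * u \<le> \<eta> / 2 * u powr \<beta> + K'"
        using linear_le_powr[OF \<beta>1 _ a(1), of "\<eta> / 2"] \<eta> by auto
      have "\<bar>Im (psi \<xi>)\<bar> \<le> \<eta> * norm \<xi> powr \<beta> + (K + K')" for \<xi>
        using a(3)[of \<xi>] K'(2)[of "norm \<xi>"] by simp
      then show "\<exists>K\<ge>0. \<forall>\<xi>. \<bar>Im (psi \<xi>)\<bar> \<le> \<eta> * norm \<xi> powr \<beta> + K"
        using a(2) K'(1) by (intro exI[of _ "K + K'"]) auto
    qed (use \<beta> in auto)
  next
    case True
    obtain a K where a: "0 \<le> a" "0 \<le> K" "\<And>\<xi>. \<bar>Im (psi \<xi>)\<bar> \<le> 1 * norm \<xi> powr \<beta> + a * norm \<xi> + K"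
      using Im_psi_bound[OF \<beta>(1) _ int, of 1] \<beta> by auto
    show ?thesis
    proof (rule tendsto_integral_of_little_o[OF _ _ int _ a(2) _ cont' bd' intF _ s])
      show "\<bar>Im (psi \<xi>)\<bar> \<le> (1 + a) * norm \<xi> powr \<beta> + K" for \<xi>
        using a(3)[of \<xi>] True by (simp add: distrib_right)
      fix e :: real assume e: "0 < e"
      have "(r has_derivative (\<lambda>h. h \<bullet> D)) (at 0)" using D by (simp add: gderiv_def)
      then obtain \<rho>1 where \<rho>1: "0 < \<rho>1" "\<And>x. norm x < \<rho>1 \<Longrightarrow> \<bar>r x - r 0 - x \<bullet> D\<bar> \<le> e / 2 * norm x"
        using e unfolding has_derivative_at_alt by (metis diff_zero half_gt_zero real_norm_def)
      \<comment> \<open>half of \<open>e\<close> for the derivative of \<open>r\<close>, half for the quadratic error of the sine\<close>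
      define \<rho> where "\<rho> = min \<rho>1 (e / (4 * ((norm D)\<^sup>2 + 1)))"
      have pos: "0 < 4 * ((norm D)\<^sup>2 + 1)" by (simp add: add_nonneg_pos)
      have "\<bar>?F x\<bar> \<le> e * norm x powr \<beta>" if "norm x < \<rho>" for x
      proof -
        have "2 * (norm D)\<^sup>2 * norm x \<le> 4 * ((norm D)\<^sup>2 + 1) * norm x / 2"
          by (simp add: distrib_right)
        also have "\<dots> \<le> e / 2"
          using that pos by (simp add: \<rho>_def field_simps)
        finally have "(2 * (norm D)\<^sup>2 * norm x) * norm x \<le> e / 2 * norm x"
          by (intro mult_right_mono) auto
        moreover have "\<bar>sin (D \<bullet> x) - D \<bullet> x\<bar> \<le> (2 * (norm D)\<^sup>2 * norm x) * norm x"
          using sin_le[of 2 x] by (simp add: powr_numeral power2_eq_square mult_ac)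
        moreover have "\<bar>r x - r 0 - D \<bullet> x\<bar> \<le> e / 2 * norm x"
          using \<rho>1(2)[of x] that by (simp add: \<rho>_def inner_commute)
        ultimately have "\<bar>?F x\<bar> \<le> e * norm x" by linarith
        then show ?thesis using True by simp
      qed
      moreover have "0 < \<rho>" using \<rho>1(1) e pos by (simp add: \<rho>_def)
      ultimately show "\<exists>\<rho>>0. \<forall>x. norm x < \<rho> \<longrightarrow> \<bar>?F x\<bar> \<le> e * norm x powr \<beta>" by blast
    qed (use \<beta> a(1) in auto)
  qed
  have sinP: "(\<integral>x. sin (D \<bullet> x) \<partial>P (s n)) / s n = Im ((exp (- of_real (s n) * psi D) - 1) / of_real (s n))" for n
  proof -
    have "(\<integral>x. sin (D \<bullet> x) \<partial>P (s n)) = (\<integral>x. Im (iexp (D \<bullet> x)) \<partial>P (s n))" by (simp add: Im_exp)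
    also have "\<dots> = Im (charfun_of (P (s n)) D)"
      by (rule integral_Im) (rule integrable_P_bounded[OF s0, where B = 1], auto)
    finally show ?thesis unfolding charfun[OF s0] by simp
  qed
  have limS: "(\<lambda>n. (\<integral>x. sin (D \<bullet> x) \<partial>P (s n)) / s n) \<longlonglongrightarrow> \<gamma> \<bullet> D + (\<integral>x. ?S x \<partial>\<nu>)"
  proof -
    have "(\<lambda>n. Im ((exp (- of_real (s n) * psi D) - 1) / of_real (s n))) \<longlonglongrightarrow> Im (- psi D)"
      by (intro tendsto_Im tendsto_exp_quotient s)
    moreover have "Im (- psi D) = \<gamma> \<bullet> D + (\<integral>x. ?S x \<partial>\<nu>)"
      by (simp add: Im_psi inner_commute[of \<gamma> D])
    ultimately show ?thesis unfolding sinP by simp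
  qed
  have split: "(\<integral>x. r x - r 0 \<partial>P (s n)) / s n = (\<integral>x. ?F x \<partial>P (s n)) / s n + (\<integral>x. sin (D \<bullet> x) \<partial>P (s n)) / s n" for n
  proof -
    have "integrable (P (s n)) ?F" by (rule integrable_P_bounded[OF s0, where B = "2 * B + 1"]) (use bd' in auto)
    moreover have "integrable (P (s n)) (\<lambda>x. sin (D \<bullet> x))"
      by (rule integrable_P_bounded[OF s0, where B = 1]) auto
    ultimately have "(\<integral>x. ?F x + sin (D \<bullet> x) \<partial>P (s n)) = (\<integral>x. ?F x \<partial>P (s n)) + (\<integral>x. sin (D \<bullet> x) \<partial>P (s n))"
      by (rule Bochner_Integration.integral_add)
    then show ?thesis by (simp add: add_divide_distrib)
  qed
  have limit: "(\<integral>x. ?F x \<partial>\<nu>) + (\<gamma> \<bullet> D + (\<integral>x. ?S x \<partial>\<nu>))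
      = \<gamma> \<bullet> D + (\<integral>x. r x - r 0 - x \<bullet> D * indicator {x. norm x \<le> 1} x \<partial>\<nu>)"
    using Bochner_Integration.integral_add[OF intF intS] unfolding sum_eq by simp
  show "(\<lambda>n. (\<integral>x. r x - r 0 \<partial>P (s n)) / s n) \<longlonglongrightarrow>
        \<gamma> \<bullet> D + (\<integral>x. r x - r 0 - x \<bullet> D * indicator {x. norm x \<le> 1} x \<partial>\<nu>)"
    using tendsto_add[OF limF limS] unfolding split limit .
qed

end

section \<open>Heat content\<close>

text \<open>The starting point is averaged first, which turns \<open>g\<close> into \<open>r\<close>.\<close>

lemma heat_content_eq_integral_law:
  assumes M: "prob_space M" and X[measurable]: "X t \<in> borel_measurable M"
    and g[measurable]: "g \<in> borel_measurable borel" and bdd: "bounded (range g)"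
    and \<mu>: "finite_measure \<mu>" and [measurable_cong]: "sets \<mu> = sets borel"
    and r: "\<And>x. r x = (\<integral>y. g (x + y) \<partial>\<mu>)"
  shows "heat_content M X g \<mu> t = (\<integral>\<omega>. r (X t \<omega>) \<partial>M)"
proof -
  interpret M: prob_space M by fact
  interpret \<mu>: finite_measure \<mu> by fact
  interpret S: pair_sigma_finite M \<mu> ..
  interpret F: finite_measure "M \<Otimes>\<^sub>M \<mu>"
    by (rule finite_measure_pair_measure) unfold_locales
  obtain G where G: "\<And>x. norm (g x) \<le> G" using bdd by (auto simp: bounded_iff)
  have int: "integrable (M \<Otimes>\<^sub>M \<mu>) (\<lambda>(\<omega>, x). g (x + X t \<omega>))"
    using G by (intro F.integrable_const_bound[where B = G]) (auto simp: case_prod_beta)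
  have "heat_content M X g \<mu> t = (\<integral>x. (\<integral>\<omega>. g (x + X t \<omega>) \<partial>M) \<partial>\<mu>)"
    by (simp add: heat_content_def expectation_from_def)
  also have "\<dots> = (\<integral>\<omega>. (\<integral>x. g (x + X t \<omega>) \<partial>\<mu>) \<partial>M)"
    by (rule S.Fubini_integral[OF int])
  finally show ?thesis by (simp add: r add.commute)
qed

theorem theorem1:
  fixes M :: "'w measure"
    and X :: "real \<Rightarrow> 'w \<Rightarrow> real ^ 'd"
    and \<gamma> :: "real ^ 'd"
    and \<nu> \<mu> :: "(real ^ 'd) measure"
    and \<beta> :: real
    and g r :: "real ^ 'd \<Rightarrow> real"
  assumes "levy_process M X"
    and "has_levy_triplet M X 0 \<gamma> \<nu>"
    and "0 \<le> \<beta>" "\<beta> < 2"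
    and "(\<integral>\<^sup>+ x\<in>{x. norm x < 1}. ennreal (norm x powr \<beta>) \<partial>\<nu>) < \<infinity>"
    and "g \<in> borel_measurable borel" "bounded (range g)"
    and "finite_measure \<mu>" "sets \<mu> = sets borel"
    and "\<And>x. r x = (\<integral>y. g (x + y) \<partial>\<mu>)"
    and "continuous_on UNIV r" "bounded (range r)"
  shows "(\<beta> \<le> 1 \<longrightarrow>
           (LINT y:{y. norm y \<le> 1}|\<nu>. y) - \<gamma> = 0 \<longrightarrow>
           (\<exists>C>0. \<forall>x. norm x < 1 \<longrightarrow> \<bar>r x - r 0\<bar> \<le> C * norm x powr \<beta>) \<longrightarrow>
             integrable \<nu> (\<lambda>x. r x - r 0) \<and>
             ((\<lambda>t. (heat_content M X g \<mu> t - heat_content M X g \<mu> 0) / t)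
               \<longlongrightarrow> (\<integral>x. (r x - r 0) \<partial>\<nu>)) (at_right 0))
       \<and> (1 \<le> \<beta> \<longrightarrow>
           \<gamma> = 0 \<longrightarrow> symmetric_measure \<nu> \<longrightarrow>
           (\<exists>C>0. \<forall>x. norm x < 1 \<longrightarrow> \<bar>r x + r (- x) - 2 * r 0\<bar> \<le> C * norm x powr \<beta>) \<longrightarrow>
             integrable \<nu> (\<lambda>x. r x + r (- x) - 2 * r 0) \<and>
             ((\<lambda>t. (heat_content M X g \<mu> t - heat_content M X g \<mu> 0) / t)
               \<longlongrightarrow> 1 / 2 * (\<integral>x. (r x + r (- x) - 2 * r 0) \<partial>\<nu>)) (at_right 0))
       \<and> (1 \<le> \<beta> \<longrightarrow>
           (\<forall>D. GDERIV r 0 :> D \<longrightarrow>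
             (\<exists>C>0. \<forall>x. norm x < 1 \<longrightarrow> \<bar>r x - r 0 - x \<bullet> D\<bar> \<le> C * norm x powr \<beta>) \<longrightarrow>
               integrable \<nu> (\<lambda>x. r x - r 0 - x \<bullet> D * indicator {x. norm x \<le> 1} x) \<and>
               ((\<lambda>t. (heat_content M X g \<mu> t - heat_content M X g \<mu> 0) / t)
                 \<longlongrightarrow> \<gamma> \<bullet> D
                     + (\<integral>x. (r x - r 0 - x \<bullet> D * indicator {x. norm x \<le> 1} x) \<partial>\<nu>))
                 (at_right 0)))"
proof -
  have M: "prob_space M" and X: "\<And>t. 0 \<le> t \<Longrightarrow> X t \<in> borel_measurable M"
    and X0: "AE \<omega> in M. X 0 \<omega> = 0"
    using assms(1) by (auto simp: levy_process_def)
  interpret M: prob_space M by (rule M)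
  interpret levy_laws \<gamma> \<nu> "\<lambda>t. distr M borel (X t)"
  proof (intro levy_laws.intro levy_jump_exponent.intro levy_laws_axioms.intro)
    show "levy_measure \<nu>" using assms(2) by (simp add: has_levy_triplet_def)
    fix t :: real assume t: "0 \<le> t"
    show "prob_space (distr M borel (X t))" by (rule M.prob_space_distr[OF X[OF t]])
    show "sets (distr M borel (X t)) = sets borel" by simp
    fix \<xi> :: "real ^ 'd"
    have "charfun_of (distr M borel (X t)) \<xi> = (\<integral>\<omega>. iexp (\<xi> \<bullet> X t \<omega>) \<partial>M)"
      by (rule integral_distr[OF X[OF t]]) measurable
    also have "\<dots> = exp (- of_real t * levy_exponent 0 \<gamma> \<nu> \<xi>)"
      using assms(2) t by (simp add: has_levy_triplet_def)
    finally show "charfun_of (distr M borel (X t)) \<xi> = exp (- of_real t * levy_exponent 0 \<gamma> \<nu> \<xi>)" .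
  qed
  note cont = assms(11)
  note r_measurable[measurable] = borel_measurable_continuous_onI[OF cont]
  obtain B where B: "\<And>x. \<bar>r x\<bar> \<le> B" using assms(12) by (auto simp: bounded_iff)
  have int: "finite_small_moment \<beta>"
  proof -
    have "(\<integral>\<^sup>+y. ennreal (norm (indicator {y. norm y < 1} y * norm y powr \<beta>)) \<partial>\<nu>)
        = (\<integral>\<^sup>+x\<in>{x. norm x < 1}. ennreal (norm x powr \<beta>) \<partial>\<nu>)"
      by (intro nn_integral_cong) (auto simp: indicator_def)
    then show ?thesis using assms(5) by (simp add: integrable_iff_bounded)
  qed
  have heat: "heat_content M X g \<mu> t = (\<integral>\<omega>. r (X t \<omega>) \<partial>M)" if "0 \<le> t" for t
    by (rule heat_content_eq_integral_law[where r = r]) (use M X[OF that] assms in auto)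
  have heat_0: "heat_content M X g \<mu> 0 = r 0"
  proof -
    have "(\<integral>\<omega>. r (X 0 \<omega>) \<partial>M) = (\<integral>\<omega>. r 0 \<partial>M)"
      by (rule integral_cong_AE) (use X0 X[of 0] in auto)
    then show ?thesis using heat[of 0] M.prob_space by simp
  qed
  have increment: "heat_content M X g \<mu> t - heat_content M X g \<mu> 0 = (\<integral>x. r x - r 0 \<partial>distr M borel (X t))"
    if t: "0 \<le> t" for t
  proof -
    interpret D: prob_space "distr M borel (X t)" by (rule M.prob_space_distr[OF X[OF t]])
    have "(\<integral>\<omega>. r (X t \<omega>) \<partial>M) = (\<integral>x. r x \<partial>distr M borel (X t))"
      by (rule integral_distr[symmetric, OF X[OF t]]) measurable
    moreover have "integrable (distr M borel (X t)) r"
      by (rule integrable_P_bounded[OF t, where B = B]) (use B in auto)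
    ultimately show ?thesis using heat[OF t] heat_0 D.prob_space by simp
  qed
  have lim: "((\<lambda>t. (heat_content M X g \<mu> t - heat_content M X g \<mu> 0) / t) \<longlongrightarrow> L) (at_right 0)"
    if seq: "\<And>s. (\<And>n. 0 < s n) \<Longrightarrow> s \<longlonglongrightarrow> 0 \<Longrightarrow>
      (\<lambda>n. (\<integral>x. r x - r 0 \<partial>distr M borel (X (s n))) / s n) \<longlonglongrightarrow> L" for L
  proof (rule tendsto_at_right_sequentially[of 0 1])
    fix s :: "nat \<Rightarrow> real" assume s: "\<And>n. 0 < s n" "s \<longlonglongrightarrow> 0"
    show "(\<lambda>n. (heat_content M X g \<mu> (s n) - heat_content M X g \<mu> 0) / s n) \<longlonglongrightarrow> L"
      unfolding increment[OF less_imp_le[OF s(1)]] by (rule seq[OF s])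
  qed simp
  show ?thesis
  proof (intro conjI impI allI)
    assume \<beta>: "\<beta> \<le> 1" and drift: "(LINT y:{y. norm y \<le> 1}|\<nu>. y) - \<gamma> = 0"
      and "\<exists>C>0. \<forall>x. norm x < 1 \<longrightarrow> \<bar>r x - r 0\<bar> \<le> C * norm x powr \<beta>"
    then obtain C where C: "0 < C" "\<And>x. norm x < 1 \<Longrightarrow> \<bar>r x - r 0\<bar> \<le> C * norm x powr \<beta>" by blast
    note main = small_time_bounded_variation[OF assms(3) \<beta> int drift cont B C]
    show "integrable \<nu> (\<lambda>x. r x - r 0)" by (rule main(1))
    show "((\<lambda>t. (heat_content M X g \<mu> t - heat_content M X g \<mu> 0) / t) \<longlongrightarrow> (\<integral>x. (r x - r 0) \<partial>\<nu>)) (at_right 0)"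
      by (rule lim[OF main(2)])
  next
    assume \<beta>: "1 \<le> \<beta>" and sym: "\<gamma> = 0" "symmetric_measure \<nu>"
      and "\<exists>C>0. \<forall>x. norm x < 1 \<longrightarrow> \<bar>r x + r (- x) - 2 * r 0\<bar> \<le> C * norm x powr \<beta>"
    then obtain C where C: "0 < C" "\<And>x. norm x < 1 \<Longrightarrow> \<bar>r x + r (- x) - 2 * r 0\<bar> \<le> C * norm x powr \<beta>" by blast
    have \<beta>0: "0 < \<beta>" using \<beta> by simp
    note main = small_time_symmetric[OF \<beta>0 assms(4) int sym(2,1) cont B C]
    show "integrable \<nu> (\<lambda>x. r x + r (- x) - 2 * r 0)" by (rule main(1))
    show "((\<lambda>t. (heat_content M X g \<mu> t - heat_content M X g \<mu> 0) / t)
        \<longlongrightarrow> 1 / 2 * (\<integral>x. (r x + r (- x) - 2 * r 0) \<partial>\<nu>)) (at_right 0)"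
      by (rule lim[OF main(2)])
  next
    fix D
    assume \<beta>: "1 \<le> \<beta>" and D: "GDERIV r 0 :> D"
      and "\<exists>C>0. \<forall>x. norm x < 1 \<longrightarrow> \<bar>r x - r 0 - x \<bullet> D\<bar> \<le> C * norm x powr \<beta>"
    then obtain C where C: "0 < C" "\<And>x. norm x < 1 \<Longrightarrow> \<bar>r x - r 0 - x \<bullet> D\<bar> \<le> C * norm x powr \<beta>" by blast
    note main = small_time_general[OF \<beta> assms(4) int cont B D C]
    show "integrable \<nu> (\<lambda>x. r x - r 0 - x \<bullet> D * indicator {x. norm x \<le> 1} x)" by (rule main(1))
    show "((\<lambda>t. (heat_content M X g \<mu> t - heat_content M X g \<mu> 0) / t)
        \<longlongrightarrow> \<gamma> \<bullet> D + (\<integral>x. (r x - r 0 - x \<bullet> D * indicator {x. norm x \<le> 1} x) \<partial>\<nu>)) (at_right 0)"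
      by (rule lim[OF main(2)])
  qed
qed

end
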